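(* For any bipartite quantum channel $\mathcal N_{AB\to A'B'}$, $\gamma^{\infty}_{\mathrm{PPT}}(\mathcal N)\ge 2^{R^{2\to2}_{\max}(\mathcal N)}$.
   Context: All Hilbert spaces are finite-dimensional; $\log$ is base 2. Alice holds $A$ (input) and $A'$ (output), Bob holds $B$, $B'$. The unnormalized Choi operator of $\mathcal M_{AB\to A'B'}$ is $J^{\mathcal M}_{ABA'B'}=\sum_{i,j}|i\rangle\langle j|_{AB}\otimes\mathcal M(|i\rangle\langle j|_{AB})$. A bipartite channel is PPT if $(J^{\mathcal M}_{ABA'B'})^{T_{BB'}}\ge0$. $\gamma_{\mathrm{PPT}}(\mathcal N)=\inf\{c_1+c_2:\mathcal N=c_1\mathcal M_1-c_2\mathcal M_2,\ c_i\ge0,\ \mathcal M_i\text{ PPT channels}\}$; for $n\ge1$, $\gamma^{(n)}_{\mathrm{PPT}}(\mathcal N)=(\gamma_{\mathrm{PPT}}(\mathcal N^{\otimes n}))^{1/n}$ with PPT taken with respect to Alice $(A^n,A'^n)$ : Bob $(B^n,B'^n)$, and $\gamma^{\infty}_{\mathrm{PPT}}(\mathcal N)=\lim_{n\to\infty}\gamma^{(n)}_{\mathrm{PPT}}(\mathcal N)$. The bidirectional max-Rains information is $R^{2\to2}_{\max}(\mathcal N)=\log\Gamma^{2\to2}(\mathcal N)$, where $\Gamma^{2\to2}(\mathcal N)=\inf\{\|\mathrm{tr}_{A'B'}(V_{ABA'B'}+Y_{ABA'B'})\|_\infty:\ V,Y\ge0,\ (V-Y)^{T_{BB'}}\ge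 J^{\mathcal N}_{ABA'B'}\}$. *)

theory Defs
  imports Complex_Main "Jordan_Normal_Form.Matrix"
begin

(* Operators on finite-dimensional Hilbert spaces are complex matrices (Jordan_Normal_Form).
   A composite system with local dimensions ds = [d_0,...,d_{m-1}] has basis indices
   encoded in big-endian mixed radix:  i = sum_k digit_k * prod (drop (k+1) ds). *)

definition suffix_prod :: "nat list \<Rightarrow> nat \<Rightarrow> nat" where
  "suffix_prod ds k = prod_list (drop (Suc k) ds)"

definition digit :: "nat list \<Rightarrow> nat \<Rightarrow> nat \<Rightarrow> nat" where
  "digit ds i k = (i div suffix_prod ds k) mod (ds ! k)"

definition mix_index :: "nat list \<Rightarrow> nat set \<Rightarrow> nat \<Rightarrow> nat \<Rightarrow> nat" where
  "mix_index ds S i j = (\<Sum>k<length ds. (if k \<in> S then digit ds j k else digit ds i k) * suffix_prod ds k)"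

definition ptrans :: "nat list \<Rightarrow> nat set \<Rightarrow> complex mat \<Rightarrow> complex mat" where
  "ptrans ds S X = mat (prod_list ds) (prod_list ds)
      (\<lambda>(i, j). X $$ (mix_index ds S i j, mix_index ds S j i))"

definition psd :: "complex mat \<Rightarrow> bool" where
  "psd A \<longleftrightarrow> A \<in> carrier_mat (dim_row A) (dim_row A) \<and>
     (\<forall>v. dim_vec v = dim_row A \<longrightarrow>
        (let z = (\<Sum>i<dim_row A. cnj (v $ i) * (A *\<^sub>v v) $ i) in Im z = 0 \<and> Re z \<ge> 0))"

definition loewner_ge :: "complex mat \<Rightarrow> complex mat \<Rightarrow> bool" where
  "loewner_ge A B \<longleftrightarrow> dim_row A = dim_row B \<and> dim_col A = dim_col B \<and> psd (A - B)"

definition mtrace :: "complex mat \<Rightarrow> complex" where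
  "mtrace A = (\<Sum>i<dim_row A. A $$ (i, i))"

definition mat_unit :: "nat \<Rightarrow> nat \<Rightarrow> nat \<Rightarrow> complex mat" where
  "mat_unit d i j = mat d d (\<lambda>(k, l). if k = i \<and> l = j then 1 else 0)"

(* unnormalized Choi operator  sum_{i,j} |i><j| (x) Phi(|i><j|), input factor first *)
definition choi :: "nat \<Rightarrow> nat \<Rightarrow> (complex mat \<Rightarrow> complex mat) \<Rightarrow> complex mat" where
  "choi dIn dOut \<Phi> = mat (dIn * dOut) (dIn * dOut)
     (\<lambda>(r, c). \<Phi> (mat_unit dIn (r div dOut) (c div dOut)) $$ (r mod dOut, c mod dOut))"

definition is_channel :: "nat \<Rightarrow> nat \<Rightarrow> (complex mat \<Rightarrow> complex mat) \<Rightarrow> bool" where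
  "is_channel dIn dOut \<Phi> \<longleftrightarrow>
     (\<forall>X \<in> carrier_mat dIn dIn. \<Phi> X \<in> carrier_mat dOut dOut \<and> mtrace (\<Phi> X) = mtrace X) \<and>
     (\<forall>X \<in> carrier_mat dIn dIn. \<forall>Y \<in> carrier_mat dIn dIn. \<Phi> (X + Y) = \<Phi> X + \<Phi> Y) \<and>
     (\<forall>c. \<forall>X \<in> carrier_mat dIn dIn. \<Phi> (c \<cdot>\<^sub>m X) = c \<cdot>\<^sub>m \<Phi> X) \<and>
     psd (choi dIn dOut \<Phi>)"

(* PPT channel for a multipartite system with input factors insD, output factors outD;
   S = positions (in the Choi factor list insD @ outD) belonging to Bob *)
definition ppt_channel :: "nat list \<Rightarrow> nat list \<Rightarrow> nat set \<Rightarrow> (complex mat \<Rightarrow> complex mat) \<Rightarrow> bool" where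
  "ppt_channel insD outD S M \<longleftrightarrow>
     is_channel (prod_list insD) (prod_list outD) M \<and>
     psd (ptrans (insD @ outD) S (choi (prod_list insD) (prod_list outD) M))"

definition gamma_PPT :: "nat list \<Rightarrow> nat list \<Rightarrow> nat set \<Rightarrow> (complex mat \<Rightarrow> complex mat) \<Rightarrow> real" where
  "gamma_PPT insD outD S \<Phi> = Inf {c1 + c2 | c1 c2 M1 M2.
      c1 \<ge> 0 \<and> c2 \<ge> 0 \<and> ppt_channel insD outD S M1 \<and> ppt_channel insD outD S M2 \<and>
      (\<forall>X \<in> carrier_mat (prod_list insD) (prod_list insD).
          \<Phi> X = complex_of_real c1 \<cdot>\<^sub>m M1 X - complex_of_real c2 \<cdot>\<^sub>m M2 X)}"

definition tensor_map :: "nat \<Rightarrow> nat \<Rightarrow> nat \<Rightarrow> nat \<Rightarrow> (complex mat \<Rightarrow> complex mat) \<Rightarrow>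
    (complex mat \<Rightarrow> complex mat) \<Rightarrow> complex mat \<Rightarrow> complex mat" where
  "tensor_map d1 d2 e1 e2 \<Phi> \<Psi> X = mat (e1 * e2) (e1 * e2) (\<lambda>(r, c).
     \<Sum>i1<d1. \<Sum>j1<d1. \<Sum>i2<d2. \<Sum>j2<d2.
        X $$ (i1 * d2 + i2, j1 * d2 + j2) *
        \<Phi> (mat_unit d1 i1 j1) $$ (r div e2, c div e2) *
        \<Psi> (mat_unit d2 i2 j2) $$ (r mod e2, c mod e2))"

fun tensor_pow :: "nat \<Rightarrow> nat \<Rightarrow> (complex mat \<Rightarrow> complex mat) \<Rightarrow> nat \<Rightarrow> complex mat \<Rightarrow> complex mat" where
  "tensor_pow dIn dOut \<Phi> 0 = (\<lambda>X. X)"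
| "tensor_pow dIn dOut \<Phi> (Suc n) = tensor_map (dIn ^ n) dIn (dOut ^ n) dOut (tensor_pow dIn dOut \<Phi> n) \<Phi>"

(* gamma^{(n)}_PPT for a bipartite channel N_{AB -> A'B'}; tensor factors of N^{(x)n} are
   ordered A1 B1 A2 B2 ... (input) and A'1 B'1 ... (output); Bob owns the odd positions *)
definition gamma_PPT_n :: "nat \<Rightarrow> nat \<Rightarrow> nat \<Rightarrow> nat \<Rightarrow> (complex mat \<Rightarrow> complex mat) \<Rightarrow> nat \<Rightarrow> real" where
  "gamma_PPT_n dA dB dA' dB' N n =
     (gamma_PPT (concat (replicate n [dA, dB])) (concat (replicate n [dA', dB'])) {k. odd k}
        (tensor_pow (dA * dB) (dA' * dB') N n)) powr (1 / real n)"

definition gamma_PPT_inf :: "nat \<Rightarrow> nat \<Rightarrow> nat \<Rightarrow> nat \<Rightarrow> (complex mat \<Rightarrow> complex mat) \<Rightarrow> real" where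
  "gamma_PPT_inf dA dB dA' dB' N = lim (\<lambda>n. gamma_PPT_n dA dB dA' dB' N (Suc n))"

definition ptrace_out :: "nat \<Rightarrow> nat \<Rightarrow> complex mat \<Rightarrow> complex mat" where
  "ptrace_out dIn dOut X = mat dIn dIn (\<lambda>(i, j). \<Sum>k<dOut. X $$ (i * dOut + k, j * dOut + k))"

definition cvec_norm :: "complex vec \<Rightarrow> real" where
  "cvec_norm v = sqrt (\<Sum>i<dim_vec v. (cmod (v $ i))\<^sup>2)"

definition op_norm :: "complex mat \<Rightarrow> real" where
  "op_norm A = Sup {cvec_norm (A *\<^sub>v v) | v. dim_vec v = dim_col A \<and> cvec_norm v \<le> 1}"

definition Gamma22 :: "nat \<Rightarrow> nat \<Rightarrow> nat \<Rightarrow> nat \<Rightarrow> (complex mat \<Rightarrow> complex mat) \<Rightarrow> real" where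
  "Gamma22 dA dB dA' dB' N = Inf {op_norm (ptrace_out (dA * dB) (dA' * dB') (V + Y)) | V Y.
      V \<in> carrier_mat (dA * dB * (dA' * dB')) (dA * dB * (dA' * dB')) \<and>
      Y \<in> carrier_mat (dA * dB * (dA' * dB')) (dA * dB * (dA' * dB')) \<and>
      psd V \<and> psd Y \<and>
      loewner_ge (ptrans [dA, dB, dA', dB'] {1, 3} (V - Y)) (choi (dA * dB) (dA' * dB') N)}"

definition R22_max :: "nat \<Rightarrow> nat \<Rightarrow> nat \<Rightarrow> nat \<Rightarrow> (complex mat \<Rightarrow> complex mat) \<Rightarrow> real" where
  "R22_max dA dB dA' dB' N = log 2 (Gamma22 dA dB dA' dB' N)"

end

theory Submission
  imports Defs
begin

text \<open>
  \<open>\<Gamma>\<close> is the value of a semidefinite program. By strong duality there are \<open>R\<close> and \<open>\<rho>\<close> with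
  \<open>Tr \<rho> = 1\<close>, \<open>- \<rho> \<otimes> I \<le> R' \<le> \<rho> \<otimes> I\<close> and \<open>Tr J R \<ge> \<Gamma>\<close>, where \<open>J\<close> is the Choi operator of the
  channel and a prime denotes the partial transpose on Bob's systems. The two inequalities survive
  tensor powers, so \<open>R\<^sub>n = R \<otimes> \<dots> \<otimes> R\<close> and \<open>\<rho>\<^sub>n = \<rho> \<otimes> \<dots> \<otimes> \<rho>\<close> satisfy them for \<open>n\<close> copies,
  with \<open>Tr J\<^sub>n R\<^sub>n = (Tr J R)^n\<close>. If \<open>J\<^sub>n = c\<^sub>1 M\<^sub>1 - c\<^sub>2 M\<^sub>2\<close> with Choi operators \<open>M\<^sub>i\<close> of PPT channels,
  then \<open>\<bar>Tr M\<^sub>i R\<^sub>n\<bar> = \<bar>Tr M\<^sub>i' R\<^sub>n'\<bar> \<le> Tr M\<^sub>i' (\<rho>\<^sub>n \<otimes> I) = Tr \<rho>\<^sub>n = 1\<close>, hence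
  \<open>c\<^sub>1 + c\<^sub>2 \<ge> \<Gamma>^n\<close>. The limit exists by Fekete's lemma, because the PPT cost is
  submultiplicative under tensor products.
\<close>

section \<open>Positive semidefinite kernels\<close>

text \<open>Operators are handled as kernels on pairs (input, output) rather than as flattened
  matrices. In the interleaved order of the systems a tensor product is an entrywise product of two
  kernels pulled back along index maps, and the partial transpose exchanges Bob's digits between row
  and column. Their compatibility is then arithmetic on indices, and positivity of tensor products
  is the Schur product theorem. Gram decompositions stand in for the spectral theorem. The two dual
  inequalities have to be multiplied as a pair: each sign for the product uses both signs for the
  factors. The dual optimum is attained because the primal value, as a function of its right-hand
  side, is finite everywhere; the primal optimum is only approached, which costs an epsilon at the
  end. \<open>Inf\<close> and \<open>lim\<close> carry information only for nonempty sets bounded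
  below and for convergent sequences, so nonemptiness and convergence are proved along with the
  bound itself.\<close>

definition psd_on :: "'a set \<Rightarrow> ('a \<Rightarrow> 'a \<Rightarrow> complex) \<Rightarrow> bool" where
  "psd_on I A \<longleftrightarrow> (\<forall>x\<in>I. \<forall>y\<in>I. A y x = cnj (A x y)) \<and>
     (\<forall>v. 0 \<le> Re (\<Sum>x\<in>I. \<Sum>y\<in>I. cnj (v x) * A x y * v y))"

lemma psd_onI:
  assumes "\<And>x y. x \<in> I \<Longrightarrow> y \<in> I \<Longrightarrow> A y x = cnj (A x y)"
    and "\<And>v. 0 \<le> Re (\<Sum>x\<in>I. \<Sum>y\<in>I. cnj (v x) * A x y * v y)"
  shows "psd_on I A"
  unfolding psd_on_def using assms by blast

lemma psd_on_hermitian: "psd_on I A \<Longrightarrow> x \<in> I \<Longrightarrow> y \<in> I \<Longrightarrow> A y x = cnj (A x y)"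
  unfolding psd_on_def by blast

lemma psd_on_form: "psd_on I A \<Longrightarrow> 0 \<le> Re (\<Sum>x\<in>I. \<Sum>y\<in>I. cnj (v x) * A x y * v y)"
  unfolding psd_on_def by blast

lemma psd_on_cong:
  assumes "\<And>x y. x \<in> I \<Longrightarrow> y \<in> I \<Longrightarrow> A x y = B x y"
  shows "psd_on I A \<longleftrightarrow> psd_on I B"
proof -
  have "(\<Sum>x\<in>I. \<Sum>y\<in>I. cnj (v x) * A x y * v y) = (\<Sum>x\<in>I. \<Sum>y\<in>I. cnj (v x) * B x y * v y)" for v
    by (intro sum.cong refl) (simp add: assms)
  then show ?thesis unfolding psd_on_def using assms by auto
qed

text \<open>Symmetric Gaussian elimination: removing the index \<open>z\<close> leaves the Schur
  complement, positive on \<open>F\<close>, and the removed column supplies one more Gram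
  vector.\<close>

lemma psd_on_gram:
  assumes "finite I" "psd_on I A"
  shows "\<exists>(m::nat) a. \<forall>x\<in>I. \<forall>y\<in>I. A x y = (\<Sum>k<m. a k x * cnj (a k y))"
  using assms
proof (induction I arbitrary: A rule: finite_induct)
  case empty
  then show ?case by auto
next
  case (insert z F)
  define \<alpha> where "\<alpha> = Re (A z z)"
  have herm: "A y x = cnj (A x y)" if "x \<in> insert z F" "y \<in> insert z F" for x y
    using psd_on_hermitian[OF insert.prems that] .
  have Azz: "A z z = of_real \<alpha>"
    using herm[of z z] by (simp add: \<alpha>_def complex_eq_iff)
  have split: "(\<Sum>x\<in>insert z F. \<Sum>y\<in>insert z F. cnj (w x) * A x y * w y)
      = cnj s * s * A z z + cnj s * (\<Sum>y\<in>F. A z y * v y) + s * cnj (\<Sum>y\<in>F. A z y * v y)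
        + (\<Sum>x\<in>F. \<Sum>y\<in>F. cnj (v x) * A x y * v y)"
    if w: "w = v(z := s)" for v w s
  proof -
    have wz: "w z = s" and wF: "\<And>x. x \<in> F \<Longrightarrow> w x = v x" using insert.hyps w by auto
    have 1: "(\<Sum>x\<in>F. cnj (w x) * A x z * w z) = s * cnj (\<Sum>y\<in>F. A z y * v y)"
      unfolding cnj_sum sum_distrib_left
    proof (intro sum.cong refl)
      fix x assume "x \<in> F"
      then show "cnj (w x) * A x z * w z = s * cnj (A z x * v x)"
        using herm[of z x] wz wF by simp
    qed
    have 2: "(\<Sum>y\<in>F. cnj (w z) * A z y * w y) = cnj s * (\<Sum>y\<in>F. A z y * v y)"
      unfolding sum_distrib_left by (intro sum.cong refl) (simp add: wz wF)
    have 3: "(\<Sum>x\<in>F. \<Sum>y\<in>F. cnj (w x) * A x y * w y) = (\<Sum>x\<in>F. \<Sum>y\<in>F. cnj (v x) * A x y * v y)"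
      by (intro sum.cong refl) (simp add: wF)
    have "(\<Sum>x\<in>insert z F. \<Sum>y\<in>insert z F. cnj (w x) * A x y * w y)
      = cnj (w z) * A z z * w z + (\<Sum>y\<in>F. cnj (w z) * A z y * w y) + ((\<Sum>x\<in>F. cnj (w x) * A x z * w z)
        + (\<Sum>x\<in>F. \<Sum>y\<in>F. cnj (w x) * A x y * w y))"
      using insert.hyps by (simp add: sum.distrib)
    then show ?thesis unfolding 1 2 3 by (simp only: wz mult_ac add_ac)
  qed
  have nn: "0 \<le> \<alpha> * (cmod s)\<^sup>2 + 2 * Re (cnj s * (\<Sum>y\<in>F. A z y * v y))
        + Re (\<Sum>x\<in>F. \<Sum>y\<in>F. cnj (v x) * A x y * v y)" for v s
  proof -
    define w where "w = v(z := s)"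
    have re2: "Re (cnj s * b) + Re (s * cnj b) = 2 * Re (cnj s * b)" for s b :: complex
      by simp
    have "0 \<le> Re (\<Sum>x\<in>insert z F. \<Sum>y\<in>insert z F. cnj (w x) * A x y * w y)"
      using psd_on_form[OF insert.prems, of w] .
    also have "\<dots> = Re (cnj s * s * A z z) + 2 * Re (cnj s * (\<Sum>y\<in>F. A z y * v y))
        + Re (\<Sum>x\<in>F. \<Sum>y\<in>F. cnj (v x) * A x y * v y)"
      unfolding split[OF w_def] plus_complex.sel using re2[of s "\<Sum>y\<in>F. A z y * v y"] by linarith
    also have "Re (cnj s * s * A z z) = \<alpha> * (cmod s)\<^sup>2"
      unfolding Azz cmod_power2 by (simp add: power2_eq_square algebra_simps)
    finally show ?thesis .
  qed
  have "0 \<le> \<alpha>" using nn[of 1 "\<lambda>_. 0"] by simp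
  have zero_row: "A z y = 0" if "\<alpha> = 0" "y \<in> F" for y
  proof (rule ccontr)
    assume ne: "A z y \<noteq> 0"
    define v where "v = (\<lambda>x. if x = y then 1 else 0 :: complex)"
    define q where "q = Re (\<Sum>x\<in>F. \<Sum>y\<in>F. cnj (v x) * A x y * v y)"
    have b: "(\<Sum>y\<in>F. A z y * v y) = A z y"
      using that insert.hyps by (simp add: v_def if_distrib cong: if_cong)
    \<comment> \<open>For \<alpha> = 0 the form is affine in \<open>t\<close> with slope
      \<open>- 2 * (cmod (A z y))\<^sup>2\<close>; this \<open>t\<close> brings it down to
      \<open>q - \<bar>q\<bar> - 1\<close>, which is negative.\<close>
    define t where "t = (\<bar>q\<bar> + 1) / (2 * (cmod (A z y))\<^sup>2)"
    have "0 \<le> 2 * Re (cnj (- of_real t * A z y) * A z y) + q"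
      using nn[of "- of_real t * A z y" v] that unfolding q_def b by simp
    also have "Re (cnj (- of_real t * A z y) * A z y) = - t * (cmod (A z y))\<^sup>2"
      unfolding cmod_power2 by (simp add: power2_eq_square algebra_simps)
    finally have "2 * t * (cmod (A z y))\<^sup>2 \<le> q" by simp
    moreover have "2 * t * (cmod (A z y))\<^sup>2 = \<bar>q\<bar> + 1" using ne by (simp add: t_def)
    ultimately show False by linarith
  qed
  \<comment> \<open>Schur complement; for \<open>\<alpha> = 0\<close> the correction is 0 because \<open>x / 0 = 0\<close>.\<close>
  define A' where "A' x y = A x y - A x z * A z y / of_real \<alpha>" for x y
  have "psd_on F A'"
    unfolding psd_on_def
  proof (intro conjI ballI allI)
    fix x y assume "x \<in> F" "y \<in> F"
    then have "A y x = cnj (A x y)" "A y z = cnj (A z y)" "A z x = cnj (A x z)"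
      using herm[of x y] herm[of z y] herm[of x z] by simp_all
    then show "A' y x = cnj (A' x y)" by (simp add: A'_def)
  next
    fix v
    define b where "b = (\<Sum>y\<in>F. A z y * v y)"
    define q where "q = Re (\<Sum>x\<in>F. \<Sum>y\<in>F. cnj (v x) * A x y * v y)"
    have "(\<Sum>x\<in>F. \<Sum>y\<in>F. cnj (v x) * A' x y * v y)
       = (\<Sum>x\<in>F. \<Sum>y\<in>F. cnj (v x) * A x y * v y) - (\<Sum>x\<in>F. \<Sum>y\<in>F. (cnj (v x) * A x z) * (A z y * v y) / of_real \<alpha>)"
      unfolding A'_def sum_subtractf[symmetric] by (intro sum.cong refl) (simp add: algebra_simps)
    also have "(\<Sum>x\<in>F. \<Sum>y\<in>F. (cnj (v x) * A x z) * (A z y * v y) / of_real \<alpha>) = (\<Sum>x\<in>F. cnj (v x) * A x z) * b / of_real \<alpha>"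
      unfolding b_def sum_product by (simp add: sum_divide_distrib)
    also have "(\<Sum>x\<in>F. cnj (v x) * A x z) = cnj b"
      unfolding b_def cnj_sum
    proof (intro sum.cong refl)
      fix x assume "x \<in> F"
      then show "cnj (v x) * A x z = cnj (A z x * v x)" using herm[of z x] by simp
    qed
    finally have "Re (\<Sum>x\<in>F. \<Sum>y\<in>F. cnj (v x) * A' x y * v y) = q - Re (cnj b * b / of_real \<alpha>)"
      by (simp add: q_def)
    also have "Re (cnj b * b / of_real \<alpha>) = (cmod b)\<^sup>2 / \<alpha>"
    proof -
      have "cnj b * b / of_real \<alpha> = of_real ((cmod b)\<^sup>2 / \<alpha>)"
        unfolding of_real_divide complex_norm_square by (simp only: mult.commute)
      then show ?thesis by (simp only: Re_complex_of_real)
    qed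
    also have "0 \<le> q - (cmod b)\<^sup>2 / \<alpha>"
    proof (cases "\<alpha> = 0")
      case True
      then show ?thesis using nn[of 0 v] by (simp add: q_def)
    next
      case False
      \<comment> \<open>The value \<open>- b / of_real \<alpha>\<close> at \<open>z\<close>
        minimises the form over all extensions of \<open>v\<close>; the minimum is the form of the
        Schur complement.\<close>
      have "Re (cnj (- b / of_real \<alpha>) * b) = - (cmod b)\<^sup>2 / \<alpha>"
      proof -
        have "cnj (- b / of_real \<alpha>) * b = of_real (- (cmod b)\<^sup>2 / \<alpha>)"
          unfolding of_real_divide of_real_minus complex_norm_square by simp
        then show ?thesis by (simp only: Re_complex_of_real)
      qed
      moreover have "\<alpha> * (cmod (- b / of_real \<alpha>))\<^sup>2 = (cmod b)\<^sup>2 / \<alpha>"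
        using False by (simp add: norm_divide power_divide power2_eq_square)
      ultimately show ?thesis
        using nn[of "- b / of_real \<alpha>" v] unfolding b_def[symmetric] q_def[symmetric] minus_divide_left[symmetric] by linarith
    qed
    finally show "0 \<le> Re (\<Sum>x\<in>F. \<Sum>y\<in>F. cnj (v x) * A' x y * v y)" .
  qed
  then obtain m :: nat and a :: "nat \<Rightarrow> 'a \<Rightarrow> complex"
    where a: "\<And>x y. x \<in> F \<Longrightarrow> y \<in> F \<Longrightarrow> A' x y = (\<Sum>k<m. a k x * cnj (a k y))"
    using insert.IH by blast
  \<comment> \<open>The new vector, with index \<open>m\<close>, reproduces row and column
    \<open>z\<close>; the old ones are set to 0 at \<open>z\<close>. If \<alpha> = 0 the quotient is
    0, in agreement with \<open>zero_row\<close>.\<close>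
  define a' where "a' k x = (if k < m then (if x = z then 0 else a k x) else A x z / of_real (sqrt \<alpha>))" for k x
  have sq: "(of_real (sqrt \<alpha>) :: complex) * of_real (sqrt \<alpha>) = of_real \<alpha>"
    using \<open>0 \<le> \<alpha>\<close> by (simp flip: of_real_mult)
  have "A x y = (\<Sum>k<Suc m. a' k x * cnj (a' k y))" if xy: "x \<in> insert z F" "y \<in> insert z F" for x y
  proof -
    have last: "a' m x * cnj (a' m y) = A x z * A z y / of_real \<alpha>"
      using herm[of y z] xy sq by (simp add: a'_def)
    have "(\<Sum>k<m. a' k x * cnj (a' k y)) = (if x = z \<or> y = z then 0 else A' x y)"
      using a xy by (auto simp: a'_def)
    then have *: "(\<Sum>k<Suc m. a' k x * cnj (a' k y)) = (if x = z \<or> y = z then 0 else A' x y) + A x z * A z y / of_real \<alpha>"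
      using last by simp
    have z1: "A z z * A z y / of_real \<alpha> = A z y"
      using Azz zero_row[of y] xy by (cases "\<alpha> = 0") auto
    have "A x z = 0" if "\<alpha> = 0" "x \<noteq> z"
      using zero_row[of x] herm[of z x] xy that by simp
    then have z2: "A x z * A z z / of_real \<alpha> = A x z"
      using Azz by (cases "\<alpha> = 0"; cases "x = z") auto
    show ?thesis unfolding * using z1 z2 by (auto simp: A'_def)
  qed
  then show ?case by blast
qed

lemma sum_gram_form:
  fixes a :: "nat \<Rightarrow> 'a \<Rightarrow> complex"
  shows "(\<Sum>x\<in>I. \<Sum>y\<in>I. cnj (v x) * (\<Sum>k<m. a k x * cnj (a k y)) * v y) =
    (\<Sum>k<m. of_real ((cmod (\<Sum>x\<in>I. cnj (v x) * a k x))\<^sup>2))"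
proof -
  have "(\<Sum>x\<in>I. \<Sum>y\<in>I. cnj (v x) * (\<Sum>k<m. a k x * cnj (a k y)) * v y) =
      (\<Sum>x\<in>I. \<Sum>y\<in>I. \<Sum>k<m. (cnj (v x) * a k x) * cnj (cnj (v y) * a k y))"
    unfolding sum_distrib_left sum_distrib_right by (simp add: mult_ac)
  also have "\<dots> = (\<Sum>k<m. \<Sum>x\<in>I. \<Sum>y\<in>I. (cnj (v x) * a k x) * cnj (cnj (v y) * a k y))"
    by (subst sum.swap[of _ "{..<m}" I], subst sum.swap[of _ "{..<m}" I]) (rule refl)
  also have "\<dots> = (\<Sum>k<m. (\<Sum>x\<in>I. cnj (v x) * a k x) * cnj (\<Sum>x\<in>I. cnj (v x) * a k x))"
    unfolding cnj_sum sum_product ..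
  finally show ?thesis unfolding complex_norm_square .
qed

lemma psd_on_gramI:
  fixes a :: "nat \<Rightarrow> 'a \<Rightarrow> complex"
  assumes "\<And>x y. x \<in> I \<Longrightarrow> y \<in> I \<Longrightarrow> A x y = (\<Sum>k<m. a k x * cnj (a k y))"
  shows "psd_on I A"
proof -
  have "psd_on I (\<lambda>x y. \<Sum>k<m. a k x * cnj (a k y))"
    unfolding psd_on_def sum_gram_form by (auto simp: mult_ac intro!: sum_nonneg)
  then show ?thesis using psd_on_cong[of I A, OF assms] by blast
qed

text \<open>Gram vectors pull back along any map, injective or not. The tensor product uses this for
  \<open>hi\<close> and \<open>lo\<close>, which forget part of the index.\<close>

lemma psd_on_reindex:
  assumes "finite I" "psd_on I A" "\<And>x. x \<in> I' \<Longrightarrow> g x \<in> I"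
  shows "psd_on I' (\<lambda>x y. A (g x) (g y))"
proof -
  obtain m a where "\<forall>x\<in>I. \<forall>y\<in>I. A x y = (\<Sum>k<(m::nat). a k x * cnj (a k y))"
    using psd_on_gram[OF assms(1,2)] by blast
  then show ?thesis using assms(3) by (intro psd_on_gramI[where a = "\<lambda>k x. a k (g x)" and m = m]) auto
qed

lemma psd_on_add:
  assumes "psd_on I A" "psd_on I B"
  shows "psd_on I (\<lambda>x y. A x y + B x y)"
proof (rule psd_onI)
  fix x y assume "x \<in> I" "y \<in> I"
  then show "A y x + B y x = cnj (A x y + B x y)"
    using psd_on_hermitian[OF assms(1), of x y] psd_on_hermitian[OF assms(2), of x y] by simp
next
  fix v
  show "0 \<le> Re (\<Sum>x\<in>I. \<Sum>y\<in>I. cnj (v x) * (A x y + B x y) * v y)"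
    using psd_on_form[OF assms(1), of v] psd_on_form[OF assms(2), of v]
    by (simp only: distrib_left distrib_right sum.distrib plus_complex.sel)
qed

lemma psd_on_scale:
  assumes "psd_on I A" "0 \<le> c"
  shows "psd_on I (\<lambda>x y. of_real c * A x y)"
proof (rule psd_onI)
  fix x y assume "x \<in> I" "y \<in> I"
  then show "of_real c * A y x = cnj (of_real c * A x y)"
    using psd_on_hermitian[OF assms(1), of x y] by simp
next
  fix v
  have "(\<Sum>x\<in>I. \<Sum>y\<in>I. cnj (v x) * (of_real c * A x y) * v y) =
    of_real c * (\<Sum>x\<in>I. \<Sum>y\<in>I. cnj (v x) * A x y * v y)"
    unfolding sum_distrib_left by (simp add: mult_ac)
  then show "0 \<le> Re (\<Sum>x\<in>I. \<Sum>y\<in>I. cnj (v x) * (of_real c * A x y) * v y)"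
    using psd_on_form[OF assms(1), of v] assms(2) by simp
qed

lemma psd_on_zero: "psd_on I (\<lambda>x y. 0)"
  unfolding psd_on_def by simp

text \<open>Schur product theorem: expanding \<open>A\<close> in Gram vectors turns the form of the
  product into a sum of forms of \<open>B\<close>, each at \<open>v\<close> multiplied entrywise by
  a conjugated Gram vector.\<close>

lemma psd_on_schur:
  assumes "finite I" "psd_on I A" "psd_on I B"
  shows "psd_on I (\<lambda>x y. A x y * B x y)"
proof (rule psd_onI)
  fix x y assume "x \<in> I" "y \<in> I"
  then show "A y x * B y x = cnj (A x y * B x y)"
    using psd_on_hermitian[OF assms(2), of x y] psd_on_hermitian[OF assms(3), of x y] by simp
next
  fix v
  obtain m a where a: "\<forall>x\<in>I. \<forall>y\<in>I. A x y = (\<Sum>k<(m::nat). a k x * cnj (a k y))"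
    using psd_on_gram[OF assms(1,2)] by blast
  have "(\<Sum>x\<in>I. \<Sum>y\<in>I. cnj (v x) * (A x y * B x y) * v y) =
      (\<Sum>x\<in>I. \<Sum>y\<in>I. \<Sum>k<m. cnj (v x * cnj (a k x)) * B x y * (v y * cnj (a k y)))"
    by (intro sum.cong refl) (simp add: a sum_distrib_left sum_distrib_right mult_ac)
  also have "\<dots> = (\<Sum>k<m. \<Sum>x\<in>I. \<Sum>y\<in>I. cnj (v x * cnj (a k x)) * B x y * (v y * cnj (a k y)))"
    by (subst sum.swap[of _ "{..<m}" I], subst sum.swap[of _ "{..<m}" I]) (rule refl)
  finally have eq: "(\<Sum>x\<in>I. \<Sum>y\<in>I. cnj (v x) * (A x y * B x y) * v y) =
     (\<Sum>k<m. \<Sum>x\<in>I. \<Sum>y\<in>I. cnj (v x * cnj (a k x)) * B x y * (v y * cnj (a k y)))" .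
  show "0 \<le> Re (\<Sum>x\<in>I. \<Sum>y\<in>I. cnj (v x) * (A x y * B x y) * v y)"
    unfolding eq Re_sum[of _ "{..<m}"] by (intro sum_nonneg psd_on_form[OF assms(3)])
qed

text \<open>With Gram vectors \<open>a k\<close> of \<open>A\<close>, the trace of the product is
  the sum of the values of the form of \<open>B\<close> at the \<open>a k\<close>.\<close>

lemma psd_on_trace_nonneg:
  assumes "finite I" "psd_on I A" "psd_on I B"
  shows "0 \<le> Re (\<Sum>x\<in>I. \<Sum>y\<in>I. A x y * B y x)"
proof -
  obtain m a where a: "\<forall>x\<in>I. \<forall>y\<in>I. A x y = (\<Sum>k<(m::nat). a k x * cnj (a k y))"
    using psd_on_gram[OF assms(1,2)] by blast
  have "(\<Sum>x\<in>I. \<Sum>y\<in>I. A x y * B y x) = (\<Sum>x\<in>I. \<Sum>y\<in>I. \<Sum>k<m. cnj (a k y) * B y x * a k x)"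
    by (intro sum.cong refl) (simp add: a sum_distrib_left sum_distrib_right mult_ac)
  also have "\<dots> = (\<Sum>k<m. \<Sum>y\<in>I. \<Sum>x\<in>I. cnj (a k y) * B y x * a k x)"
    by (subst sum.swap[of _ "{..<m}" I], subst sum.swap[of _ "{..<m}" I], subst (2) sum.swap) (rule refl)
  finally have eq: "(\<Sum>x\<in>I. \<Sum>y\<in>I. A x y * B y x) = (\<Sum>k<m. \<Sum>y\<in>I. \<Sum>x\<in>I. cnj (a k y) * B y x * a k x)" .
  show ?thesis
    unfolding eq Re_sum[of _ "{..<m}"] by (intro sum_nonneg psd_on_form[OF assms(3)])
qed

lemma psd_on_diag_nonneg:
  assumes "finite I" "psd_on I A" "x \<in> I"
  shows "0 \<le> Re (A x x)"
  using psd_on_form[OF psd_on_reindex[OF assms(1,2), of "{x}" "\<lambda>x. x"], of "\<lambda>_. 1"] assms(3) by simp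

text \<open>All Gram vectors vanish when the diagonal does. This serves the weight
  \<open>c = 0\<close>, where a PPT kernel has zero partial trace.\<close>

lemma psd_on_zero_diag:
  assumes "finite I" "psd_on I A" "\<And>x. x \<in> I \<Longrightarrow> Re (A x x) = 0" "x \<in> I" "y \<in> I"
  shows "A x y = 0"
proof -
  obtain m a where a: "\<forall>x\<in>I. \<forall>y\<in>I. A x y = (\<Sum>k<(m::nat). a k x * cnj (a k y))"
    using psd_on_gram[OF assms(1,2)] by blast
  have "a k x = 0" if "k < m" for k
  proof -
    have "Re (A x x) = (\<Sum>k<m. (cmod (a k x))\<^sup>2)"
      using a assms(4) by (simp flip: complex_norm_square add: cmod_power2 power2_eq_square)
    then have "(\<Sum>k<m. (cmod (a k x))\<^sup>2) = 0" using assms by simp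
    then show ?thesis using that by (simp add: sum_nonneg_eq_0_iff)
  qed
  then have "(\<Sum>k<m. a k x * cnj (a k y)) = 0" by (intro sum.neutral) simp
  then show ?thesis using a assms(4,5) by metis
qed

lemma psd_on_rank_one: "psd_on I (\<lambda>x y. v x * cnj (v y))"
  by (rule psd_on_gramI[where m = "Suc 0" and a = "\<lambda>_. v"]) simp

text \<open>The sum of the moduli of all entries dominates the operator norm. The bound is crude but
  explicit, and supplies feasible points wherever a set has to be shown nonempty.\<close>

lemma psd_on_dominated:
  assumes "finite I" and herm: "\<And>x y. x \<in> I \<Longrightarrow> y \<in> I \<Longrightarrow> Z y x = cnj (Z x y)"
    and c: "(\<Sum>x\<in>I. \<Sum>y\<in>I. cmod (Z x y)) \<le> c"
  shows "psd_on I (\<lambda>x y. of_real c * (if x = y then 1 else 0) - Z x y)"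
proof (rule psd_onI)
  fix x y assume "x \<in> I" "y \<in> I"
  then show "of_real c * (if y = x then 1 else 0) - Z y x = cnj (of_real c * (if x = y then 1 else 0) - Z x y)"
    using herm[of x y] by simp
next
  fix v
  define S where "S = (\<Sum>x\<in>I. (cmod (v x))\<^sup>2)"
  have le: "(cmod (v x))\<^sup>2 \<le> S" if "x \<in> I" for x
    unfolding S_def using assms(1) that by (intro member_le_sum) auto
  have "cmod (\<Sum>x\<in>I. \<Sum>y\<in>I. cnj (v x) * Z x y * v y) \<le> (\<Sum>x\<in>I. \<Sum>y\<in>I. cmod (v x) * cmod (Z x y) * cmod (v y))"
    by (intro order.trans[OF norm_sum] sum_mono) (simp add: norm_mult)
  also have "\<dots> \<le> (\<Sum>x\<in>I. \<Sum>y\<in>I. cmod (Z x y) * S)"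
  proof (intro sum_mono)
    fix x y assume "x \<in> I" "y \<in> I"
    then have "2 * (cmod (v x) * cmod (v y)) \<le> 2 * S"
      using le[of x] le[of y] sum_squares_bound[of "cmod (v x)" "cmod (v y)"] by simp
    then have "cmod (Z x y) * (cmod (v x) * cmod (v y)) \<le> cmod (Z x y) * S"
      by (intro mult_left_mono) auto
    then show "cmod (v x) * cmod (Z x y) * cmod (v y) \<le> cmod (Z x y) * S"
      by (simp add: mult_ac)
  qed
  also have "\<dots> = (\<Sum>x\<in>I. \<Sum>y\<in>I. cmod (Z x y)) * S" by (simp add: sum_distrib_right)
  also have "\<dots> \<le> c * S" using c by (intro mult_right_mono) (auto simp: S_def sum_nonneg)
  finally have bound: "Re (\<Sum>x\<in>I. \<Sum>y\<in>I. cnj (v x) * Z x y * v y) \<le> c * S"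
    using complex_Re_le_cmod order.trans by blast
  have "(\<Sum>x\<in>I. \<Sum>y\<in>I. cnj (v x) * (of_real c * (if x = y then 1 else 0) - Z x y) * v y)
    = (\<Sum>x\<in>I. \<Sum>y\<in>I. if x = y then of_real c * (cnj (v x) * v y) else 0) - (\<Sum>x\<in>I. \<Sum>y\<in>I. cnj (v x) * Z x y * v y)"
    unfolding sum_subtractf[symmetric] by (intro sum.cong refl) (auto simp: algebra_simps)
  also have "(\<Sum>x\<in>I. \<Sum>y\<in>I. if x = y then of_real c * (cnj (v x) * v y) else 0) = of_real (c * S)"
    unfolding S_def of_real_mult of_real_sum complex_norm_square sum_distrib_left
    using assms(1) by (simp add: mult.commute)
  finally show "0 \<le> Re (\<Sum>x\<in>I. \<Sum>y\<in>I. cnj (v x) * (of_real c * (if x = y then 1 else 0) - Z x y) * v y)"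
    using bound by simp
qed

lemma psd_on_identity:
  assumes "finite I"
  shows "psd_on I (\<lambda>x y. if x = y then 1 else 0)"
proof -
  have "psd_on I (\<lambda>x y. of_real 1 * (if x = y then 1 else 0) - (\<lambda>_ _. 0) x y)"
    by (rule psd_on_dominated[OF assms]) simp_all
  then show ?thesis by simp
qed

text \<open>Self-duality of the positive cone; testing against rank-one \<open>V\<close> is
  enough.\<close>

lemma psd_on_traceI:
  assumes "finite I" and herm: "\<And>x y. x \<in> I \<Longrightarrow> y \<in> I \<Longrightarrow> A y x = cnj (A x y)"
    and "\<And>V. psd_on I V \<Longrightarrow> 0 \<le> Re (\<Sum>x\<in>I. \<Sum>y\<in>I. A x y * V y x)"
  shows "psd_on I A"
proof (rule psd_onI)
  fix v
  show "0 \<le> Re (\<Sum>x\<in>I. \<Sum>y\<in>I. cnj (v x) * A x y * v y)"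
    using assms(3)[OF psd_on_rank_one, of v] by (simp add: mult_ac)
qed (rule herm)

section \<open>Dominated functionals and subadditive sequences\<close>

definition sublinear_on_functions :: "(('i \<Rightarrow> real) \<Rightarrow> real) \<Rightarrow> bool" where
  "sublinear_on_functions p \<longleftrightarrow> p (\<lambda>_. 0) = 0 \<and> (\<forall>x y. p (\<lambda>i. x i + y i) \<le> p x + p y) \<and>
     (\<forall>t x. 0 < t \<longrightarrow> p (\<lambda>i. t * x i) = t * p x)"

text \<open>The reverse inequality in the homogeneity follows by scaling back with
  \<open>1 / t\<close>.\<close>

lemma sublinear_on_functionsI:
  assumes "p (\<lambda>_. 0) = 0" "\<And>x y. p (\<lambda>i. x i + y i) \<le> p x + p y"
    "\<And>t x. 0 < t \<Longrightarrow> p (\<lambda>i. t * x i) \<le> t * p x"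
  shows "sublinear_on_functions p"
proof -
  have "p (\<lambda>i. t * x i) = t * p x" if "0 < t" for t x
  proof (rule antisym[OF assms(3)[OF that]])
    have "p x \<le> (1 / t) * p (\<lambda>i. t * x i)"
      using assms(3)[of "1 / t" "\<lambda>i. t * x i"] that by simp
    then show "t * p x \<le> p (\<lambda>i. t * x i)" using that by (simp add: field_simps)
  qed
  then show ?thesis unfolding sublinear_on_functions_def using assms by blast
qed

context
  fixes p :: "('i \<Rightarrow> real) \<Rightarrow> real"
  assumes p: "sublinear_on_functions p"
begin

lemma sublinear_zero: "p (\<lambda>_. 0) = 0"
  using p unfolding sublinear_on_functions_def by blast

lemma sublinear_add: "p (\<lambda>i. x i + y i) \<le> p x + p y"
  using p unfolding sublinear_on_functions_def by blast

lemma sublinear_scale: "0 \<le> t \<Longrightarrow> p (\<lambda>i. t * x i) = t * p x"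
  using p sublinear_zero unfolding sublinear_on_functions_def by (cases "t = 0") auto

lemma sublinear_minus: "- p x \<le> p (\<lambda>i. - x i)"
  using sublinear_add[of x "\<lambda>i. - x i"] sublinear_zero by simp

text \<open>Hahn-Banach by shrinking the majorant instead of extending a functional:
  \<open>r x\<close> is the infimum of \<open>p (x + t e) - t * p e\<close> over
  \<open>t \<ge> 0\<close>. It stays sublinear, and \<open>r (- e) \<le> - p e\<close> forces
  \<open>r e = p e\<close>, so that \<open>r\<close> is linear along \<open>e\<close>.\<close>

lemma sublinear_step:
  "\<exists>r. sublinear_on_functions r \<and> (\<forall>x. r x \<le> p x) \<and> r (\<lambda>i. - e i) \<le> - p e"
proof -
  define S where "S x = (\<lambda>t. p (\<lambda>i. x i + t * e i) - t * p e) ` {0..}" for x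
  define r where "r x = Inf (S x)" for x
  \<comment> \<open>A bound independent of \<open>t\<close>, so that the infimum defining
    \<open>r\<close> is genuine and not a default value.\<close>
  have lower: "- p (\<lambda>i. - x i) \<le> s" if "s \<in> S x" for x s
  proof -
    obtain t where t: "0 \<le> t" "s = p (\<lambda>i. x i + t * e i) - t * p e"
      using \<open>s \<in> S x\<close> unfolding S_def by auto
    have "t * p e = p (\<lambda>i. (x i + t * e i) + - x i)"
      using sublinear_scale[OF t(1), of e] by simp
    also have "\<dots> \<le> p (\<lambda>i. x i + t * e i) + p (\<lambda>i. - x i)"
      by (rule sublinear_add)
    finally show ?thesis using t(2) by simp
  qed
  have bdd: "bdd_below (S x)" for x using lower[of _ x] by (rule bdd_belowI)
  have ne: "S x \<noteq> {}" for x by (simp add: S_def)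
  have le: "r x \<le> p (\<lambda>i. x i + t * e i) - t * p e" if "0 \<le> t" for x t
    unfolding r_def using that by (intro cInf_lower bdd) (simp add: S_def)
  have greatest: "c \<le> r x" if "\<And>t. 0 \<le> t \<Longrightarrow> c \<le> p (\<lambda>i. x i + t * e i) - t * p e" for c x
    unfolding r_def using that by (intro cInf_greatest ne) (auto simp: S_def)
  have "sublinear_on_functions r"
  proof (rule sublinear_on_functionsI)
    show "r (\<lambda>_. 0) = 0"
    proof (rule antisym)
      show "r (\<lambda>_. 0) \<le> 0" using le[of 0 "\<lambda>_. 0"] sublinear_zero by simp
      show "0 \<le> r (\<lambda>_. 0)" by (rule greatest) (simp add: sublinear_scale)
    qed
  next
    fix x y
    have *: "r (\<lambda>i. x i + y i) \<le> (p (\<lambda>i. x i + s * e i) - s * p e) + (p (\<lambda>i. y i + t * e i) - t * p e)"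
      if "0 \<le> s" "0 \<le> t" for s t
    proof -
      have "(\<lambda>i. (x i + y i) + (s + t) * e i) = (\<lambda>i. (x i + s * e i) + (y i + t * e i))"
        by (simp add: algebra_simps)
      then have "p (\<lambda>i. (x i + y i) + (s + t) * e i) \<le> p (\<lambda>i. x i + s * e i) + p (\<lambda>i. y i + t * e i)"
        using sublinear_add[of "\<lambda>i. x i + s * e i" "\<lambda>i. y i + t * e i"] by simp
      then show ?thesis
        using le[of "s + t" "\<lambda>i. x i + y i"] that by (simp add: algebra_simps)
    qed
    have "r (\<lambda>i. x i + y i) - (p (\<lambda>i. x i + s * e i) - s * p e) \<le> r y" if "0 \<le> s" for s
      using *[OF that] by (intro greatest) (simp add: algebra_simps)
    then have "r (\<lambda>i. x i + y i) - r y \<le> r x"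
      by (intro greatest) (simp add: algebra_simps)
    then show "r (\<lambda>i. x i + y i) \<le> r x + r y" by simp
  next
    fix t :: real and x
    assume t: "0 < t"
    have "r (\<lambda>i. t * x i) / t \<le> r x"
    proof (rule greatest)
      fix s :: real assume s: "0 \<le> s"
      have "r (\<lambda>i. t * x i) \<le> p (\<lambda>i. t * x i + (t * s) * e i) - (t * s) * p e"
        using le[of "t * s" "\<lambda>i. t * x i"] s t by simp
      also have "(\<lambda>i. t * x i + (t * s) * e i) = (\<lambda>i. t * (x i + s * e i))"
        by (simp add: algebra_simps)
      also have "p \<dots> = t * p (\<lambda>i. x i + s * e i)" using t by (intro sublinear_scale) simp
      finally show "r (\<lambda>i. t * x i) / t \<le> p (\<lambda>i. x i + s * e i) - s * p e"
        using t by (simp add: field_simps)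
    qed
    then show "r (\<lambda>i. t * x i) \<le> t * r x" using t by (simp add: field_simps)
  qed
  moreover have "r x \<le> p x" for x using le[of 0 x] by simp
  moreover have "r (\<lambda>i. - e i) \<le> - p e" using le[of 1 "\<lambda>i. - e i"] sublinear_zero by simp
  ultimately show ?thesis by blast
qed

text \<open>The hypothesis makes \<open>p\<close> odd at \<open>e\<close>, hence linear on its
  multiples; subadditivity used in both directions then gives equality.\<close>

lemma sublinear_add_linear_direction:
  assumes lin: "p (\<lambda>i. - e i) \<le> - p e"
  shows "p (\<lambda>i. x i + t * e i) = p x + t * p e"
proof -
  have neg: "p (\<lambda>i. - e i) = - p e" using lin sublinear_minus[of e] by simp
  have te: "p (\<lambda>i. t * e i) = t * p e" for t
  proof (cases "0 \<le> t")
    case False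
    then show ?thesis using sublinear_scale[of "- t" "\<lambda>i. - e i"] neg by simp
  qed (rule sublinear_scale)
  have "p x \<le> p (\<lambda>i. x i + t * e i) + p (\<lambda>i. - t * e i)"
    using sublinear_add[of "\<lambda>i. x i + t * e i" "\<lambda>i. - t * e i"] by simp
  then show ?thesis using sublinear_add[of x "\<lambda>i. t * e i"] te[of t] te[of "- t"] by simp
qed

end

text \<open>Linearity along \<open>e\<close> is inherited by every smaller sublinear functional, so
  directions can be treated one after another without losing the earlier ones.\<close>

lemma sublinear_linear_direction_mono:
  assumes "sublinear_on_functions p" "sublinear_on_functions r" "\<And>x. r x \<le> p x" "p (\<lambda>i. - e i) \<le> - p e"
  shows "r e = p e" "r (\<lambda>i. - e i) \<le> - r e"
  using sublinear_minus[OF assms(2), of e] assms(3)[of e] assms(3)[of "\<lambda>i. - e i"] assms(4) by auto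

lemma sublinear_linear_directions:
  assumes "finite E" "sublinear_on_functions p"
  shows "\<exists>r. sublinear_on_functions r \<and> (\<forall>x. r x \<le> p x) \<and> (\<forall>e\<in>E. r (\<lambda>i. - e i) \<le> - r e)"
  using assms
proof (induction E rule: finite_induct)
  case empty
  then show ?case by (intro exI[of _ p]) simp
next
  case (insert e F)
  then obtain q where q: "sublinear_on_functions q" "\<And>x. q x \<le> p x" "\<forall>e\<in>F. q (\<lambda>i. - e i) \<le> - q e"
    by blast
  from sublinear_step[OF q(1), of e] obtain r
    where r: "sublinear_on_functions r" "\<And>x. r x \<le> q x" "r (\<lambda>i. - e i) \<le> - q e"
    by blast
  have "r (\<lambda>i. - e i) \<le> - r e" using r(2)[of e] r(3) by simp
  moreover have "r (\<lambda>i. - f i) \<le> - r f" if "f \<in> F" for f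
    using sublinear_linear_direction_mono(2)[OF q(1) r(1,2)] q(3) that by blast
  moreover have "r x \<le> p x" for x using r(2) q(2) order.trans by blast
  ultimately show ?case using r(1) by blast
qed

text \<open>By \<open>local\<close> only the coordinates in \<open>I\<close> matter. Once every
  coordinate direction is linear, the weights are the values of the shrunken functional at the unit
  vectors.\<close>

lemma finite_hahn_banach:
  fixes p :: "('i \<Rightarrow> real) \<Rightarrow> real"
  assumes fin: "finite I" and p: "sublinear_on_functions p"
    and local: "\<And>x y. (\<And>i. i \<in> I \<Longrightarrow> x i = y i) \<Longrightarrow> p x = p y"
  obtains w where "\<And>x. (\<Sum>i\<in>I. w i * x i) \<le> p x" "(\<Sum>i\<in>I. w i * z i) = p z"
proof -
  define restr where "restr J x = (\<lambda>i. if i \<in> J then x i else 0 :: real)" for J and x :: "'i \<Rightarrow> real"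
  define b where "b k = (\<lambda>i. if i = k then 1 else 0 :: real)" for k :: 'i
  \<comment> \<open>The direction \<open>z\<close> comes first: from here on the value at
    \<open>z\<close> is frozen at \<open>p z\<close>, however much the later steps shrink the
    functional.\<close>
  obtain q where q: "sublinear_on_functions q" "\<And>x. q x \<le> p x" "q (\<lambda>i. - restr I z i) \<le> - p (restr I z)"
    using sublinear_step[OF p, of "restr I z"] by blast
  have q': "q (\<lambda>i. - restr I z i) \<le> - q (restr I z)" using q(2)[of "restr I z"] q(3) by simp
  have qz: "q (restr I z) = p (restr I z)"
    using sublinear_minus[OF q(1), of "restr I z"] q(2)[of "restr I z"] q(3) by simp
  obtain r where r: "sublinear_on_functions r" "\<And>x. r x \<le> q x" "\<forall>e\<in>b ` I. r (\<lambda>i. - e i) \<le> - r e"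
    using sublinear_linear_directions[of "b ` I", OF _ q(1)] fin by blast
  have rz: "r (restr I z) = p (restr I z)"
    using sublinear_linear_direction_mono(1)[OF q(1) r(1,2) q'] qz by simp
  have expand: "r (restr J x) = (\<Sum>i\<in>J. r (b i) * x i)" if "J \<subseteq> I" for J x
    using finite_subset[OF that fin] that
  proof (induction J rule: finite_induct)
    case empty
    then show ?case using sublinear_zero[OF r(1)] by (simp add: restr_def)
  next
    case (insert k F)
    have "restr (insert k F) x = (\<lambda>i. restr F x i + x k * b k i)"
      using insert.hyps by (auto simp: restr_def b_def)
    then have "r (restr (insert k F) x) = r (restr F x) + x k * r (b k)"
      using sublinear_add_linear_direction[OF r(1), of "b k" "restr F x" "x k"] r(3) insert.prems by simp
    then show ?case using insert by simp
  qed
  have eq: "p (restr I x) = p x" for x by (rule local) (simp add: restr_def)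
  show thesis
  proof
    show "(\<Sum>i\<in>I. r (b i) * x i) \<le> p x" for x
      using expand[of I x] r(2)[of "restr I x"] q(2)[of "restr I x"] eq[of x] by simp
    show "(\<Sum>i\<in>I. r (b i) * z i) = p z"
      using expand[of I z] rz eq[of z] by simp
  qed
qed

section \<open>Fekete's lemma for subadditive and submultiplicative sequences\<close>

lemma subadditive_average_convergent:
  fixes u :: "nat \<Rightarrow> real"
  assumes nonneg: "\<And>n. 1 \<le> n \<Longrightarrow> 0 \<le> u n"
    and sub: "\<And>m n. 1 \<le> m \<Longrightarrow> 1 \<le> n \<Longrightarrow> u (m + n) \<le> u m + u n"
  shows "convergent (\<lambda>n. u (Suc n) / real (Suc n))"
proof -
  define f where "f n = u (Suc n) / real (Suc n)" for n
  define L where "L = Inf (range f)"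
  have f_nonneg: "0 \<le> f n" for n unfolding f_def using nonneg[of "Suc n"] by simp
  have L_le: "L \<le> f n" for n
    unfolding L_def using f_nonneg by (intro cInf_lower bdd_belowI[of _ 0]) auto
  have mult: "u (q * k + r) \<le> real q * u k + u r" if "1 \<le> k" "1 \<le> r" for q k r
  proof (induction q)
    case (Suc q)
    have "u (Suc q * k + r) \<le> u k + u (q * k + r)"
      using sub[of k "q * k + r"] that by (simp add: add.assoc)
    then show ?case using Suc by (simp add: algebra_simps)
  qed simp
  have "f \<longlonglongrightarrow> L"
  proof (rule LIMSEQ_I)
    fix e :: real assume e: "0 < e"
    have "\<exists>x\<in>range f. x < L + e / 2"
      unfolding L_def using e by (intro cInf_lessD) auto
    then obtain j where j: "f j < L + e / 2" by auto
    define k where "k = Suc j"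
    define M where "M = (\<Sum>i\<in>{1..k}. u i)"
    have upper: "f n \<le> f j + M / real (Suc n)" for n
    proof -
      \<comment> \<open>The remainder runs through \<open>1..k\<close> and not
        \<open>0..k - 1\<close>, since nothing is known about \<open>u 0\<close>.\<close>
      define q r where "q = n div k" and "r = Suc (n mod k)"
      have k: "1 \<le> k" "r \<le> k" "1 \<le> r" by (auto simp: k_def r_def Suc_leI)
      have n: "Suc n = q * k + r" by (simp add: q_def r_def)
      have "u r \<le> M"
        unfolding M_def using k by (intro member_le_sum) (auto intro: nonneg)
      then have "u (Suc n) \<le> real q * u k + M" using mult[OF k(1,3), of q] n by simp
      also have "real q * u k \<le> real (Suc n) * f j"
      proof -
        have "real k * f j = u k" by (simp add: f_def k_def del: of_nat_Suc)
        then have "real q * u k = real (q * k) * f j" by (metis mult.assoc of_nat_mult)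
        also have "\<dots> \<le> real (Suc n) * f j" using n f_nonneg by (intro mult_right_mono) auto
        finally show ?thesis .
      qed
      finally have "u (Suc n) / real (Suc n) \<le> (real (Suc n) * f j + M) / real (Suc n)"
        by (intro divide_right_mono) simp_all
      also have "\<dots> = f j + M / real (Suc n)" by (simp add: add_divide_distrib del: of_nat_Suc)
      finally show ?thesis by (simp only: f_def[of n])
    qed
    have M: "0 \<le> M" unfolding M_def by (intro sum_nonneg nonneg) auto
    obtain N :: nat where N: "2 * M / e < real N" using reals_Archimedean2 by blast
    have "norm (f n - L) < e" if "N \<le> n" for n
    proof -
      have "2 * M / e < real (Suc n)" using N that by simp
      then have "M / real (Suc n) < e / 2" using e by (simp add: field_simps)
      then show ?thesis using upper[of n] j L_le[of n] unfolding real_norm_def by linarith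
    qed
    then show "\<exists>N. \<forall>n\<ge>N. norm (f n - L) < e" by blast
  qed
  then show ?thesis unfolding f_def convergent_def by blast
qed

lemma submultiplicative_root_convergent:
  fixes a :: "nat \<Rightarrow> real"
  assumes ge1: "\<And>n. 1 \<le> n \<Longrightarrow> 1 \<le> a n"
    and sub: "\<And>m n. 1 \<le> m \<Longrightarrow> 1 \<le> n \<Longrightarrow> a (m + n) \<le> a m * a n"
  shows "convergent (\<lambda>n. a (Suc n) powr (1 / real (Suc n)))"
proof -
  have pos: "0 < a n" if "1 \<le> n" for n using ge1[OF that] by simp
  have "convergent (\<lambda>n. ln (a (Suc n)) / real (Suc n))"
  proof (rule subadditive_average_convergent[where u = "\<lambda>n. ln (a n)"])
    fix m n :: nat assume mn: "1 \<le> m" "1 \<le> n"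
    then have "ln (a (m + n)) \<le> ln (a m * a n)" using sub pos by simp
    then show "ln (a (m + n)) \<le> ln (a m) + ln (a n)"
      using pos[OF mn(1)] pos[OF mn(2)] by (simp add: ln_mult)
  qed (use ge1 in simp)
  then obtain L where "(\<lambda>n. ln (a (Suc n)) / real (Suc n)) \<longlonglongrightarrow> L" unfolding convergent_def ..
  then have "(\<lambda>n. exp (ln (a (Suc n)) / real (Suc n))) \<longlonglongrightarrow> exp L" by (rule tendsto_exp)
  moreover have "exp (ln (a (Suc n)) / real (Suc n)) = a (Suc n) powr (1 / real (Suc n))" for n
    using pos[of "Suc n"] by (simp add: powr_def)
  ultimately show ?thesis unfolding convergent_def by auto
qed

section \<open>The index form of the partial transpose\<close>

text \<open>The even length of \<open>xs\<close> keeps the parity of the positions in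
  \<open>ys\<close>, so Bob's set \<open>{k. odd k}\<close> restricts to itself on both
  blocks.\<close>

lemma mix_index_append_odd:
  assumes "even (length xs)" "k < prod_list ys" "l < prod_list ys"
  shows "mix_index (xs @ ys) {k. odd k} (i * prod_list ys + k) (j * prod_list ys + l) =
    mix_index xs {k. odd k} i j * prod_list ys + mix_index ys {k. odd k} k l"
proof -
  define P where "P = prod_list ys"
  have P: "0 < P" using assms(2) by (cases P) (auto simp: P_def)
  have sp1: "suffix_prod (xs @ ys) t = suffix_prod xs t * P" if "t < length xs" for t
    using that by (simp add: suffix_prod_def P_def)
  have sp2: "suffix_prod (xs @ ys) (length xs + t) = suffix_prod ys t" for t
    by (simp add: suffix_prod_def)
  have dg1: "digit (xs @ ys) (i * P + k) t = digit xs i t" if "t < length xs" "k < P" for i k t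
  proof -
    have "(i * P + k) div (suffix_prod xs t * P) = (i * P + k) div P div suffix_prod xs t"
      by (metis div_mult2_eq mult.commute)
    then show ?thesis using that P by (simp add: digit_def sp1 nth_append)
  qed
  have dg2: "digit (xs @ ys) (i * P + k) (length xs + t) = digit ys k t" if "t < length ys" for i k t
  proof -
    have Pt: "P = prod_list (take t ys) * ys ! t * suffix_prod ys t"
      unfolding P_def suffix_prod_def
      by (metis id_take_nth_drop[OF that] prod_list.append prod_list.Cons mult.assoc)
    \<comment> \<open>The block \<open>xs\<close> contributes a multiple of
      \<open>ys ! t * suffix_prod ys t\<close>, which the digit at position \<open>t\<close> cannot
      see.\<close>
    then have eq: "i * P + k = k + (i * prod_list (take t ys) * ys ! t) * suffix_prod ys t"
      by (simp add: mult_ac)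
    have "suffix_prod ys t \<noteq> 0" using P Pt by (cases "suffix_prod ys t = 0") auto
    then have "(i * P + k) div suffix_prod ys t = i * prod_list (take t ys) * ys ! t + k div suffix_prod ys t"
      unfolding eq by simp
    then show ?thesis by (simp add: digit_def sp2)
  qed
  have split: "(\<Sum>t<m + n. f t) = (\<Sum>t<m. f t) + (\<Sum>t<n. f (m + t))" for m n and f :: "nat \<Rightarrow> nat"
    by (induction n) simp_all
  have "mix_index (xs @ ys) {k. odd k} (i * P + k) (j * P + l) =
    (\<Sum>t<length xs. (if odd t then digit xs j t else digit xs i t) * suffix_prod xs t * P) + mix_index ys {k. odd k} k l"
    unfolding mix_index_def length_append split
    using assms by (intro arg_cong2[where f = "(+)"] sum.cong refl)
      (auto simp: dg1 dg2 sp1 sp2 P_def[symmetric])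
  then show ?thesis unfolding P_def mix_index_def by (simp add: sum_distrib_right)
qed

text \<open>Alice's digits of \<open>i\<close> combined with Bob's digits of \<open>j\<close>: the
  row from which the partial transpose takes its entry at \<open>(i, j)\<close>.\<close>

definition swap_index :: "nat \<Rightarrow> nat \<Rightarrow> nat \<Rightarrow> nat \<Rightarrow> nat \<Rightarrow> nat" where
  "swap_index a b n i j = mix_index (concat (replicate n [a, b])) {k. odd k} i j"

lemma prod_list_replicate_pair: "prod_list (concat (replicate n [a, b])) = (a * b) ^ n" for a b :: nat
  by (induction n) (auto simp: mult_ac)

lemma length_replicate_pair: "length (concat (replicate n [a, b])) = 2 * n"
  by (induction n) auto

lemma swap_index_0: "swap_index a b 0 i j = 0"
  by (simp add: swap_index_def mix_index_def)

lemma swap_index_1: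
  assumes "0 < a" "0 < b" "i < a * b"
  shows "swap_index a b 1 i j = i div b * b + j mod b"
proof -
  have "i div b < a" using assms by (simp add: less_mult_imp_div_less)
  then show ?thesis
    by (simp add: swap_index_def mix_index_def digit_def suffix_prod_def lessThan_Suc numeral_2_eq_2)
qed

lemma swap_index_add:
  assumes "0 < a" "0 < b"
  shows "swap_index a b (m + n) i j =
    swap_index a b m (i div (a * b) ^ n) (j div (a * b) ^ n) * (a * b) ^ n +
    swap_index a b n (i mod (a * b) ^ n) (j mod (a * b) ^ n)"
proof -
  let ?P = "(a * b) ^ n"
  have "0 < ?P" using assms by simp
  then have "swap_index a b (m + n) (i div ?P * ?P + i mod ?P) (j div ?P * ?P + j mod ?P) =
    swap_index a b m (i div ?P) (j div ?P) * ?P + swap_index a b n (i mod ?P) (j mod ?P)"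
    unfolding swap_index_def replicate_add concat_append
    using mix_index_append_odd[of "concat (replicate m [a, b])" "i mod ?P" "concat (replicate n [a, b])" "j mod ?P"]
    unfolding prod_list_replicate_pair length_replicate_pair by simp
  then show ?thesis unfolding div_mult_mod_eq .
qed

lemma index_div_mod:
  fixes k P :: nat assumes "k < P"
  shows "(i * P + k) div P = i" "(i * P + k) mod P = k"
  using assms by auto

lemma index_less:
  fixes i k D P :: nat assumes "i < D" "k < P"
  shows "i * P + k < D * P"
proof -
  have "i * P + k < Suc i * P" using assms by simp
  also have "\<dots> \<le> D * P" using assms by (intro mult_right_mono) auto
  finally show ?thesis .
qed

lemma sum_lessThan_mult:
  fixes f :: "nat \<Rightarrow> 'c::comm_monoid_add"
  assumes "0 < d"
  shows "(\<Sum>i<c * d. f i) = (\<Sum>u<c. \<Sum>v<d. f (u * d + v))"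
proof -
  have "(\<Sum>i<c * d. f i) = (\<Sum>p\<in>{..<c} \<times> {..<d}. f (fst p * d + snd p))"
    by (rule sum.reindex_bij_witness[where i = "\<lambda>p. fst p * d + snd p" and j = "\<lambda>i. (i div d, i mod d)"])
      (use assms in \<open>auto simp: less_mult_imp_div_less index_less\<close>)
  then show ?thesis by (simp add: sum.cartesian_product case_prod_unfold)
qed

lemma swap_index_less:
  assumes "0 < a" "0 < b" "i < (a * b) ^ n"
  shows "swap_index a b n i j < (a * b) ^ n"
  using assms(3)
proof (induction n arbitrary: i j)
  case 0
  then show ?case by (simp add: swap_index_0)
next
  case (Suc n)
  have i: "i div (a * b) < (a * b) ^ n" using Suc.prems by (simp add: less_mult_imp_div_less mult.commute)
  have "swap_index a b 1 (i mod (a * b)) (j mod (a * b)) < a * b"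
    using assms swap_index_1[of a b "i mod (a * b)"]
    by (simp add: less_mult_imp_div_less index_less)
  then show ?case
    using index_less[OF Suc.IH[OF i, of "j div (a * b)"], of _ "a * b"] assms swap_index_add[of a b n 1 i j]
    by (simp add: mult.commute)
qed

text \<open>Exchanging Bob's digits between the two indices twice restores both; the induction
  splits off one copy at a time.\<close>

lemma swap_index_involution:
  assumes "0 < a" "0 < b" "i < (a * b) ^ n" "j < (a * b) ^ n"
  shows "swap_index a b n (swap_index a b n i j) (swap_index a b n j i) = i"
  using assms(3,4)
proof (induction n arbitrary: i j)
  case 0
  then show ?case by (simp add: swap_index_0)
next
  case (Suc n)
  let ?d = "a * b"
  have d: "0 < ?d" using assms by simp
  have base: "swap_index a b 1 i j < ?d"
    "swap_index a b 1 (swap_index a b 1 i j) (swap_index a b 1 j i) = i" if "i < ?d" "j < ?d" for i j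
  proof -
    have s: "swap_index a b 1 i j = i div b * b + j mod b" "swap_index a b 1 j i = j div b * b + i mod b"
      using that swap_index_1 assms by auto
    show l: "swap_index a b 1 i j < ?d" unfolding s
      using that assms by (intro index_less) (auto simp: less_mult_imp_div_less)
    show "swap_index a b 1 (swap_index a b 1 i j) (swap_index a b 1 j i) = i"
      using swap_index_1[OF assms(1,2) l] assms unfolding s by simp
  qed
  have i: "i div ?d < ?d ^ n" "j div ?d < ?d ^ n"
    using Suc.prems by (auto simp: less_mult_imp_div_less mult.commute)
  have ij: "i mod ?d < ?d" "j mod ?d < ?d" using d by auto
  have s: "swap_index a b (Suc n) x y =
    swap_index a b n (x div ?d) (y div ?d) * ?d + swap_index a b 1 (x mod ?d) (y mod ?d)" for x y
    using swap_index_add[of a b n 1 x y] assms by simp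
  show ?case
    unfolding s[of i j] s[of j i]
    unfolding s index_div_mod[OF base(1)[OF ij]] index_div_mod[OF base(1)[OF ij(2,1)]]
    unfolding Suc.IH[OF i] base(2)[OF ij] by (rule div_mult_mod_eq)
qed

lemma swap_index_same:
  assumes "0 < a" "0 < b" "i < (a * b) ^ n"
  shows "swap_index a b n i i = i"
  using assms(3)
proof (induction n arbitrary: i)
  case 0
  then show ?case by (simp add: swap_index_0)
next
  case (Suc n)
  have i: "i div (a * b) < (a * b) ^ n" using Suc.prems by (simp add: less_mult_imp_div_less mult.commute)
  have "swap_index a b 1 (i mod (a * b)) (i mod (a * b)) = i mod (a * b)"
    using assms swap_index_1[of a b "i mod (a * b)" "i mod (a * b)"] by simp
  then show ?case
    using Suc.IH[OF i] swap_index_add[OF assms(1,2), of n 1 i i] div_mult_mod_eq[of i "a * b"]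
    by (simp only: power_one_right Suc_eq_plus1)
qed

section \<open>Tensor products of kernels\<close>

locale bipartite_dims =
  fixes a b a' b' :: nat
  assumes dims_pos: "0 < a" "0 < b" "0 < a'" "0 < b'"
begin

definition d_in :: "nat \<Rightarrow> nat" where "d_in n = (a * b) ^ n"
definition d_out :: "nat \<Rightarrow> nat" where "d_out n = (a' * b') ^ n"

definition idx :: "nat \<Rightarrow> (nat \<times> nat) set" where "idx n = {..<d_in n} \<times> {..<d_out n}"

definition sw :: "nat \<Rightarrow> nat \<times> nat \<Rightarrow> nat \<times> nat \<Rightarrow> nat \<times> nat" where
  "sw n x y = (swap_index a b n (fst x) (fst y), swap_index a' b' n (snd x) (snd y))"

text \<open>The rows of a Choi kernel are pairs (input, output), so exchanging Bob's digits in both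
  components transposes B and B' together.\<close>

definition pt :: "nat \<Rightarrow> (nat \<times> nat \<Rightarrow> nat \<times> nat \<Rightarrow> complex) \<Rightarrow> nat \<times> nat \<Rightarrow> nat \<times> nat \<Rightarrow> complex" where
  "pt n P x y = P (sw n x y) (sw n y x)"

text \<open>The last \<open>n\<close> copies occupy the low-order digits, hence quotient and
  remainder.\<close>

definition hi :: "nat \<Rightarrow> nat \<times> nat \<Rightarrow> nat \<times> nat" where
  "hi n x = (fst x div d_in n, snd x div d_out n)"
definition lo :: "nat \<Rightarrow> nat \<times> nat \<Rightarrow> nat \<times> nat" where
  "lo n x = (fst x mod d_in n, snd x mod d_out n)"

text \<open>The parameter \<open>n\<close> counts the copies of the second factor only; the first
  factor receives whatever remains.\<close>

definition tens :: "nat \<Rightarrow> (nat \<times> nat \<Rightarrow> nat \<times> nat \<Rightarrow> complex) \<Rightarrow> (nat \<times> nat \<Rightarrow> nat \<times> nat \<Rightarrow> complex) \<Rightarrow>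
    nat \<times> nat \<Rightarrow> nat \<times> nat \<Rightarrow> complex" where
  "tens n P Q x y = P (hi n x) (hi n y) * Q (lo n x) (lo n y)"

fun kpow :: "(nat \<times> nat \<Rightarrow> nat \<times> nat \<Rightarrow> complex) \<Rightarrow> nat \<Rightarrow> nat \<times> nat \<Rightarrow> nat \<times> nat \<Rightarrow> complex" where
  "kpow J 0 = (\<lambda>_ _. 1)"
| "kpow J (Suc n) = tens 1 (kpow J n) J"

lemma d_pos [simp]: "0 < d_in n" "0 < d_out n"
  using dims_pos by (simp_all add: d_in_def d_out_def)

lemma d_add: "d_in (m + n) = d_in m * d_in n" "d_out (m + n) = d_out m * d_out n"
  by (simp_all add: d_in_def d_out_def power_add)

lemma finite_idx [simp]: "finite (idx n)"
  by (simp add: idx_def)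

lemma sum_idx: "(\<Sum>x\<in>idx n. f x) = (\<Sum>i<d_in n. \<Sum>k<d_out n. f (i, k))"
  unfolding idx_def sum.cartesian_product by simp

lemma sw_in_idx: "x \<in> idx n \<Longrightarrow> sw n x y \<in> idx n"
  using dims_pos swap_index_less by (auto simp: idx_def sw_def d_in_def d_out_def)

lemma sw_involution: "x \<in> idx n \<Longrightarrow> y \<in> idx n \<Longrightarrow> sw n (sw n x y) (sw n y x) = x"
  using dims_pos swap_index_involution by (auto simp: idx_def sw_def d_in_def d_out_def)

lemma hi_in_idx: "x \<in> idx (m + n) \<Longrightarrow> hi n x \<in> idx m"
  by (auto simp: idx_def hi_def d_add less_mult_imp_div_less)

lemma lo_in_idx: "lo n x \<in> idx n"
  by (auto simp: idx_def lo_def)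

lemma hi_sw: "hi n (sw (m + n) x y) = sw m (hi n x) (hi n y)"
  and lo_sw: "lo n (sw (m + n) x y) = sw n (lo n x) (lo n y)"
proof -
  have "swap_index a b n (fst x mod (a * b) ^ n) j < (a * b) ^ n" for j
    using dims_pos by (intro swap_index_less) auto
  moreover have "swap_index a' b' n (snd x mod (a' * b') ^ n) j < (a' * b') ^ n" for j
    using dims_pos by (intro swap_index_less) auto
  ultimately show "hi n (sw (m + n) x y) = sw m (hi n x) (hi n y)" "lo n (sw (m + n) x y) = sw n (lo n x) (lo n y)"
    unfolding sw_def hi_def lo_def d_in_def d_out_def fst_conv snd_conv
      swap_index_add[OF dims_pos(1,2)] swap_index_add[OF dims_pos(3,4)]
    by (simp_all add: index_div_mod)
qed

lemma pt_tens: "pt (m + n) (tens n P Q) = tens n (pt m P) (pt n Q)"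
  by (intro ext) (simp add: pt_def tens_def hi_sw lo_sw)

lemma sum_idx_tens:
  "(\<Sum>x\<in>idx (m + n). F (hi n x) (lo n x)) = (\<Sum>u\<in>idx m. \<Sum>v\<in>idx n. F u v)"
proof -
  have "(\<Sum>x\<in>idx (m + n). F (hi n x) (lo n x)) =
    (\<Sum>i<d_in m. \<Sum>i'<d_in n. \<Sum>k<d_out m. \<Sum>k'<d_out n. F (i, k) (i', k'))"
    unfolding sum_idx d_add
    by (simp add: sum_lessThan_mult hi_def lo_def index_div_mod)
  also have "\<dots> = (\<Sum>u\<in>idx m. \<Sum>v\<in>idx n. F u v)"
    unfolding sum_idx by (rule sum.cong[OF refl], rule sum.swap)
  finally show ?thesis .
qed

text \<open>An instance of the Schur product theorem, since a tensor product is the entrywise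
  product of two pulled-back kernels.\<close>

lemma psd_tens:
  assumes "psd_on (idx m) P" "psd_on (idx n) Q"
  shows "psd_on (idx (m + n)) (tens n P Q)"
proof -
  have "psd_on (idx (m + n)) (\<lambda>x y. P (hi n x) (hi n y))"
    by (rule psd_on_reindex[OF finite_idx assms(1) hi_in_idx])
  moreover have "psd_on (idx (m + n)) (\<lambda>x y. Q (lo n x) (lo n y))"
    by (rule psd_on_reindex[OF finite_idx assms(2) lo_in_idx])
  ultimately show ?thesis unfolding tens_def[abs_def] by (intro psd_on_schur finite_idx)
qed

lemma sum_out_tens:
  "(\<Sum>k<d_out (m + n). tens n P Q (i, k) (j, k)) =
    (\<Sum>k<d_out m. P (i div d_in n, k) (j div d_in n, k)) * (\<Sum>k<d_out n. Q (i mod d_in n, k) (j mod d_in n, k))"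
  unfolding d_add by (simp add: sum_lessThan_mult tens_def hi_def lo_def index_div_mod sum_product)

lemma div_mod_eq_iff: "i div d = j div d \<and> i mod d = j mod d \<longleftrightarrow> i = (j::nat)"
  by (metis div_mult_mod_eq)

text \<open>The partial trace over the output is \<open>c\<close> times the identity, as for the
  Choi kernel of a map that multiplies the trace by \<open>c\<close>.\<close>

definition marginal :: "nat \<Rightarrow> real \<Rightarrow> (nat \<times> nat \<Rightarrow> nat \<times> nat \<Rightarrow> complex) \<Rightarrow> bool" where
  "marginal n c P \<longleftrightarrow> (\<forall>i<d_in n. \<forall>j<d_in n. (\<Sum>k<d_out n. P (i, k) (j, k)) = (if i = j then of_real c else 0))"

lemma marginal_tens:
  assumes "marginal m c P" "marginal n e Q"
  shows "marginal (m + n) (c * e) (tens n P Q)"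
proof -
  have div: "i div d_in n < d_in m" if "i < d_in (m + n)" for i
    using that by (simp add: d_add less_mult_imp_div_less)
  show ?thesis
    unfolding marginal_def sum_out_tens
  proof (intro allI impI)
    fix i j assume ij: "i < d_in (m + n)" "j < d_in (m + n)"
    have P: "(\<Sum>k<d_out m. P (i div d_in n, k) (j div d_in n, k)) = (if i div d_in n = j div d_in n then of_real c else 0)"
      using assms(1) div ij unfolding marginal_def by blast
    have Q: "(\<Sum>k<d_out n. Q (i mod d_in n, k) (j mod d_in n, k)) = (if i mod d_in n = j mod d_in n then of_real e else 0)"
      using assms(2) unfolding marginal_def by simp
    show "(\<Sum>k<d_out m. P (i div d_in n, k) (j div d_in n, k)) * (\<Sum>k<d_out n. Q (i mod d_in n, k) (j mod d_in n, k)) =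
        (if i = j then of_real (c * e) else 0)"
      unfolding P Q using div_mod_eq_iff[of i "d_in n" j] by (cases "i = j") auto
  qed
qed

lemma marginal_add:
  assumes "marginal n c P" "marginal n e Q"
  shows "marginal n (c + e) (\<lambda>x y. P x y + Q x y)"
  using assms unfolding marginal_def by (auto simp: sum.distrib)

text \<open>On the output the exchange fixes the equal indices \<open>k, k\<close>, so the trace
  does not notice it; on the input it permutes pairs and preserves the diagonal.\<close>

lemma marginal_pt:
  assumes "marginal n c P"
  shows "marginal n c (pt n P)"
  unfolding marginal_def
proof (intro allI impI)
  fix i j assume ij: "i < d_in n" "j < d_in n"
  define s t where "s = swap_index a b n i j" and "t = swap_index a b n j i"
  have st: "s < d_in n" "t < d_in n" "s = t \<longleftrightarrow> i = j"
    using swap_index_less[OF dims_pos(1,2)] swap_index_involution[OF dims_pos(1,2)] ij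
    unfolding s_def t_def d_in_def by (auto, metis)
  have "(\<Sum>k<d_out n. pt n P (i, k) (j, k)) = (\<Sum>k<d_out n. P (s, k) (t, k))"
    using swap_index_same[OF dims_pos(3,4)]
    by (intro sum.cong refl) (simp add: pt_def sw_def s_def t_def d_out_def)
  then show "(\<Sum>k<d_out n. pt n P (i, k) (j, k)) = (if i = j then of_real c else 0)"
    using assms st unfolding marginal_def by simp
qed

text \<open>Choi kernel of \<open>c\<close> times a PPT channel. Carrying the weight inside makes
  these kernels closed under sums and tensor products, with weights adding and multiplying.\<close>

definition ppt_kernel :: "nat \<Rightarrow> real \<Rightarrow> (nat \<times> nat \<Rightarrow> nat \<times> nat \<Rightarrow> complex) \<Rightarrow> bool" where
  "ppt_kernel n c P \<longleftrightarrow> psd_on (idx n) P \<and> psd_on (idx n) (pt n P) \<and> marginal n c P"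

lemma ppt_kernel_tens:
  assumes "ppt_kernel m c P" "ppt_kernel n e Q"
  shows "ppt_kernel (m + n) (c * e) (tens n P Q)"
  using assms unfolding ppt_kernel_def pt_tens by (auto intro: psd_tens marginal_tens)

lemma ppt_kernel_add:
  assumes "ppt_kernel n c P" "ppt_kernel n e Q"
  shows "ppt_kernel n (c + e) (\<lambda>x y. P x y + Q x y)"
  using assms psd_on_add[of _ "pt n P" "pt n Q"] psd_on_add[of _ P Q] marginal_add
  unfolding ppt_kernel_def pt_def[abs_def] by blast

definition ppt_costs :: "nat \<Rightarrow> (nat \<times> nat \<Rightarrow> nat \<times> nat \<Rightarrow> complex) \<Rightarrow> real set" where
  "ppt_costs n J = {c1 + c2 | c1 c2 P1 P2. 0 \<le> c1 \<and> 0 \<le> c2 \<and> ppt_kernel n c1 P1 \<and> ppt_kernel n c2 P2 \<and>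
     (\<forall>x\<in>idx n. \<forall>y\<in>idx n. J x y = P1 x y - P2 x y)}"

lemma ppt_costs_tens:
  assumes "v \<in> ppt_costs m J" "w \<in> ppt_costs n K"
  shows "v * w \<in> ppt_costs (m + n) (tens n J K)"
proof -
  obtain c1 c2 P1 P2 where P: "v = c1 + c2" "0 \<le> c1" "0 \<le> c2" "ppt_kernel m c1 P1" "ppt_kernel m c2 P2"
    "\<forall>x\<in>idx m. \<forall>y\<in>idx m. J x y = P1 x y - P2 x y"
    using assms(1) unfolding ppt_costs_def by blast
  obtain e1 e2 Q1 Q2 where Q: "w = e1 + e2" "0 \<le> e1" "0 \<le> e2" "ppt_kernel n e1 Q1" "ppt_kernel n e2 Q2"
    "\<forall>x\<in>idx n. \<forall>y\<in>idx n. K x y = Q1 x y - Q2 x y"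
    using assms(2) unfolding ppt_costs_def by blast
  \<comment> \<open>The four products are grouped by sign, so the weights add up to
    \<open>(c1 + c2) * (e1 + e2)\<close>.\<close>
  let ?R1 = "\<lambda>x y. tens n P1 Q1 x y + tens n P2 Q2 x y"
  let ?R2 = "\<lambda>x y. tens n P1 Q2 x y + tens n P2 Q1 x y"
  have "ppt_kernel (m + n) (c1 * e1 + c2 * e2) ?R1" "ppt_kernel (m + n) (c1 * e2 + c2 * e1) ?R2"
    using P Q by (auto intro!: ppt_kernel_add ppt_kernel_tens)
  moreover have "tens n J K x y = ?R1 x y - ?R2 x y" if "x \<in> idx (m + n)" "y \<in> idx (m + n)" for x y
  proof -
    have J: "J (hi n x) (hi n y) = P1 (hi n x) (hi n y) - P2 (hi n x) (hi n y)"
      using P(6) hi_in_idx that by blast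
    have K: "K (lo n x) (lo n y) = Q1 (lo n x) (lo n y) - Q2 (lo n x) (lo n y)"
      using Q(6) lo_in_idx by blast
    show ?thesis unfolding tens_def J K by (simp add: algebra_simps)
  qed
  moreover have "v * w = (c1 * e1 + c2 * e2) + (c1 * e2 + c2 * e1)"
    unfolding P(1) Q(1) by (simp add: algebra_simps)
  moreover have "0 \<le> c1 * e1 + c2 * e2" "0 \<le> c1 * e2 + c2 * e1"
    using P(2,3) Q(2,3) by auto
  ultimately show ?thesis unfolding ppt_costs_def by blast
qed

lemma ppt_costs_cong:
  assumes "\<And>x y. x \<in> idx n \<Longrightarrow> y \<in> idx n \<Longrightarrow> J x y = K x y"
  shows "ppt_costs n J = ppt_costs n K"
  unfolding ppt_costs_def using assms by auto

text \<open>Comparing partial traces gives \<open>c1 - c2 = 1\<close>. The bound keeps the infima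
  away from 0 and their logarithms nonnegative.\<close>

lemma ppt_costs_ge_1:
  assumes "marginal n 1 J" "v \<in> ppt_costs n J"
  shows "1 \<le> v"
proof -
  obtain c1 c2 P1 P2 where P: "v = c1 + c2" "0 \<le> c1" "0 \<le> c2" "marginal n c1 P1" "marginal n c2 P2"
    "\<forall>x\<in>idx n. \<forall>y\<in>idx n. J x y = P1 x y - P2 x y"
    using assms(2) unfolding ppt_costs_def ppt_kernel_def by blast
  have "(\<Sum>k<d_out n. J (0, k) (0, k)) = (\<Sum>k<d_out n. P1 (0, k) (0, k) - P2 (0, k) (0, k))"
    using P(6) by (intro sum.cong refl) (auto simp: idx_def)
  then have "complex_of_real 1 = of_real (c1 - c2)"
    using assms(1) P(4,5) d_pos unfolding marginal_def by (simp add: sum_subtractf)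
  then have "1 = c1 - c2" by (simp only: of_real_eq_iff)
  then show ?thesis using P by simp
qed

lemma pt_identity:
  assumes "x \<in> idx n" "y \<in> idx n"
  shows "pt n (\<lambda>x y. if x = y then 1 else 0) x y = (if x = y then 1 else 0)"
  using sw_involution[OF assms] sw_involution[OF assms(2,1)] unfolding pt_def by metis

lemma marginal_identity:
  "marginal n (c * real (d_out n)) (\<lambda>x y. of_real c * (if x = y then 1 else 0))"
  unfolding marginal_def by auto

lemma pt_hermitian:
  assumes "\<And>x y. x \<in> idx n \<Longrightarrow> y \<in> idx n \<Longrightarrow> P y x = cnj (P x y)" "x \<in> idx n" "y \<in> idx n"
  shows "pt n P y x = cnj (pt n P x y)"
  unfolding pt_def using assms sw_in_idx by blast

lemma pt_scaled_identity:
  assumes "x \<in> idx n" "y \<in> idx n"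
  shows "pt n (\<lambda>x y. of_real c * (if x = y then 1 else 0)) x y = of_real c * (if x = y then 1 else 0)"
  using pt_identity[OF assms] unfolding pt_def by simp

lemma ppt_kernel_identity:
  assumes "0 \<le> c"
  shows "ppt_kernel n (c * real (d_out n)) (\<lambda>x y. of_real c * (if x = y then 1 else 0))"
proof -
  have psd: "psd_on (idx n) (\<lambda>x y. of_real c * (if x = y then 1 else 0))"
    by (rule psd_on_scale[OF psd_on_identity[OF finite_idx] assms])
  have "psd_on (idx n) (pt n (\<lambda>x y. of_real c * (if x = y then 1 else 0)))"
    by (rule iffD2[OF psd_on_cong, OF pt_scaled_identity psd])
  then show ?thesis unfolding ppt_kernel_def by (intro conjI psd marginal_identity)
qed

lemma ppt_kernel_scale:
  assumes "ppt_kernel n c P" "0 \<le> t"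
  shows "ppt_kernel n (t * c) (\<lambda>x y. of_real t * P x y)"
proof -
  have "psd_on (idx n) (pt n (\<lambda>x y. of_real t * P x y))"
    using psd_on_scale[of "idx n" "pt n P" t] assms unfolding ppt_kernel_def pt_def[abs_def] by blast
  moreover have "marginal n (t * c) (\<lambda>x y. of_real t * P x y)"
    using assms unfolding ppt_kernel_def marginal_def sum_distrib_left[symmetric] by simp
  ultimately show ?thesis
    using psd_on_scale[of "idx n" P t] assms unfolding ppt_kernel_def by blast
qed

lemma ppt_kernel_normalize:
  assumes "ppt_kernel n c P" "0 \<le> c"
  shows "\<exists>K. ppt_kernel n 1 K \<and> (\<forall>x\<in>idx n. \<forall>y\<in>idx n. P x y = of_real c * K x y)"
proof (cases "c = 0")
  case False
  then show ?thesis
    using ppt_kernel_scale[OF assms(1), of "1 / c"] assms(2)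
    by (intro exI[of _ "\<lambda>x y. of_real (1 / c) * P x y"]) simp
next
  case True
  have psd: "psd_on (idx n) P" using assms(1) by (simp add: ppt_kernel_def)
  have diag: "Re (P x x) = 0" if "x \<in> idx n" for x
  proof -
    obtain i k where x: "x = (i, k)" "i < d_in n" "k < d_out n" using \<open>x \<in> idx n\<close> by (auto simp: idx_def)
    have "(\<Sum>k<d_out n. P (i, k) (i, k)) = 0"
      using assms(1) x True by (simp add: ppt_kernel_def marginal_def)
    then have "(\<Sum>k<d_out n. Re (P (i, k) (i, k))) = 0" by (metis Re_sum zero_complex.sel(1))
    moreover have "0 \<le> Re (P (i, k) (i, k))" if "k < d_out n" for k
      using psd_on_diag_nonneg[OF finite_idx psd] that x by (simp add: idx_def)
    ultimately show ?thesis using x by (subst (asm) sum_nonneg_eq_0_iff) auto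
  qed
  \<comment> \<open>For \<open>c = 0\<close> any PPT channel can carry the weight; the completely
    depolarising one is at hand.\<close>
  have "ppt_kernel n 1 (\<lambda>x y. of_real (1 / real (d_out n)) * (if x = y then 1 else 0))"
    using ppt_kernel_identity[of "1 / real (d_out n)" n] d_pos(2)[of n] by simp
  moreover have "P x y = 0" if "x \<in> idx n" "y \<in> idx n" for x y
    by (rule psd_on_zero_diag[OF finite_idx psd diag that])
  ultimately show ?thesis using True by auto
qed

text \<open>The decomposition is \<open>J = (J + c I) - c I\<close>, with \<open>c\<close> so large
  that the partial transpose of \<open>J + c I\<close> is positive; partial transposition leaves the
  identity fixed.\<close>

lemma ppt_costs_nonempty:
  assumes "psd_on (idx n) J" "marginal n 1 J"
  shows "ppt_costs n J \<noteq> {}"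
proof -
  define c where "c = (\<Sum>x\<in>idx n. \<Sum>y\<in>idx n. cmod (pt n J x y))"
  define e where "e = c * real (d_out n)"
  have c: "0 \<le> c" unfolding c_def by (intro sum_nonneg) simp
  let ?P = "\<lambda>x y. of_real c * (if x = y then 1 else 0)"
  have I: "psd_on (idx n) ?P"
    by (rule psd_on_scale[OF psd_on_identity[OF finite_idx] c])
  have P: "ppt_kernel n e ?P"
    unfolding e_def by (rule ppt_kernel_identity[OF c])
  have "psd_on (idx n) (\<lambda>x y. of_real c * (if x = y then 1 else 0) - (- pt n J x y))"
  proof (rule psd_on_dominated[OF finite_idx])
    fix x y assume "x \<in> idx n" "y \<in> idx n"
    then have "pt n J y x = cnj (pt n J x y)"
      by (intro pt_hermitian[where n = n] psd_on_hermitian[OF assms(1)])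
    then show "- pt n J y x = cnj (- pt n J x y)" by simp
  qed (simp add: c_def)
  moreover have eq: "pt n (\<lambda>x y. J x y + ?P x y) x y = of_real c * (if x = y then 1 else 0) - (- pt n J x y)"
    if "x \<in> idx n" "y \<in> idx n" for x y
    using pt_scaled_identity[OF that, of c] by (simp add: pt_def)
  ultimately have "psd_on (idx n) (pt n (\<lambda>x y. J x y + ?P x y))"
    by (subst psd_on_cong[OF eq])
  then have "ppt_kernel n (1 + e) (\<lambda>x y. J x y + ?P x y)"
    unfolding ppt_kernel_def e_def
    using psd_on_add[OF assms(1) I] marginal_add[OF assms(2) marginal_identity[of n c]] by blast
  moreover have "J x y = (J x y + ?P x y) - ?P x y" for x y by simp
  moreover have "0 \<le> e" using c by (simp add: e_def)
  moreover from this have "0 \<le> 1 + e" by simp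
  ultimately have "(1 + e) + e \<in> ppt_costs n J"
    unfolding ppt_costs_def using P by blast
  then show ?thesis by blast
qed

section \<open>Tensor powers of kernels and the dual program\<close>

lemma hi_lo_comp:
  "hi n (hi 1 x) = hi (Suc n) x" "lo n (hi 1 x) = hi 1 (lo (Suc n) x)" "lo 1 (lo (Suc n) x) = lo 1 x"
proof -
  have "i div d div d ^ n = i div d ^ Suc n" "i div d mod d ^ n = i mod d ^ Suc n div d"
    "i mod d ^ Suc n mod d = i mod d" if "0 < d" for i d :: nat
    using that by (simp_all add: div_mult2_eq mod_mult2_eq)
  then show "hi n (hi 1 x) = hi (Suc n) x" "lo n (hi 1 x) = hi 1 (lo (Suc n) x)" "lo 1 (lo (Suc n) x) = lo 1 x"
    using dims_pos by (simp_all add: hi_def lo_def d_in_def d_out_def del: power_Suc)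
qed

lemma kpow_add: "kpow J (m + n) = tens n (kpow J m) (kpow J n)"
proof (induction n)
  case 0
  show ?case by (intro ext) (simp add: tens_def hi_def d_in_def d_out_def)
next
  case (Suc n)
  show ?case
    by (intro ext) (simp add: Suc.IH tens_def hi_lo_comp mult.assoc del: One_nat_def)
qed

lemma marginal_kpow:
  assumes "marginal 1 1 J"
  shows "marginal n 1 (kpow J n)"
proof (induction n)
  case 0
  show ?case by (auto simp: marginal_def d_in_def d_out_def)
next
  case (Suc n)
  then show ?case using marginal_tens[OF Suc assms] by simp
qed

lemma psd_kpow:
  assumes "psd_on (idx 1) J"
  shows "psd_on (idx n) (kpow J n)"
proof (induction n)
  case 0
  show ?case using psd_on_rank_one[of "idx 0" "\<lambda>_. 1"] by simp
next
  case (Suc n)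
  then show ?case using psd_tens[OF Suc assms] by simp
qed

text \<open>A point of value \<open>g\<close> of the dual semidefinite program. Averaging the two
  conditions shows that \<open>\<rho>\<close> tensored with the identity is positive, so
  \<open>\<rho>\<close> is a density operator.\<close>

definition dual_feasible :: "nat \<Rightarrow> (nat \<times> nat \<Rightarrow> nat \<times> nat \<Rightarrow> complex) \<Rightarrow> real \<Rightarrow> bool" where
  "dual_feasible n J g \<longleftrightarrow> (\<exists>R \<rho>.
     psd_on (idx n) (\<lambda>x y. \<rho> (fst x) (fst y) * (if snd x = snd y then 1 else 0) + pt n R x y) \<and>
     psd_on (idx n) (\<lambda>x y. \<rho> (fst x) (fst y) * (if snd x = snd y then 1 else 0) - pt n R x y) \<and>
     (\<Sum>i<d_in n. \<rho> i i) = 1 \<and>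
     (\<Sum>x\<in>idx n. \<Sum>y\<in>idx n. J x y * R y x) = of_real g)"

lemma dual_feasible_tens:
  assumes "dual_feasible m J g" "dual_feasible n K h"
  shows "dual_feasible (m + n) (tens n J K) (g * h)"
proof -
  let ?e = "\<lambda>\<rho> x y. \<rho> (fst x) (fst y) * (if snd x = snd y then 1 else 0 :: complex)"
  obtain R \<rho> where R: "psd_on (idx m) (\<lambda>x y. ?e \<rho> x y + pt m R x y)" "psd_on (idx m) (\<lambda>x y. ?e \<rho> x y - pt m R x y)"
    "(\<Sum>i<d_in m. \<rho> i i) = 1" "(\<Sum>x\<in>idx m. \<Sum>y\<in>idx m. J x y * R y x) = of_real g"
    using assms(1) unfolding dual_feasible_def by blast
  obtain S \<sigma> where S: "psd_on (idx n) (\<lambda>x y. ?e \<sigma> x y + pt n S x y)" "psd_on (idx n) (\<lambda>x y. ?e \<sigma> x y - pt n S x y)"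
    "(\<Sum>i<d_in n. \<sigma> i i) = 1" "(\<Sum>x\<in>idx n. \<Sum>y\<in>idx n. K x y * S y x) = of_real h"
    using assms(2) unfolding dual_feasible_def by blast
  define \<tau> where "\<tau> i j = \<rho> (i div d_in n) (j div d_in n) * \<sigma> (i mod d_in n) (j mod d_in n)" for i j
  have e: "?e \<tau> x y = tens n (?e \<rho>) (?e \<sigma>) x y" for x y
    using div_mod_eq_iff[of "snd x" "d_out n" "snd y"] by (auto simp: \<tau>_def tens_def hi_def lo_def)
  let ?A1 = "\<lambda>x y. ?e \<rho> x y + pt m R x y" and ?A2 = "\<lambda>x y. ?e \<rho> x y - pt m R x y"
  let ?B1 = "\<lambda>x y. ?e \<sigma> x y + pt n S x y" and ?B2 = "\<lambda>x y. ?e \<sigma> x y - pt n S x y"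
  \<comment> \<open>Averaging the two products with equal signs cancels the mixed terms and leaves
    \<open>?e \<tau>\<close> plus the product of the transposed kernels; opposite signs leave the
    difference.\<close>
  have p: "psd_on (idx (m + n)) (\<lambda>x y. of_real (1 / 2) * (tens n ?A1 ?B1 x y + tens n ?A2 ?B2 x y))"
    "psd_on (idx (m + n)) (\<lambda>x y. of_real (1 / 2) * (tens n ?A1 ?B2 x y + tens n ?A2 ?B1 x y))"
    by (intro psd_on_scale psd_on_add psd_tens R(1,2) S(1,2), simp)+
  have eq: "?e \<tau> x y + pt (m + n) (tens n R S) x y = of_real (1 / 2) * (tens n ?A1 ?B1 x y + tens n ?A2 ?B2 x y)"
    "?e \<tau> x y - pt (m + n) (tens n R S) x y = of_real (1 / 2) * (tens n ?A1 ?B2 x y + tens n ?A2 ?B1 x y)" for x y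
    unfolding e pt_tens unfolding tens_def by (simp_all add: field_simps)
  have "psd_on (idx (m + n)) (\<lambda>x y. ?e \<tau> x y + pt (m + n) (tens n R S) x y)"
    "psd_on (idx (m + n)) (\<lambda>x y. ?e \<tau> x y - pt (m + n) (tens n R S) x y)"
    unfolding eq by (rule p)+
  moreover have "(\<Sum>i<d_in (m + n). \<tau> i i) = 1"
  proof -
    have "(\<Sum>i<d_in (m + n). \<tau> i i) = (\<Sum>i<d_in m. \<rho> i i) * (\<Sum>i<d_in n. \<sigma> i i)"
      unfolding d_add by (simp add: sum_lessThan_mult \<tau>_def index_div_mod sum_product)
    then show ?thesis using R(3) S(3) by simp
  qed
  moreover have "(\<Sum>x\<in>idx (m + n). \<Sum>y\<in>idx (m + n). tens n J K x y * tens n R S y x) = of_real (g * h)"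
  proof -
    have "(\<Sum>x\<in>idx (m + n). \<Sum>y\<in>idx (m + n). tens n J K x y * tens n R S y x)
      = (\<Sum>x\<in>idx (m + n). \<Sum>u\<in>idx m. \<Sum>v\<in>idx n. J (hi n x) u * K (lo n x) v * (R u (hi n x) * S v (lo n x)))"
      unfolding tens_def
    proof (rule sum.cong[OF refl])
      fix x
      show "(\<Sum>y\<in>idx (m + n). J (hi n x) (hi n y) * K (lo n x) (lo n y) * (R (hi n y) (hi n x) * S (lo n y) (lo n x)))
        = (\<Sum>u\<in>idx m. \<Sum>v\<in>idx n. J (hi n x) u * K (lo n x) v * (R u (hi n x) * S v (lo n x)))"
        by (rule sum_idx_tens[where F = "\<lambda>u v. J (hi n x) u * K (lo n x) v * (R u (hi n x) * S v (lo n x))"])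
    qed
    also have "\<dots> = (\<Sum>u'\<in>idx m. \<Sum>v'\<in>idx n. \<Sum>u\<in>idx m. \<Sum>v\<in>idx n. J u' u * K v' v * (R u u' * S v v'))"
      by (rule sum_idx_tens[where F = "\<lambda>u' v'. \<Sum>u\<in>idx m. \<Sum>v\<in>idx n. J u' u * K v' v * (R u u' * S v v')"])
    also have "\<dots> = (\<Sum>u'\<in>idx m. \<Sum>v'\<in>idx n. (\<Sum>u\<in>idx m. J u' u * R u u') * (\<Sum>v\<in>idx n. K v' v * S v v'))"
      unfolding sum_product by (intro sum.cong refl) (simp only: mult_ac)
    also have "\<dots> = of_real g * of_real h"
      unfolding sum_product[symmetric] R(4) S(4) ..
    finally show ?thesis by simp
  qed
  ultimately show ?thesis unfolding dual_feasible_def by blast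
qed

lemma dual_feasible_kpow:
  assumes "dual_feasible 1 J g"
  shows "dual_feasible n (kpow J n) (g ^ n)"
proof (induction n)
  case 0
  have i: "idx 0 = {(0, 0)}" by (auto simp: idx_def d_in_def d_out_def)
  have "psd_on (idx 0) (\<lambda>x y. 1 * (if snd x = snd y then 1 else 0) + pt 0 (\<lambda>_ _. 1) x y)"
    "psd_on (idx 0) (\<lambda>x y. 1 * (if snd x = snd y then 1 else 0) - pt 0 (\<lambda>_ _. 1) x y)"
    unfolding i by (auto simp: psd_on_def pt_def)
  then show ?case
    unfolding dual_feasible_def
    by (intro exI[of _ "\<lambda>_ _. 1"] conjI) (simp_all add: i d_in_def)
next
  case (Suc n)
  then show ?case using dual_feasible_tens[OF Suc assms] by (simp add: mult.commute)
qed

text \<open>Exchanging Bob's digits is an involution on pairs \<open>(x, y)\<close>, so transposing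
  both factors merely reorders the terms.\<close>

lemma sum_pt_swap:
  "(\<Sum>x\<in>idx n. \<Sum>y\<in>idx n. P x y * R y x) = (\<Sum>x\<in>idx n. \<Sum>y\<in>idx n. pt n P x y * pt n R y x)"
  unfolding sum.cartesian_product
  by (rule sum.reindex_bij_witness[where i = "\<lambda>(x, y). (sw n x y, sw n y x)" and j = "\<lambda>(x, y). (sw n x y, sw n y x)"])
    (auto simp: sw_in_idx sw_involution pt_def)

text \<open>The positive kernel \<open>pt n P\<close> is paired with the positive kernel built from
  \<open>\<rho>\<close> and \<open>R\<close>; the part with \<open>\<rho>\<close> contributes
  exactly \<open>c\<close>, because partial transposition keeps the marginal. The opposite bound is
  this one for \<open>- R\<close>, whose condition is the second half of dual feasibility.\<close>

lemma dual_bound_ppt: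
  assumes P: "ppt_kernel n c P"
    and R: "psd_on (idx n) (\<lambda>x y. \<rho> (fst x) (fst y) * (if snd x = snd y then 1 else 0) + pt n R x y)"
    and \<rho>: "(\<Sum>i<d_in n. \<rho> i i) = 1"
  shows "- c \<le> Re (\<Sum>x\<in>idx n. \<Sum>y\<in>idx n. P x y * R y x)"
proof -
  let ?e = "\<lambda>x y. \<rho> (fst x) (fst y) * (if snd x = snd y then 1 else 0 :: complex)"
  have "(\<Sum>x\<in>idx n. \<Sum>y\<in>idx n. pt n P x y * ?e y x) =
    (\<Sum>i<d_in n. \<Sum>k<d_out n. \<Sum>j<d_in n. pt n P (i, k) (j, k) * \<rho> j i)"
    unfolding sum_idx by (intro sum.cong refl) (simp add: if_distrib cong: if_cong)
  also have "\<dots> = (\<Sum>i<d_in n. \<Sum>j<d_in n. (\<Sum>k<d_out n. pt n P (i, k) (j, k)) * \<rho> j i)"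
    unfolding sum_distrib_right by (rule sum.cong[OF refl], rule sum.swap)
  also have "\<dots> = (\<Sum>i<d_in n. \<Sum>j<d_in n. if i = j then of_real c * \<rho> j i else 0)"
    using marginal_pt[of n c P] P unfolding ppt_kernel_def marginal_def
    by (intro sum.cong refl) auto
  also have "\<dots> = of_real c * (\<Sum>i<d_in n. \<rho> i i)"
    by (simp add: sum_distrib_left)
  finally have e: "(\<Sum>x\<in>idx n. \<Sum>y\<in>idx n. pt n P x y * ?e y x) = of_real c" using \<rho> by simp
  have "0 \<le> Re (\<Sum>x\<in>idx n. \<Sum>y\<in>idx n. pt n P x y * (?e y x + pt n R y x))"
    using P R unfolding ppt_kernel_def by (intro psd_on_trace_nonneg finite_idx) auto
  also have "\<dots> = c + Re (\<Sum>x\<in>idx n. \<Sum>y\<in>idx n. pt n P x y * pt n R y x)"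
    unfolding distrib_left sum.distrib plus_complex.sel e by simp
  finally show ?thesis unfolding sum_pt_swap[symmetric] by simp
qed

lemma dual_bound:
  assumes "dual_feasible n J g" "v \<in> ppt_costs n J"
  shows "g \<le> v"
proof -
  let ?e = "\<lambda>\<rho> x y. \<rho> (fst x) (fst y) * (if snd x = snd y then 1 else 0 :: complex)"
  let ?t = "\<lambda>A B. \<Sum>x\<in>idx n. \<Sum>y\<in>idx n. A x y * B y x :: complex"
  obtain R \<rho> where R: "psd_on (idx n) (\<lambda>x y. ?e \<rho> x y + pt n R x y)" "psd_on (idx n) (\<lambda>x y. ?e \<rho> x y - pt n R x y)"
    "(\<Sum>i<d_in n. \<rho> i i) = 1" "?t J R = of_real g"
    using assms(1) unfolding dual_feasible_def by blast
  obtain c1 c2 P1 P2 where P: "v = c1 + c2" "ppt_kernel n c1 P1" "ppt_kernel n c2 P2"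
    "\<forall>x\<in>idx n. \<forall>y\<in>idx n. J x y = P1 x y - P2 x y"
    using assms(2) unfolding ppt_costs_def by blast
  have "?t J R = ?t P1 R - ?t P2 R"
    unfolding sum_subtractf[symmetric] by (intro sum.cong refl) (simp add: P(4) algebra_simps)
  then have g: "g = Re (?t P1 R) - Re (?t P2 R)"
    using R(4) by (metis Re_complex_of_real minus_complex.sel(1))
  have m: "psd_on (idx n) (\<lambda>x y. ?e \<rho> x y + pt n (\<lambda>x y. - R x y) x y)"
    using R(2) by (simp add: pt_def)
  have "?t P1 (\<lambda>x y. - R x y) = - ?t P1 R" by (simp add: sum_negf)
  then have "Re (?t P1 R) \<le> c1" using dual_bound_ppt[OF P(2) m R(3)] by simp
  moreover have "- c2 \<le> Re (?t P2 R)" by (rule dual_bound_ppt[OF P(3) R(1,3)])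
  ultimately show ?thesis using g P(1) by simp
qed

end

section \<open>Strong duality\<close>

text \<open>Every real array gives a Hermitian kernel and every Hermitian kernel arises from exactly
  one array, with no symmetry constraint on the coordinates. Real-valued functions can therefore
  stand for Hermitian variables in the Hahn-Banach argument.\<close>

definition herm_of :: "('a \<Rightarrow> 'a \<Rightarrow> real) \<Rightarrow> 'a \<Rightarrow> 'a \<Rightarrow> complex" where
  "herm_of u x y = Complex (u x y + u y x) (u x y - u y x)"

definition herm_coords :: "('a \<Rightarrow> 'a \<Rightarrow> complex) \<Rightarrow> 'a \<Rightarrow> 'a \<Rightarrow> real" where
  "herm_coords Z x y = (Re (Z x y) + Im (Z x y)) / 2"

lemma herm_of_hermitian: "herm_of u y x = cnj (herm_of u x y)"
  by (simp add: herm_of_def complex_eq_iff)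

lemma herm_of_coords: "Z y x = cnj (Z x y) \<Longrightarrow> herm_of (herm_coords Z) x y = Z x y"
  by (simp add: herm_of_def herm_coords_def complex_eq_iff field_simps)

text \<open>The terms at \<open>(x, y)\<close> and \<open>(y, x)\<close> are conjugate, so imaginary
  parts cancel and the trace pairing is the Euclidean pairing of coordinates up to the factor
  4.\<close>

lemma trace_herm_of:
  "(\<Sum>x\<in>I. \<Sum>y\<in>I. herm_of u x y * herm_of w y x) = of_real (4 * (\<Sum>x\<in>I. \<Sum>y\<in>I. u x y * w x y))"
proof -
  define f where "f x y = Complex (2 * u x y * w x y) (2 * u x y * w y x)" for x y
  have "herm_of u x y * herm_of w y x = f x y + cnj (f y x)" for x y
    by (simp add: herm_of_def f_def complex_eq_iff algebra_simps)
  then have "(\<Sum>x\<in>I. \<Sum>y\<in>I. herm_of u x y * herm_of w y x) = (\<Sum>x\<in>I. \<Sum>y\<in>I. f x y) + cnj (\<Sum>x\<in>I. \<Sum>y\<in>I. f y x)"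
    by (simp add: sum.distrib)
  also have "(\<Sum>x\<in>I. \<Sum>y\<in>I. f y x) = (\<Sum>x\<in>I. \<Sum>y\<in>I. f x y)" by (rule sum.swap)
  finally have "(\<Sum>x\<in>I. \<Sum>y\<in>I. herm_of u x y * herm_of w y x) = of_real (2 * Re (\<Sum>x\<in>I. \<Sum>y\<in>I. f x y))"
    unfolding complex_add_cnj .
  then show ?thesis by (simp add: f_def sum_distrib_left mult_ac)
qed

context bipartite_dims
begin

section \<open>The primal program with a perturbed right-hand side\<close>

definition tr_out :: "nat \<Rightarrow> (nat \<times> nat \<Rightarrow> nat \<times> nat \<Rightarrow> complex) \<Rightarrow> nat \<Rightarrow> nat \<Rightarrow> complex" where
  "tr_out n P i j = (\<Sum>k<d_out n. P (i, k) (j, k))"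

text \<open>The program for \<Gamma> is the case where \<open>Z\<close> is the Choi kernel and
  \<open>T = 0\<close>, with the norm bound written as an operator inequality. The perturbations
  \<open>Z\<close> and \<open>T\<close> are there for their Lagrange multipliers, which become
  \<open>R\<close> and \<open>\<rho>\<close>.\<close>

definition primal_feasible :: "nat \<Rightarrow> (nat \<times> nat \<Rightarrow> nat \<times> nat \<Rightarrow> complex) \<Rightarrow> (nat \<Rightarrow> nat \<Rightarrow> complex) \<Rightarrow> real \<Rightarrow> bool" where
  "primal_feasible n Z T \<mu> \<longleftrightarrow> (\<exists>V Y. psd_on (idx n) V \<and> psd_on (idx n) Y \<and>
     psd_on (idx n) (\<lambda>x y. pt n V x y - pt n Y x y - Z x y) \<and>
     psd_on {..<d_in n} (\<lambda>i j. of_real \<mu> * (if i = j then 1 else 0) - tr_out n V i j - tr_out n Y i j - T i j))"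

lemma psd_tr_out:
  assumes "psd_on (idx n) V"
  shows "psd_on {..<d_in n} (tr_out n V)"
proof (rule psd_onI)
  fix i j assume "i \<in> {..<d_in n}" "j \<in> {..<d_in n}"
  then show "tr_out n V j i = cnj (tr_out n V i j)"
    unfolding tr_out_def cnj_sum
    by (intro sum.cong refl psd_on_hermitian[OF assms]) (auto simp: idx_def)
next
  fix v
  have "0 \<le> Re (\<Sum>i<d_in n. \<Sum>j<d_in n. cnj (v i) * V (i, k) (j, k) * v j)" if "k < d_out n" for k
    by (rule psd_on_form, rule psd_on_reindex[OF finite_idx assms]) (use that in \<open>auto simp: idx_def\<close>)
  then have "0 \<le> (\<Sum>k<d_out n. Re (\<Sum>i<d_in n. \<Sum>j<d_in n. cnj (v i) * V (i, k) (j, k) * v j))"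
    by (intro sum_nonneg) simp
  also have "\<dots> = Re (\<Sum>k<d_out n. \<Sum>i<d_in n. \<Sum>j<d_in n. cnj (v i) * V (i, k) (j, k) * v j)"
    by (rule Re_sum[symmetric])
  also have "(\<Sum>k<d_out n. \<Sum>i<d_in n. \<Sum>j<d_in n. cnj (v i) * V (i, k) (j, k) * v j) =
      (\<Sum>i<d_in n. \<Sum>j<d_in n. cnj (v i) * tr_out n V i j * v j)"
    unfolding tr_out_def sum_distrib_left sum_distrib_right
    by (subst sum.swap, rule sum.cong[OF refl], rule sum.swap)
  finally show "0 \<le> Re (\<Sum>i<d_in n. \<Sum>j<d_in n. cnj (v i) * tr_out n V i j * v j)" .
qed

text \<open>The partial traces of \<open>V\<close> and \<open>Y\<close> and the slack all have
  nonnegative diagonals. As the bound does not involve \<open>V\<close> and \<open>Y\<close>, the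
  optimal value is bounded below.\<close>

lemma primal_feasible_lower:
  assumes "primal_feasible n Z T \<mu>"
  shows "Re (T 0 0) \<le> \<mu>"
proof -
  obtain V Y where V: "psd_on (idx n) V" "psd_on (idx n) Y"
    "psd_on {..<d_in n} (\<lambda>i j. of_real \<mu> * (if i = j then 1 else 0) - tr_out n V i j - tr_out n Y i j - T i j)"
    using assms unfolding primal_feasible_def by blast
  show ?thesis
    using psd_on_diag_nonneg[OF _ V(3), of 0] psd_on_diag_nonneg[OF _ psd_tr_out[OF V(1)], of 0]
      psd_on_diag_nonneg[OF _ psd_tr_out[OF V(2)], of 0] by simp
qed

lemma primal_feasible_cong:
  assumes "\<And>x y. x \<in> idx n \<Longrightarrow> y \<in> idx n \<Longrightarrow> Z x y = Z' x y"
    "\<And>i j. i < d_in n \<Longrightarrow> j < d_in n \<Longrightarrow> T i j = T' i j"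
  shows "primal_feasible n Z T \<mu> \<longleftrightarrow> primal_feasible n Z' T' \<mu>"
proof -
  have "psd_on (idx n) (\<lambda>x y. pt n V x y - pt n Y x y - Z x y) \<longleftrightarrow>
      psd_on (idx n) (\<lambda>x y. pt n V x y - pt n Y x y - Z' x y)" for V Y
    by (rule psd_on_cong) (simp add: assms(1))
  moreover have "psd_on {..<d_in n} (\<lambda>i j. of_real \<mu> * (if i = j then 1 else 0) - tr_out n V i j - tr_out n Y i j - T i j) \<longleftrightarrow>
      psd_on {..<d_in n} (\<lambda>i j. of_real \<mu> * (if i = j then 1 else 0) - tr_out n V i j - tr_out n Y i j - T' i j)" for V Y
    by (rule psd_on_cong) (simp add: assms(2))
  ultimately show ?thesis unfolding primal_feasible_def by simp
qed

lemma primal_feasible_add: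
  assumes "primal_feasible n Z T \<mu>" "primal_feasible n Z' T' \<nu>"
  shows "primal_feasible n (\<lambda>x y. Z x y + Z' x y) (\<lambda>i j. T i j + T' i j) (\<mu> + \<nu>)"
proof -
  obtain V Y where V: "psd_on (idx n) V" "psd_on (idx n) Y"
    "psd_on (idx n) (\<lambda>x y. pt n V x y - pt n Y x y - Z x y)"
    "psd_on {..<d_in n} (\<lambda>i j. of_real \<mu> * (if i = j then 1 else 0) - tr_out n V i j - tr_out n Y i j - T i j)"
    using assms(1) unfolding primal_feasible_def by blast
  obtain V' Y' where V': "psd_on (idx n) V'" "psd_on (idx n) Y'"
    "psd_on (idx n) (\<lambda>x y. pt n V' x y - pt n Y' x y - Z' x y)"
    "psd_on {..<d_in n} (\<lambda>i j. of_real \<nu> * (if i = j then 1 else 0) - tr_out n V' i j - tr_out n Y' i j - T' i j)"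
    using assms(2) unfolding primal_feasible_def by blast
  have "psd_on (idx n) (\<lambda>x y. V x y + V' x y)" "psd_on (idx n) (\<lambda>x y. Y x y + Y' x y)"
    by (intro psd_on_add V V')+
  moreover have "psd_on (idx n) (\<lambda>x y. pt n (\<lambda>x y. V x y + V' x y) x y - pt n (\<lambda>x y. Y x y + Y' x y) x y - (Z x y + Z' x y))"
    using psd_on_add[OF V(3) V'(3)] by (simp add: pt_def algebra_simps)
  moreover have "psd_on {..<d_in n} (\<lambda>i j. of_real (\<mu> + \<nu>) * (if i = j then 1 else 0) - tr_out n (\<lambda>x y. V x y + V' x y) i j
      - tr_out n (\<lambda>x y. Y x y + Y' x y) i j - (T i j + T' i j))"
    using psd_on_add[OF V(4) V'(4)] by (simp add: tr_out_def sum.distrib algebra_simps)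
  ultimately show ?thesis unfolding primal_feasible_def by blast
qed

lemma primal_feasible_scale:
  assumes "primal_feasible n Z T \<mu>" "0 \<le> t"
  shows "primal_feasible n (\<lambda>x y. of_real t * Z x y) (\<lambda>i j. of_real t * T i j) (t * \<mu>)"
proof -
  obtain V Y where V: "psd_on (idx n) V" "psd_on (idx n) Y"
    "psd_on (idx n) (\<lambda>x y. pt n V x y - pt n Y x y - Z x y)"
    "psd_on {..<d_in n} (\<lambda>i j. of_real \<mu> * (if i = j then 1 else 0) - tr_out n V i j - tr_out n Y i j - T i j)"
    using assms(1) unfolding primal_feasible_def by blast
  have "psd_on (idx n) (\<lambda>x y. of_real t * V x y)" "psd_on (idx n) (\<lambda>x y. of_real t * Y x y)"
    by (intro psd_on_scale V assms)+
  moreover have "psd_on (idx n) (\<lambda>x y. pt n (\<lambda>x y. of_real t * V x y) x y - pt n (\<lambda>x y. of_real t * Y x y) x y - of_real t * Z x y)"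
    using psd_on_scale[OF V(3) assms(2)] by (simp add: pt_def algebra_simps)
  moreover have "psd_on {..<d_in n} (\<lambda>i j. of_real (t * \<mu>) * (if i = j then 1 else 0) - tr_out n (\<lambda>x y. of_real t * V x y) i j
      - tr_out n (\<lambda>x y. of_real t * Y x y) i j - of_real t * T i j)"
    using psd_on_scale[OF V(4) assms(2)]
    by (simp only: tr_out_def sum_distrib_left[symmetric] right_diff_distrib of_real_mult mult.assoc)
  ultimately show ?thesis unfolding primal_feasible_def by blast
qed

lemma primal_feasible_zero: "primal_feasible n (\<lambda>_ _. 0) (\<lambda>_ _. 0) 0"
  unfolding primal_feasible_def
  by (intro exI[of _ "\<lambda>_ _. 0"]) (simp add: psd_on_zero pt_def tr_out_def)

text \<open>A large multiple of the identity for \<open>V\<close>, with \<open>Y = 0\<close>, works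
  for arbitrary Hermitian \<open>Z\<close> and \<open>T\<close>. Feasibility everywhere makes the
  value function real on the whole space and takes the place of a Slater condition.\<close>

lemma primal_feasible_exists:
  assumes Z: "\<And>x y. x \<in> idx n \<Longrightarrow> y \<in> idx n \<Longrightarrow> Z y x = cnj (Z x y)"
    and T: "\<And>i j. i < d_in n \<Longrightarrow> j < d_in n \<Longrightarrow> T j i = cnj (T i j)"
  shows "\<exists>\<mu>. primal_feasible n Z T \<mu>"
proof -
  define c where "c = (\<Sum>x\<in>idx n. \<Sum>y\<in>idx n. cmod (Z x y))"
  define e where "e = (\<Sum>i<d_in n. \<Sum>j<d_in n. cmod (T i j))"
  define V where "V x y = of_real c * (if x = y then 1 else 0 :: complex)" for x y :: "nat \<times> nat"
  have c: "0 \<le> c" unfolding c_def by (intro sum_nonneg) simp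
  have V: "psd_on (idx n) V"
    unfolding V_def[abs_def] by (rule psd_on_scale[OF psd_on_identity[OF finite_idx] c])
  have "pt n V x y = V x y" if "x \<in> idx n" "y \<in> idx n" for x y
    using pt_identity[OF that] unfolding pt_def V_def by simp
  then have eq: "pt n V x y - pt n (\<lambda>_ _. 0) x y - Z x y = of_real c * (if x = y then 1 else 0) - Z x y"
    if "x \<in> idx n" "y \<in> idx n" for x y
    using that by (simp add: pt_def V_def)
  have 1: "psd_on (idx n) (\<lambda>x y. pt n V x y - pt n (\<lambda>_ _. 0) x y - Z x y)"
    by (rule iffD2[OF psd_on_cong, OF eq psd_on_dominated[OF finite_idx Z]]) (simp_all add: c_def)
  have "(\<lambda>i j. of_real (e + c * real (d_out n)) * (if i = j then 1 else 0) - tr_out n V i j - tr_out n (\<lambda>_ _. 0) i j - T i j)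
     = (\<lambda>i j. of_real e * (if i = j then 1 else 0) - T i j)"
    by (intro ext) (simp add: tr_out_def V_def)
  moreover have "psd_on {..<d_in n} (\<lambda>i j. of_real e * (if i = j then 1 else 0) - T i j)"
    by (rule psd_on_dominated[OF _ T]) (simp_all add: e_def)
  ultimately have 2: "psd_on {..<d_in n} (\<lambda>i j. of_real (e + c * real (d_out n)) * (if i = j then 1 else 0)
      - tr_out n V i j - tr_out n (\<lambda>_ _. 0) i j - T i j)"
    by (simp only:)
  \<comment> \<open>The summand \<open>c * real (d_out n)\<close> pays for the partial trace of
    \<open>V\<close>, and \<open>e\<close> absorbs \<open>T\<close>.\<close>
  have "primal_feasible n Z T (e + c * real (d_out n))"
    unfolding primal_feasible_def
    by (rule exI[of _ V], rule exI[of _ "\<lambda>_ _. 0"]) (intro conjI V psd_on_zero 1 2)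
  then show ?thesis ..
qed

lemma trace_tr_out:
  "(\<Sum>i<d_in n. \<Sum>j<d_in n. tr_out n V i j * \<rho> j i) =
    (\<Sum>x\<in>idx n. \<Sum>y\<in>idx n. V x y * (\<rho> (fst y) (fst x) * (if snd y = snd x then 1 else 0)))"
proof -
  have "(\<Sum>x\<in>idx n. \<Sum>y\<in>idx n. V x y * (\<rho> (fst y) (fst x) * (if snd y = snd x then 1 else 0))) =
    (\<Sum>i<d_in n. \<Sum>k<d_out n. \<Sum>j<d_in n. V (i, k) (j, k) * \<rho> j i)"
    unfolding sum_idx by (intro sum.cong refl) (simp add: if_distrib cong: if_cong)
  also have "\<dots> = (\<Sum>i<d_in n. \<Sum>j<d_in n. tr_out n V i j * \<rho> j i)"
    unfolding tr_out_def sum_distrib_right by (rule sum.cong[OF refl], rule sum.swap)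
  finally show ?thesis ..
qed

lemma pt_pt:
  assumes "x \<in> idx n" "y \<in> idx n"
  shows "pt n (pt n V) x y = V x y"
  using sw_involution assms by (simp add: pt_def)

text \<open>Hahn-Banach is applied to the optimal value of the primal problem as a function of its
  right-hand side \<open>(Z, T)\<close>; both dual variables are read off the dominated functional.\<close>

lemma strong_duality:
  assumes J: "\<And>x y. x \<in> idx n \<Longrightarrow> y \<in> idx n \<Longrightarrow> J y x = cnj (J x y)"
  obtains g where "dual_feasible n J g"
    and "\<And>\<epsilon>. 0 < \<epsilon> \<Longrightarrow> \<exists>\<mu>. primal_feasible n J (\<lambda>_ _. 0) \<mu> \<and> \<mu> < g + \<epsilon>"
proof -
  define Z where "Z z = herm_of (\<lambda>x y. z (Inl (x, y)))" for z :: "((nat \<times> nat) \<times> (nat \<times> nat)) + (nat \<times> nat) \<Rightarrow> real"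
  define T where "T z = herm_of (\<lambda>i j. z (Inr (i, j)))" for z :: "((nat \<times> nat) \<times> (nat \<times> nat)) + (nat \<times> nat) \<Rightarrow> real"
  define S where "S z = {\<mu>. primal_feasible n (Z z) (T z) \<mu>}" for z
  define p where "p z = Inf (S z)" for z
  let ?D = "{..<d_in n}"
  let ?I = "(idx n \<times> idx n) <+> (?D \<times> ?D)"
  have bdd: "bdd_below (S z)" for z
    unfolding S_def by (rule bdd_belowI) (use primal_feasible_lower in blast)
  have ne: "S z \<noteq> {}" for z
    unfolding S_def using primal_feasible_exists[of n "Z z" "T z"]
    by (auto simp: Z_def T_def intro: herm_of_hermitian)
  have p_le: "p z \<le> \<mu>" if "primal_feasible n (Z z) (T z) \<mu>" for z \<mu>
    unfolding p_def using that by (intro cInf_lower bdd) (simp add: S_def)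
  have le_p: "c \<le> p z" if "\<And>\<mu>. primal_feasible n (Z z) (T z) \<mu> \<Longrightarrow> c \<le> \<mu>" for z c
    unfolding p_def using that by (intro cInf_greatest ne) (simp add: S_def)
  have sub: "sublinear_on_functions p"
  proof (rule sublinear_on_functionsI)
    have z: "Z (\<lambda>_. 0) = (\<lambda>_ _. 0)" "T (\<lambda>_. 0) = (\<lambda>_ _. 0)"
      by (intro ext; simp add: Z_def T_def herm_of_def complex_eq_iff)+
    show "p (\<lambda>_. 0) = 0"
    proof (rule antisym)
      show "p (\<lambda>_. 0) \<le> 0" by (rule p_le) (simp add: z primal_feasible_zero)
      show "0 \<le> p (\<lambda>_. 0)" by (rule le_p) (use primal_feasible_lower z in fastforce)
    qed
  next
    fix x y
    have z: "Z (\<lambda>i. x i + y i) = (\<lambda>i j. Z x i j + Z y i j)" "T (\<lambda>i. x i + y i) = (\<lambda>i j. T x i j + T y i j)"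
      by (intro ext; simp add: Z_def T_def herm_of_def complex_eq_iff)+
    have *: "p (\<lambda>i. x i + y i) \<le> \<mu> + \<nu>"
      if "primal_feasible n (Z x) (T x) \<mu>" "primal_feasible n (Z y) (T y) \<nu>" for \<mu> \<nu>
      by (rule p_le) (simp only: z primal_feasible_add[OF that])
    have "p (\<lambda>i. x i + y i) - \<mu> \<le> p y" if "primal_feasible n (Z x) (T x) \<mu>" for \<mu>
      by (rule le_p) (use *[OF that] in \<open>simp add: algebra_simps\<close>)
    then have "p (\<lambda>i. x i + y i) - p y \<le> p x"
      by (intro le_p) (simp add: algebra_simps)
    then show "p (\<lambda>i. x i + y i) \<le> p x + p y" by simp
  next
    fix t :: real and x
    assume t: "0 < t"
    have z: "Z (\<lambda>i. t * x i) = (\<lambda>i j. of_real t * Z x i j)" "T (\<lambda>i. t * x i) = (\<lambda>i j. of_real t * T x i j)"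
      by (intro ext; simp add: Z_def T_def herm_of_def complex_eq_iff algebra_simps)+
    have "p (\<lambda>i. t * x i) / t \<le> p x"
    proof (rule le_p)
      fix \<mu> assume "primal_feasible n (Z x) (T x) \<mu>"
      then have "p (\<lambda>i. t * x i) \<le> t * \<mu>"
        using t by (intro p_le) (simp only: z primal_feasible_scale less_imp_le)
      then show "p (\<lambda>i. t * x i) / t \<le> \<mu>" using t by (simp add: field_simps)
    qed
    then show "p (\<lambda>i. t * x i) \<le> t * p x" using t by (simp add: field_simps)
  qed
  have local: "p x = p y" if "\<And>i. i \<in> ?I \<Longrightarrow> x i = y i" for x y
  proof -
    have "x (Inl (u, v)) = y (Inl (u, v))" if "u \<in> idx n" "v \<in> idx n" for u v
      by (rule \<open>\<And>i. i \<in> ?I \<Longrightarrow> x i = y i\<close>) (use that in blast)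
    moreover have "x (Inr (i, j)) = y (Inr (i, j))" if "i < d_in n" "j < d_in n" for i j
      by (rule \<open>\<And>i. i \<in> ?I \<Longrightarrow> x i = y i\<close>) (use that in blast)
    ultimately have "S x = S y"
      unfolding S_def by (intro Collect_cong primal_feasible_cong) (simp_all add: Z_def T_def herm_of_def)
    then show ?thesis by (simp add: p_def)
  qed
  define code :: "(nat \<times> nat \<Rightarrow> nat \<times> nat \<Rightarrow> complex) \<Rightarrow> (nat \<Rightarrow> nat \<Rightarrow> complex) \<Rightarrow> _"
    where "code U W i = (case i of Inl (x, y) \<Rightarrow> herm_coords U x y | Inr (i, j) \<Rightarrow> herm_coords W i j)" for U W i
  \<comment> \<open>The functional touches the value function at the right-hand side
    \<open>(J, 0)\<close>, so there is no duality gap.\<close>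
  obtain w where w: "\<And>z. (\<Sum>i\<in>?I. w i * z i) \<le> p z"
      "(\<Sum>i\<in>?I. w i * code J (\<lambda>_ _. 0) i) = p (code J (\<lambda>_ _. 0))"
    using finite_hahn_banach[OF _ sub local, of ?I] by auto
  \<comment> \<open>Dividing by 4 offsets the factor in \<open>trace_herm_of\<close>.\<close>
  define R where "R x y = herm_of (\<lambda>x y. w (Inl (x, y)) / 4) x y" for x y
  define \<rho> where "\<rho> i j = herm_of (\<lambda>i j. w (Inr (i, j)) / 4) i j" for i j
  have R_herm: "R y x = cnj (R x y)" for x y unfolding R_def by (rule herm_of_hermitian)
  have \<rho>_herm: "\<rho> j i = cnj (\<rho> i j)" for i j unfolding \<rho>_def by (rule herm_of_hermitian)
  let ?tr = "\<lambda>I A B. \<Sum>x\<in>I. \<Sum>y\<in>I. A x y * B y x :: complex"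
  define herm2 where "herm2 U W \<longleftrightarrow> (\<forall>x\<in>idx n. \<forall>y\<in>idx n. U y x = cnj (U x y)) \<and>
      (\<forall>i\<in>?D. \<forall>j\<in>?D. W j i = cnj (W i j))"
    for U :: "nat \<times> nat \<Rightarrow> nat \<times> nat \<Rightarrow> complex" and W :: "nat \<Rightarrow> nat \<Rightarrow> complex"
  have coordsI: "herm_of (herm_coords U) x y = U x y" if "herm2 U W" "x \<in> idx n" "y \<in> idx n" for U W x y
    by (rule herm_of_coords) (use that in \<open>unfold herm2_def, blast\<close>)
  have coordsD: "herm_of (herm_coords W) i j = W i j" if "herm2 U W" "i \<in> ?D" "j \<in> ?D" for U W i j
    by (rule herm_of_coords) (use that in \<open>unfold herm2_def, blast\<close>)
  have ZT: "x \<in> idx n \<Longrightarrow> y \<in> idx n \<Longrightarrow> Z (code U W) x y = U x y"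
      "i \<in> ?D \<Longrightarrow> j \<in> ?D \<Longrightarrow> T (code U W) i j = W i j"
    if "herm2 U W" for U W x y i j
    using coordsI[OF that] coordsD[OF that] unfolding Z_def T_def code_def by simp_all
  have pairing: "of_real (\<Sum>i\<in>?I. w i * code U W i) = ?tr (idx n) U R + ?tr ?D W \<rho>"
    if h: "herm2 U W" for U W
  proof -
    have "?tr (idx n) U R = ?tr (idx n) (herm_of (herm_coords U)) R"
      by (intro sum.cong refl) (simp add: coordsI[OF h])
    also have "\<dots> = of_real (\<Sum>x\<in>idx n. \<Sum>y\<in>idx n. w (Inl (x, y)) * herm_coords U x y)"
      unfolding R_def trace_herm_of by (simp add: sum_distrib_left mult_ac)
    finally have 1: "?tr (idx n) U R = of_real (\<Sum>x\<in>idx n. \<Sum>y\<in>idx n. w (Inl (x, y)) * herm_coords U x y)" .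
    have "?tr ?D W \<rho> = ?tr ?D (herm_of (herm_coords W)) \<rho>"
      by (intro sum.cong refl) (simp add: coordsD[OF h])
    also have "\<dots> = of_real (\<Sum>x\<in>?D. \<Sum>y\<in>?D. w (Inr (x, y)) * herm_coords W x y)"
      unfolding \<rho>_def trace_herm_of by (simp add: sum_distrib_left mult_ac)
    finally have 2: "?tr ?D W \<rho> = of_real (\<Sum>x\<in>?D. \<Sum>y\<in>?D. w (Inr (x, y)) * herm_coords W x y)" .
    have "(\<Sum>i\<in>?I. w i * code U W i) = (\<Sum>x\<in>idx n. \<Sum>y\<in>idx n. w (Inl (x, y)) * herm_coords U x y) +
        (\<Sum>x\<in>?D. \<Sum>y\<in>?D. w (Inr (x, y)) * herm_coords W x y)"
      by (subst sum.Plus) (simp_all add: sum.cartesian_product code_def case_prod_unfold)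
    then show ?thesis unfolding 1 2 by simp
  qed
  \<comment> \<open>Each dual constraint below comes from this inequality at a suitable feasible
    triple \<open>(U, W, \<mu>)\<close>.\<close>
  have key: "Re (?tr (idx n) U R) + Re (?tr ?D W \<rho>) \<le> \<mu>" if h: "herm2 U W" and f: "primal_feasible n U W \<mu>" for U W \<mu>
  proof -
    have "primal_feasible n (Z (code U W)) (T (code U W)) \<mu>"
      using f primal_feasible_cong[of n "Z (code U W)" U "T (code U W)" W] ZT[OF h] by simp
    then have "(\<Sum>i\<in>?I. w i * code U W i) \<le> \<mu>" using w(1) p_le order.trans by blast
    moreover have "(\<Sum>i\<in>?I. w i * code U W i) = Re (?tr (idx n) U R + ?tr ?D W \<rho>)"
      unfolding pairing[OF h, symmetric] by (rule Re_complex_of_real[symmetric])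
    ultimately show ?thesis by simp
  qed
  have trI: "?tr ?D (\<lambda>i j. of_real c * (if i = j then 1 else 0)) \<rho> = of_real c * (\<Sum>i\<in>?D. \<rho> i i)" for c
    by (simp add: sum_distrib_left if_distrib if_distribR cong: if_cong)
  have feasI: "primal_feasible n (\<lambda>_ _. 0) (\<lambda>i j. of_real c * (if i = j then 1 else 0)) c" for c
    unfolding primal_feasible_def
    by (intro exI[of _ "\<lambda>_ _. 0"]) (simp add: psd_on_zero pt_def tr_out_def)
  \<comment> \<open>The right-hand side \<open>(0, c I)\<close> is met at cost \<open>c\<close> by
    \<open>V = Y = 0\<close>; the values 1 and -1 of \<open>c\<close> pin the trace of
    \<open>\<rho>\<close> from both sides.\<close>
  have "c * Re (\<Sum>i\<in>?D. \<rho> i i) \<le> c" for c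
    using key[OF _ feasI[of c]] unfolding trI by (simp add: herm2_def)
  from this[of 1] this[of "-1"] have "Re (\<Sum>i\<in>?D. \<rho> i i) = 1" by simp
  moreover have "Im (\<rho> i i) = 0" for i by (simp add: \<rho>_def herm_of_def)
  ultimately have \<rho>1: "(\<Sum>i<d_in n. \<rho> i i) = 1" by (simp add: complex_eq_iff)
  let ?e = "\<lambda>x y. \<rho> (fst x) (fst y) * (if snd x = snd y then 1 else 0 :: complex)"
  have tre: "?tr ?D (\<lambda>i j. - tr_out n V i j) \<rho> = - ?tr (idx n) ?e V" for V
  proof -
    have "?tr ?D (\<lambda>i j. - tr_out n V i j) \<rho> = - ?tr ?D (tr_out n V) \<rho>" by (simp add: sum_negf)
    also have "?tr ?D (tr_out n V) \<rho> = ?tr (idx n) ?e V"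
      unfolding trace_tr_out by (subst sum.swap) (simp only: mult.commute)
    finally show ?thesis .
  qed
  have trp: "?tr (idx n) (pt n V) R = ?tr (idx n) (pt n R) V" for V
  proof -
    have "?tr (idx n) (pt n V) R = (\<Sum>x\<in>idx n. \<Sum>y\<in>idx n. V x y * pt n R y x)"
      unfolding sum_pt_swap[of "pt n V"] by (intro sum.cong refl) (simp add: pt_pt)
    also have "\<dots> = ?tr (idx n) (pt n R) V" by (subst sum.swap) (simp only: mult.commute)
    finally show ?thesis .
  qed
  \<comment> \<open>A positive \<open>V\<close>, taken as first variable for \<open>s = 1\<close>
    and as second for \<open>s = -1\<close>, has cost 0 for the right-hand side
    \<open>(?U, ?W)\<close>. Letting \<open>V\<close> range over the cone gives the dual constraints
    by self-duality.\<close>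
  have bound: "s * Re (?tr (idx n) (pt n R) V) \<le> Re (?tr (idx n) ?e V)"
    if V: "psd_on (idx n) V" and s: "s = 1 \<or> s = -1" for s V
  proof -
    let ?U = "\<lambda>x y. of_real s * pt n V x y" and ?W = "\<lambda>i j. - tr_out n V i j"
    have "primal_feasible n ?U ?W 0"
      unfolding primal_feasible_def using s
    proof
      assume "s = 1"
      then show "\<exists>V Y. psd_on (idx n) V \<and> psd_on (idx n) Y \<and>
         psd_on (idx n) (\<lambda>x y. pt n V x y - pt n Y x y - ?U x y) \<and>
         psd_on ?D (\<lambda>i j. of_real 0 * (if i = j then 1 else 0) - tr_out n V i j - tr_out n Y i j - ?W i j)"
        using V by (intro exI[of _ V] exI[of _ "\<lambda>_ _. 0"]) (simp add: psd_on_zero pt_def tr_out_def)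
    next
      assume "s = -1"
      then show "\<exists>V Y. psd_on (idx n) V \<and> psd_on (idx n) Y \<and>
         psd_on (idx n) (\<lambda>x y. pt n V x y - pt n Y x y - ?U x y) \<and>
         psd_on ?D (\<lambda>i j. of_real 0 * (if i = j then 1 else 0) - tr_out n V i j - tr_out n Y i j - ?W i j)"
        using V by (intro exI[of _ "\<lambda>_ _. 0"] exI[of _ V]) (simp add: psd_on_zero pt_def tr_out_def)
    qed
    moreover have "herm2 ?U ?W"
      unfolding herm2_def
    proof (intro conjI ballI)
      fix x y assume "x \<in> idx n" "y \<in> idx n"
      then have "pt n V y x = cnj (pt n V x y)"
        by (intro pt_hermitian[where n = n] psd_on_hermitian[OF V])
      then show "?U y x = cnj (?U x y)" by simp
    next
      fix i j assume "i \<in> ?D" "j \<in> ?D"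
      then have "tr_out n V j i = cnj (tr_out n V i j)"
        by (rule psd_on_hermitian[OF psd_tr_out[OF V]])
      then show "?W j i = cnj (?W i j)" by simp
    qed
    ultimately have "Re (?tr (idx n) ?U R) + Re (?tr ?D ?W \<rho>) \<le> 0" by (rule key[rotated])
    moreover have "?tr (idx n) ?U R = of_real s * ?tr (idx n) (pt n V) R"
      by (simp add: sum_distrib_left mult.assoc)
    ultimately show ?thesis unfolding tre trp by simp
  qed
  have psd: "psd_on (idx n) (\<lambda>x y. ?e x y + of_real s * pt n R x y)" if s: "s = 1 \<or> s = -1" for s
  proof (rule psd_on_traceI[OF finite_idx])
    fix x y assume "x \<in> idx n" "y \<in> idx n"
    have "pt n R y x = cnj (pt n R x y)" unfolding pt_def by (rule R_herm)
    moreover have "?e y x = cnj (?e x y)" using \<rho>_herm[of "fst x" "fst y"] by simp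
    ultimately show "?e y x + of_real s * pt n R y x = cnj (?e x y + of_real s * pt n R x y)" by simp
  next
    fix V assume V: "psd_on (idx n) V"
    have "?tr (idx n) (\<lambda>x y. ?e x y + of_real s * pt n R x y) V = ?tr (idx n) ?e V + of_real s * ?tr (idx n) (pt n R) V"
      unfolding distrib_right sum.distrib sum_distrib_left by (simp only: mult.assoc)
    then have "Re (?tr (idx n) (\<lambda>x y. ?e x y + of_real s * pt n R x y) V) = Re (?tr (idx n) ?e V) + s * Re (?tr (idx n) (pt n R) V)"
      by simp
    moreover have "- s * Re (?tr (idx n) (pt n R) V) \<le> Re (?tr (idx n) ?e V)"
      using s by (intro bound[OF V]) auto
    ultimately show "0 \<le> Re (?tr (idx n) (\<lambda>x y. ?e x y + of_real s * pt n R x y) V)" by linarith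
  qed
  define g where "g = p (code J (\<lambda>_ _. 0))"
  have hJ: "herm2 J (\<lambda>_ _. 0)" unfolding herm2_def by (intro conjI ballI J) simp_all
  have "?tr (idx n) J R = of_real g"
    using pairing[OF hJ] unfolding w(2) g_def by simp
  then have "dual_feasible n J g"
    unfolding dual_feasible_def using psd[of 1] psd[of "-1"] \<rho>1 by (intro exI[of _ R] exI[of _ \<rho>]) simp
  moreover have "\<exists>\<mu>. primal_feasible n J (\<lambda>_ _. 0) \<mu> \<and> \<mu> < g + \<epsilon>" if "0 < \<epsilon>" for \<epsilon>
  proof -
    have "\<exists>\<mu>\<in>S (code J (\<lambda>_ _. 0)). \<mu> < g + \<epsilon>"
      using that ne bdd unfolding g_def p_def by (intro cInf_lessD) auto
    moreover have "primal_feasible n (Z (code J (\<lambda>_ _. 0))) (T (code J (\<lambda>_ _. 0))) \<mu> \<longleftrightarrow> primal_feasible n J (\<lambda>_ _. 0) \<mu>" for \<mu>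
      by (rule primal_feasible_cong) (use ZT[OF hJ] in auto)
    ultimately show ?thesis unfolding S_def by auto
  qed
  ultimately show thesis by (rule that)
qed

end

section \<open>Kernels of matrices and channels\<close>

text \<open>Polarisation with two-point vectors: \<open>(1, 1)\<close> settles the imaginary parts
  and \<open>(1, \<i>)\<close> the real parts. This bridges \<open>psd\<close>, which asks only for
  a real nonnegative form, and \<open>psd_on\<close>, which has symmetry built in.\<close>

lemma hermitian_of_real_form:
  assumes "finite I" and real: "\<And>v. Im (\<Sum>x\<in>I. \<Sum>y\<in>I. cnj (v x) * A x y * v y) = 0"
    and ij: "i \<in> I" "j \<in> I"
  shows "A j i = cnj (A i j)"
proof -
  have diag: "Im (A i i) = 0" if "i \<in> I" for i
  proof -
    define v where "v x = (if x = i then 1 else 0 :: complex)" for x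
    have "(\<Sum>x\<in>I. \<Sum>y\<in>I. cnj (v x) * A x y * v y) = (\<Sum>x\<in>{i}. \<Sum>y\<in>I. cnj (v x) * A x y * v y)"
      using assms(1) that by (intro sum.mono_neutral_right) (auto simp: v_def)
    also have "\<dots> = (\<Sum>x\<in>{i}. \<Sum>y\<in>{i}. cnj (v x) * A x y * v y)"
      using assms(1) that by (intro sum.cong refl sum.mono_neutral_right) (auto simp: v_def)
    finally show ?thesis using real[of v] by (simp add: v_def)
  qed
  show ?thesis
  proof (cases "i = j")
    case True
    then show ?thesis using diag[OF ij(1)] by (simp add: complex_eq_iff)
  next
    case False
    have form: "Im (cnj s * A i i * s + cnj s * A i j * t + (cnj t * A j i * s + cnj t * A j j * t)) = 0" for s t
    proof -
      define v where "v x = (if x = i then s else if x = j then t else 0)" for x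
      have "(\<Sum>x\<in>I. \<Sum>y\<in>I. cnj (v x) * A x y * v y) = (\<Sum>x\<in>{i, j}. \<Sum>y\<in>I. cnj (v x) * A x y * v y)"
        using assms(1) ij by (intro sum.mono_neutral_right) (auto simp: v_def)
      also have "\<dots> = (\<Sum>x\<in>{i, j}. \<Sum>y\<in>{i, j}. cnj (v x) * A x y * v y)"
        using assms(1) ij by (intro sum.cong refl sum.mono_neutral_right) (auto simp: v_def)
      also have "\<dots> = cnj s * A i i * s + cnj s * A i j * t + (cnj t * A j i * s + cnj t * A j j * t)"
        using False by (simp add: v_def)
      finally show ?thesis using real[of v] by simp
    qed
    have "Im (A i j) + Im (A j i) = 0"
      using form[of 1 1] diag ij by simp
    moreover have "Re (A i j) - Re (A j i) = 0"
      using form[of 1 \<i>] diag ij by simp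
    ultimately show ?thesis by (simp add: complex_eq_iff)
  qed
qed

lemma psd_iff_psd_on:
  assumes "A \<in> carrier_mat d d"
  shows "psd A \<longleftrightarrow> psd_on {..<d} (\<lambda>i j. A $$ (i, j))"
proof -
  have form: "(\<Sum>i<dim_row A. cnj (v $ i) * (A *\<^sub>v v) $ i) = (\<Sum>i<d. \<Sum>j<d. cnj (v $ i) * A $$ (i, j) * v $ j)"
    if "dim_vec v = d" for v
    using assms that by (simp add: scalar_prod_def sum_distrib_left atLeast0LessThan mult.assoc)
  have vec: "(\<Sum>i<d. \<Sum>j<d. cnj (vec d v $ i) * A $$ (i, j) * vec d v $ j) =
      (\<Sum>i<d. \<Sum>j<d. cnj (v i) * A $$ (i, j) * v j)" for v
    by simp
  have "psd A \<longleftrightarrow> (\<forall>v. dim_vec v = d \<longrightarrow> Im (\<Sum>i<d. \<Sum>j<d. cnj (v $ i) * A $$ (i, j) * v $ j) = 0 \<and>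
      0 \<le> Re (\<Sum>i<d. \<Sum>j<d. cnj (v $ i) * A $$ (i, j) * v $ j))"
    using assms form unfolding psd_def Let_def by auto
  also have "\<dots> \<longleftrightarrow> (\<forall>v. Im (\<Sum>i<d. \<Sum>j<d. cnj (v i) * A $$ (i, j) * v j) = 0 \<and>
      0 \<le> Re (\<Sum>i<d. \<Sum>j<d. cnj (v i) * A $$ (i, j) * v j))"
    (is "?l \<longleftrightarrow> ?r")
  proof
    assume l: ?l
    show ?r
    proof
      fix v :: "nat \<Rightarrow> complex"
      show "Im (\<Sum>i<d. \<Sum>j<d. cnj (v i) * A $$ (i, j) * v j) = 0 \<and>
          0 \<le> Re (\<Sum>i<d. \<Sum>j<d. cnj (v i) * A $$ (i, j) * v j)"
        using l[rule_format, of "vec d v"] unfolding vec by simp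
    qed
  next
    assume ?r
    then show ?l by simp
  qed
  also have "\<dots> \<longleftrightarrow> psd_on {..<d} (\<lambda>i j. A $$ (i, j))"
  proof
    assume r: "\<forall>v. Im (\<Sum>i<d. \<Sum>j<d. cnj (v i) * A $$ (i, j) * v j) = 0 \<and>
      0 \<le> Re (\<Sum>i<d. \<Sum>j<d. cnj (v i) * A $$ (i, j) * v j)"
    show "psd_on {..<d} (\<lambda>i j. A $$ (i, j))"
    proof (rule psd_onI)
      fix i j assume "i \<in> {..<d}" "j \<in> {..<d}"
      then show "A $$ (j, i) = cnj (A $$ (i, j))"
        by (intro hermitian_of_real_form[of "{..<d}" "\<lambda>i j. A $$ (i, j)"]) (use r in auto)
    qed (use r in auto)
  next
    assume p: "psd_on {..<d} (\<lambda>i j. A $$ (i, j))"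
    obtain m :: nat and g :: "nat \<Rightarrow> nat \<Rightarrow> complex"
      where g: "\<forall>x\<in>{..<d}. \<forall>y\<in>{..<d}. A $$ (x, y) = (\<Sum>k<m. g k x * cnj (g k y))"
      using psd_on_gram[OF _ p] by auto
    have "(\<Sum>i<d. \<Sum>j<d. cnj (v i) * A $$ (i, j) * v j) =
      (\<Sum>i<d. \<Sum>j<d. cnj (v i) * (\<Sum>k<m. g k i * cnj (g k j)) * v j)" for v
      by (intro sum.cong refl) (simp add: g)
    then show "\<forall>v. Im (\<Sum>i<d. \<Sum>j<d. cnj (v i) * A $$ (i, j) * v j) = 0 \<and>
      0 \<le> Re (\<Sum>i<d. \<Sum>j<d. cnj (v i) * A $$ (i, j) * v j)"
      unfolding sum_gram_form by (auto intro!: sum_nonneg)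
  qed
  finally show ?thesis .
qed

lemma psd_on_flatten:
  fixes d e :: nat
  shows "psd_on {..<d * e} (\<lambda>r c. P (r div e, r mod e) (c div e, c mod e)) \<longleftrightarrow> psd_on ({..<d} \<times> {..<e}) P"
proof
  assume "psd_on ({..<d} \<times> {..<e}) P"
  then show "psd_on {..<d * e} (\<lambda>r c. P (r div e, r mod e) (c div e, c mod e))"
    by (rule psd_on_reindex[rotated])
      (auto simp: less_mult_imp_div_less intro!: mod_less_divisor gr0I)
next
  assume "psd_on {..<d * e} (\<lambda>r c. P (r div e, r mod e) (c div e, c mod e))"
  then have "psd_on ({..<d} \<times> {..<e}) (\<lambda>x y. P ((fst x * e + snd x) div e, (fst x * e + snd x) mod e)
      ((fst y * e + snd y) div e, (fst y * e + snd y) mod e))"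
    by (rule psd_on_reindex[rotated]) (auto simp: index_less)
  then show "psd_on ({..<d} \<times> {..<e}) P"
    by (rule iffD1[OF psd_on_cong, rotated]) (auto simp: index_div_mod)
qed

section \<open>Choi kernels of linear maps\<close>

lemma mat_unit_index:
  "k < d \<Longrightarrow> l < d \<Longrightarrow> mat_unit d i j $$ (k, l) = (if k = i \<and> l = j then 1 else 0)"
  by (simp add: mat_unit_def)

lemma mat_unit_carrier [simp]: "mat_unit d i j \<in> carrier_mat d d"
  by (simp add: mat_unit_def)

definition map_kernel :: "nat \<Rightarrow> (complex mat \<Rightarrow> complex mat) \<Rightarrow> nat \<times> nat \<Rightarrow> nat \<times> nat \<Rightarrow> complex" where
  "map_kernel d M x y = M (mat_unit d (fst x) (fst y)) $$ (snd x, snd y)"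

text \<open>Inverse of the Choi correspondence, linear by construction.\<close>

definition kernel_map :: "nat \<Rightarrow> nat \<Rightarrow> (nat \<times> nat \<Rightarrow> nat \<times> nat \<Rightarrow> complex) \<Rightarrow> complex mat \<Rightarrow> complex mat" where
  "kernel_map d e P X = mat e e (\<lambda>(k, l). \<Sum>i<d. \<Sum>j<d. X $$ (i, j) * P (i, k) (j, l))"

lemma map_kernel_kernel_map:
  assumes "x \<in> {..<d} \<times> {..<e}" "y \<in> {..<d} \<times> {..<e}"
  shows "map_kernel d (kernel_map d e P) x y = P x y"
proof -
  have "(\<Sum>i<d. \<Sum>j<d. mat_unit d (fst x) (fst y) $$ (i, j) * P (i, snd x) (j, snd y)) =
    (\<Sum>i<d. \<Sum>j<d. if i = fst x then if j = fst y then P (i, snd x) (j, snd y) else 0 else 0)"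
    by (intro sum.cong refl) (simp add: mat_unit_index)
  also have "\<dots> = (\<Sum>i<d. if i = fst x then (\<Sum>j<d. if j = fst y then P (i, snd x) (j, snd y) else 0) else 0)"
    by (intro sum.cong refl) simp
  also have "\<dots> = P x y" using assms by auto
  finally show ?thesis using assms by (auto simp: map_kernel_def kernel_map_def)
qed

lemma psd_choi_iff: "psd (choi d e M) \<longleftrightarrow> psd_on ({..<d} \<times> {..<e}) (map_kernel d M)"
proof -
  have "psd (choi d e M) \<longleftrightarrow> psd_on {..<d * e} (\<lambda>r c. choi d e M $$ (r, c))"
    by (rule psd_iff_psd_on) (simp add: choi_def)
  also have "\<dots> \<longleftrightarrow> psd_on {..<d * e} (\<lambda>r c. map_kernel d M (r div e, r mod e) (c div e, c mod e))"
    by (rule psd_on_cong) (simp add: choi_def map_kernel_def)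
  finally show ?thesis unfolding psd_on_flatten .
qed

lemma kernel_map_channel:
  assumes psd: "psd_on ({..<d} \<times> {..<e}) P"
    and tr: "\<And>i j. i < d \<Longrightarrow> j < d \<Longrightarrow> (\<Sum>k<e. P (i, k) (j, k)) = (if i = j then 1 else 0)"
  shows "is_channel d e (kernel_map d e P)"
  unfolding is_channel_def
proof (intro conjI ballI allI)
  fix X :: "complex mat" assume X: "X \<in> carrier_mat d d"
  show "kernel_map d e P X \<in> carrier_mat e e" by (simp add: kernel_map_def)
  have "mtrace (kernel_map d e P X) = (\<Sum>k<e. \<Sum>i<d. \<Sum>j<d. X $$ (i, j) * P (i, k) (j, k))"
    by (simp add: mtrace_def kernel_map_def)
  also have "\<dots> = (\<Sum>i<d. \<Sum>j<d. X $$ (i, j) * (\<Sum>k<e. P (i, k) (j, k)))"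
    unfolding sum_distrib_left by (subst sum.swap, rule sum.cong[OF refl], rule sum.swap)
  also have "\<dots> = (\<Sum>i<d. \<Sum>j<d. if i = j then X $$ (i, j) else 0)"
    by (intro sum.cong refl) (simp add: tr)
  also have "\<dots> = mtrace X" using X by (simp add: mtrace_def)
  finally show "mtrace (kernel_map d e P X) = mtrace X" .
next
  fix X Y :: "complex mat" assume "X \<in> carrier_mat d d" "Y \<in> carrier_mat d d"
  then show "kernel_map d e P (X + Y) = kernel_map d e P X + kernel_map d e P Y"
    by (intro eq_matI) (simp_all add: kernel_map_def distrib_right sum.distrib)
next
  fix c and X :: "complex mat" assume "X \<in> carrier_mat d d"
  then show "kernel_map d e P (c \<cdot>\<^sub>m X) = c \<cdot>\<^sub>m kernel_map d e P X"
    by (intro eq_matI) (simp_all add: kernel_map_def sum_distrib_left mult.assoc)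
next
  show "psd (choi d e (kernel_map d e P))"
    unfolding psd_choi_iff
    by (rule iffD2[OF psd_on_cong psd]) (rule map_kernel_kernel_map)
qed

lemma channel_kernel_trace:
  assumes "is_channel d e M" "i < d" "j < d"
  shows "(\<Sum>k<e. map_kernel d M (i, k) (j, k)) = (if i = j then 1 else 0)"
proof -
  have c: "M (mat_unit d i j) \<in> carrier_mat e e" "mtrace (M (mat_unit d i j)) = mtrace (mat_unit d i j)"
    using assms(1) unfolding is_channel_def by simp_all
  have "(\<Sum>k<e. map_kernel d M (i, k) (j, k)) = mtrace (M (mat_unit d i j))"
    using c(1) by (simp add: mtrace_def map_kernel_def)
  also have "\<dots> = (\<Sum>k<dim_row (mat_unit d i j). mat_unit d i j $$ (k, k))"
    using c(2) unfolding mtrace_def[of "mat_unit d i j"] .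
  also have "\<dots> = (\<Sum>k<d. if k = i then if i = j then 1 else 0 else 0)"
    by (rule sum.cong) (auto simp: mat_unit_def)
  finally show ?thesis using assms by simp
qed

text \<open>A matrix unit of the product space is a product of matrix units, so exactly one term of
  the fourfold sum survives.\<close>

lemma map_kernel_tensor_map:
  assumes "0 < d" "0 < e" "x \<in> {..<c * d} \<times> {..<b * e}" "y \<in> {..<c * d} \<times> {..<b * e}"
  shows "map_kernel (c * d) (tensor_map c d b e \<Phi> \<Psi>) x y =
    map_kernel c \<Phi> (fst x div d, snd x div e) (fst y div d, snd y div e) *
    map_kernel d \<Psi> (fst x mod d, snd x mod e) (fst y mod d, snd y mod e)"
proof -
  let ?F = "\<lambda>i1 j1 i2 j2. \<Phi> (mat_unit c i1 j1) $$ (snd x div e, snd y div e) * \<Psi> (mat_unit d i2 j2) $$ (snd x mod e, snd y mod e)"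
  let ?U = "mat_unit (c * d) (fst x) (fst y)"
  have ind: "?U $$ (i1 * d + i2, j1 * d + j2) =
      (if i1 = fst x div d \<and> j1 = fst y div d \<and> i2 = fst x mod d \<and> j2 = fst y mod d then 1 else 0)"
    if "i1 < c" "j1 < c" "i2 < d" "j2 < d" for i1 j1 i2 j2
  proof -
    have "i1 * d + i2 = r \<longleftrightarrow> i1 = r div d \<and> i2 = r mod d" if "i2 < d" for i1 i2 r :: nat
      using that by (metis div_mult_mod_eq index_div_mod)
    then show ?thesis using that by (simp add: mat_unit_index index_less conj_ac)
  qed
  have "(\<Sum>i1<c. \<Sum>j1<c. \<Sum>i2<d. \<Sum>j2<d. ?U $$ (i1 * d + i2, j1 * d + j2) * ?F i1 j1 i2 j2) =
    (\<Sum>i1<c. \<Sum>j1<c. \<Sum>i2<d. \<Sum>j2<d. if i1 = fst x div d then if j1 = fst y div d then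
      if i2 = fst x mod d then if j2 = fst y mod d then ?F i1 j1 i2 j2 else 0 else 0 else 0 else 0)"
    by (intro sum.cong refl) (simp add: ind)
  also have "\<dots> = ?F (fst x div d) (fst y div d) (fst x mod d) (fst y mod d)"
  proof -
    have delta: "(\<Sum>i<n. if i = t then f i else 0) = f t" if "t < n" for n t and f :: "nat \<Rightarrow> complex"
      using that by simp
    have sum_if: "(\<Sum>i<n. if P then f i else 0) = (if P then \<Sum>i<n. f i else 0)" for n P and f :: "nat \<Rightarrow> complex"
      by simp
    have "fst x div d < c" "fst y div d < c" "fst x mod d < d" "fst y mod d < d"
      using assms by (auto simp: less_mult_imp_div_less)
    then show ?thesis by (simp only: sum_if delta)
  qed
  finally show ?thesis
    using assms by (auto simp: map_kernel_def tensor_map_def mult.assoc)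
qed

text \<open>\<open>tensor_map\<close> evaluates its factors only at matrix units and depends
  linearly on the entries of \<open>X\<close>, so its Choi kernel determines it.\<close>

lemma tensor_map_eq_kernel_map:
  assumes "0 < d" "0 < e" "X \<in> carrier_mat (c * d) (c * d)"
  shows "tensor_map c d b e \<Phi> \<Psi> X = kernel_map (c * d) (b * e) (map_kernel (c * d) (tensor_map c d b e \<Phi> \<Psi>)) X"
proof (rule eq_matI)
  fix k l assume "k < dim_row (kernel_map (c * d) (b * e) (map_kernel (c * d) (tensor_map c d b e \<Phi> \<Psi>)) X)"
    "l < dim_col (kernel_map (c * d) (b * e) (map_kernel (c * d) (tensor_map c d b e \<Phi> \<Psi>)) X)"
  then have kl: "k < b * e" "l < b * e" by (simp_all add: kernel_map_def)
  let ?F = "\<lambda>i1 j1 i2 j2. \<Phi> (mat_unit c i1 j1) $$ (k div e, l div e) * \<Psi> (mat_unit d i2 j2) $$ (k mod e, l mod e)"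
  have "(\<Sum>i<c * d. \<Sum>j<c * d. X $$ (i, j) * map_kernel (c * d) (tensor_map c d b e \<Phi> \<Psi>) (i, k) (j, l))
    = (\<Sum>i<c * d. \<Sum>j<c * d. X $$ (i, j) * ?F (i div d) (j div d) (i mod d) (j mod d))"
    using kl assms by (intro sum.cong refl) (simp add: map_kernel_tensor_map, simp add: map_kernel_def)
  also have "\<dots> = (\<Sum>i1<c. \<Sum>i2<d. \<Sum>j1<c. \<Sum>j2<d. X $$ (i1 * d + i2, j1 * d + j2) * ?F i1 j1 i2 j2)"
    using assms(1) by (simp add: sum_lessThan_mult index_div_mod)
  also have "\<dots> = (\<Sum>i1<c. \<Sum>j1<c. \<Sum>i2<d. \<Sum>j2<d. X $$ (i1 * d + i2, j1 * d + j2) * ?F i1 j1 i2 j2)"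
    by (rule sum.cong[OF refl], rule sum.swap)
  finally show "tensor_map c d b e \<Phi> \<Psi> X $$ (k, l) =
      kernel_map (c * d) (b * e) (map_kernel (c * d) (tensor_map c d b e \<Phi> \<Psi>)) X $$ (k, l)"
    using kl by (simp add: tensor_map_def kernel_map_def mult.assoc)
qed (simp_all add: tensor_map_def kernel_map_def)

section \<open>The operator norm\<close>

lemma op_norm_bdd:
  "bdd_above {cvec_norm (A *\<^sub>v v) | v. dim_vec v = dim_col A \<and> cvec_norm v \<le> 1}"
proof (rule bdd_aboveI)
  fix c assume "c \<in> {cvec_norm (A *\<^sub>v v) | v. dim_vec v = dim_col A \<and> cvec_norm v \<le> 1}"
  then obtain v where v: "c = cvec_norm (A *\<^sub>v v)" "dim_vec v = dim_col A" "cvec_norm v \<le> 1" by blast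
  \<comment> \<open>Vectors in the unit ball have entries of modulus at most 1. The resulting bound
    is far from sharp, but it makes the \<open>Sup\<close> in \<open>op_norm\<close>
    meaningful.\<close>
  have v1: "cmod (v $ j) \<le> 1" if "j < dim_col A" for j
  proof -
    have "cmod (v $ j) = sqrt ((cmod (v $ j))\<^sup>2)" by simp
    also have "\<dots> \<le> cvec_norm v"
      unfolding cvec_norm_def using that v(2) by (intro real_sqrt_le_mono member_le_sum) auto
    finally show ?thesis using v(3) by simp
  qed
  have "cmod ((A *\<^sub>v v) $ i) \<le> (\<Sum>j<dim_col A. cmod (A $$ (i, j)))" if "i < dim_row A" for i
  proof -
    have "cmod ((A *\<^sub>v v) $ i) \<le> (\<Sum>j<dim_col A. cmod (A $$ (i, j)) * cmod (v $ j))"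
      using that v(2) by (simp add: scalar_prod_def atLeast0LessThan norm_mult[symmetric] norm_sum)
    also have "\<dots> \<le> (\<Sum>j<dim_col A. cmod (A $$ (i, j)) * 1)"
      by (intro sum_mono mult_left_mono v1) auto
    finally show ?thesis by simp
  qed
  then show "c \<le> sqrt (\<Sum>i<dim_row A. (\<Sum>j<dim_col A. cmod (A $$ (i, j)))\<^sup>2)"
    unfolding v(1) cvec_norm_def by (intro real_sqrt_le_mono) (auto intro!: sum_mono power_mono)
qed

lemma op_norm_nonneg: "0 \<le> op_norm A"
proof -
  have "cvec_norm (A *\<^sub>v 0\<^sub>v (dim_col A)) = 0"
    by (simp add: cvec_norm_def)
  then have "0 \<in> {cvec_norm (A *\<^sub>v v) | v. dim_vec v = dim_col A \<and> cvec_norm v \<le> 1}"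
    by (intro CollectI exI[of _ "0\<^sub>v (dim_col A)"]) (simp add: cvec_norm_def)
  then show ?thesis unfolding op_norm_def by (rule cSup_upper[OF _ op_norm_bdd])
qed

text \<open>For \<open>0 \<le> T \<le> \<mu>\<close> the two quadratic forms \<open>\<mu> - T\<close> at \<open>T v\<close> and \<open>T\<close> at
  \<open>T v - \<mu> v\<close> combine to \<open>\<parallel>T v\<parallel>\<^sup>2 \<le> \<mu> \<langle>v, T v\<rangle>\<close>.\<close>

lemma op_norm_le:
  assumes T: "psd_on {..<d} T" and le: "psd_on {..<d} (\<lambda>i j. of_real \<mu> * (if i = j then 1 else 0) - T i j)"
    and "0 < \<mu>"
  shows "op_norm (mat d d (\<lambda>(i, j). T i j)) \<le> \<mu>"
  unfolding op_norm_def
proof (rule cSup_least)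
  show "{cvec_norm (mat d d (\<lambda>(i, j). T i j) *\<^sub>v v) |v. dim_vec v = dim_col (mat d d (\<lambda>(i, j). T i j)) \<and> cvec_norm v \<le> 1} \<noteq> {}"
    by (auto intro!: exI[of _ "0\<^sub>v d"] simp: cvec_norm_def)
next
  fix c assume "c \<in> {cvec_norm (mat d d (\<lambda>(i, j). T i j) *\<^sub>v v) |v. dim_vec v = dim_col (mat d d (\<lambda>(i, j). T i j)) \<and> cvec_norm v \<le> 1}"
  then obtain v where v: "c = cvec_norm (mat d d (\<lambda>(i, j). T i j) *\<^sub>v v)" "dim_vec v = d" "cvec_norm v \<le> 1" by auto
  define u where "u i = (\<Sum>j<d. T i j * v $ j)" for i
  define w where "w i = (\<Sum>j<d. T i j * u j)" for i
  define U where "U = (\<Sum>i<d. (cmod (u i))\<^sup>2)"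
  define N where "N = (\<Sum>i<d. (cmod (v $ i))\<^sup>2)"
  have sq: "(\<Sum>i<d. cnj (z i) * z i) = of_real (\<Sum>i<d. (cmod (z i))\<^sup>2)" for z :: "nat \<Rightarrow> complex"
    unfolding of_real_sum complex_norm_square by (simp only: mult.commute)
  have herm: "T j i = cnj (T i j)" if "i < d" "j < d" for i j
    using psd_on_hermitian[OF T] that by blast
  have vw: "(\<Sum>i<d. cnj (v $ i) * w i) = of_real U"
  proof -
    have "(\<Sum>i<d. cnj (v $ i) * w i) = (\<Sum>i<d. \<Sum>j<d. cnj (v $ i) * (T i j * u j))"
      by (simp add: w_def sum_distrib_left)
    also have "\<dots> = (\<Sum>j<d. \<Sum>i<d. cnj (v $ i) * (T i j * u j))" by (rule sum.swap)
    also have "\<dots> = (\<Sum>j<d. cnj (u j) * u j)"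
      unfolding u_def cnj_sum sum_distrib_right
    proof (intro sum.cong refl)
      fix j i assume "j \<in> {..<d}" "i \<in> {..<d}"
      then show "cnj (v $ i) * (T i j * (\<Sum>j'<d. T j j' * v $ j')) = cnj (T j i * v $ i) * (\<Sum>j'<d. T j j' * v $ j')"
        using herm[of j i] by simp
    qed
    finally show ?thesis unfolding sq U_def .
  qed
  have fT: "(\<Sum>i<d. \<Sum>j<d. cnj (z i) * T i j * z j) = (\<Sum>i<d. cnj (z i) * (\<Sum>j<d. T i j * z j))" for z
    by (simp add: sum_distrib_left mult.assoc)
  have fM: "(\<Sum>i<d. \<Sum>j<d. cnj (z i) * (of_real \<mu> * (if i = j then 1 else 0) - T i j) * z j) =
      of_real (\<mu> * (\<Sum>i<d. (cmod (z i))\<^sup>2)) - (\<Sum>i<d. cnj (z i) * (\<Sum>j<d. T i j * z j))" for z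
  proof -
    have "(\<Sum>i<d. \<Sum>j<d. cnj (z i) * (of_real \<mu> * (if i = j then 1 else 0) - T i j) * z j) =
      (\<Sum>i<d. \<Sum>j<d. (if i = j then of_real \<mu> * (cnj (z i) * z j) else 0)) - (\<Sum>i<d. \<Sum>j<d. cnj (z i) * T i j * z j)"
      unfolding sum_subtractf[symmetric] by (intro sum.cong refl) (simp add: algebra_simps)
    also have "(\<Sum>i<d. \<Sum>j<d. (if i = j then of_real \<mu> * (cnj (z i) * z j) else 0)) = of_real (\<mu> * (\<Sum>i<d. (cmod (z i))\<^sup>2))"
      unfolding of_real_mult sq[symmetric] by (simp add: sum_distrib_left)
    finally show ?thesis unfolding fT .
  qed
  define uw where "uw = Re (\<Sum>i<d. cnj (u i) * w i)"
  define vu where "vu = Re (\<Sum>i<d. cnj (v $ i) * u i)"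
  have 1: "uw \<le> \<mu> * U"
    using psd_on_form[OF le, of u] unfolding fM w_def[symmetric] U_def[symmetric] uw_def by simp
  have 2: "vu \<le> \<mu> * N"
    using psd_on_form[OF le, of "\<lambda>i. v $ i"] unfolding fM u_def[symmetric] N_def[symmetric] vu_def by simp
  have lin: "(\<Sum>j<d. T i j * (u j - of_real \<mu> * v $ j)) = w i - of_real \<mu> * u i" for i
    by (simp add: w_def u_def sum_distrib_left algebra_simps sum_subtractf)
  have "(\<Sum>i<d. cnj (u i - of_real \<mu> * v $ i) * (w i - of_real \<mu> * u i)) =
      (\<Sum>i<d. cnj (u i) * w i) - of_real \<mu> * (\<Sum>i<d. cnj (u i) * u i) - of_real \<mu> * (\<Sum>i<d. cnj (v $ i) * w i)
      + of_real (\<mu> * \<mu>) * (\<Sum>i<d. cnj (v $ i) * u i)"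
    unfolding sum_distrib_left sum_subtractf[symmetric] sum.distrib[symmetric]
    by (intro sum.cong refl) (simp add: algebra_simps)
  \<comment> \<open>Both mixed terms equal \<open>U\<close>, one by definition and the other because
    \<open>T\<close> is Hermitian.\<close>
  then have "0 \<le> uw - 2 * (\<mu> * U) + \<mu> * \<mu> * vu"
    using psd_on_form[OF T, of "\<lambda>i. u i - of_real \<mu> * v $ i"]
    unfolding fT lin sq U_def[symmetric] vw by (simp add: uw_def vu_def mult_ac)
  then have "\<mu> * U \<le> \<mu> * (\<mu> * vu)" using 1 by (simp add: algebra_simps)
  \<comment> \<open>Cancelling \<mu> needs strict positivity; the final argument provides it by
    adding a small slack to the primal value.\<close>
  then have "U \<le> \<mu> * vu" using \<open>0 < \<mu>\<close> by simp
  also have "\<dots> \<le> \<mu> * (\<mu> * N)" using 2 \<open>0 < \<mu>\<close> by simp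
  also have "\<dots> \<le> \<mu> * (\<mu> * 1)"
  proof -
    have "N \<le> 1" using v(2,3) by (simp add: cvec_norm_def N_def)
    then show ?thesis using \<open>0 < \<mu>\<close> by (intro mult_left_mono) auto
  qed
  finally have "sqrt U \<le> \<mu>" using \<open>0 < \<mu>\<close> by (intro real_le_lsqrt) (auto simp: power2_eq_square)
  moreover have "c = sqrt U"
    unfolding v(1) cvec_norm_def U_def u_def using v(2)
    by (simp add: scalar_prod_def atLeast0LessThan)
  ultimately show "c \<le> \<mu>" by simp
qed

section \<open>The regularised lower bound\<close>

context bipartite_dims
begin

section \<open>Channels and costs of several copies in terms of kernels\<close>

abbreviation in_dims :: "nat \<Rightarrow> nat list" where "in_dims n \<equiv> concat (replicate n [a, b])"
abbreviation out_dims :: "nat \<Rightarrow> nat list" where "out_dims n \<equiv> concat (replicate n [a', b'])"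

lemma prod_dims: "prod_list (in_dims n) = d_in n" "prod_list (out_dims n) = d_out n"
  by (simp_all add: prod_list_replicate_pair d_in_def d_out_def)

definition flat :: "nat \<Rightarrow> (nat \<times> nat \<Rightarrow> nat \<times> nat \<Rightarrow> complex) \<Rightarrow> complex mat" where
  "flat n P = mat (d_in n * d_out n) (d_in n * d_out n)
     (\<lambda>(r, c). P (r div d_out n, r mod d_out n) (c div d_out n, c mod d_out n))"

lemma flat_carrier [simp]: "flat n P \<in> carrier_mat (d_in n * d_out n) (d_in n * d_out n)"
  by (simp add: flat_def)

lemma psd_flat: "psd (flat n P) \<longleftrightarrow> psd_on (idx n) P"
proof -
  have "psd (flat n P) \<longleftrightarrow> psd_on {..<d_in n * d_out n} (\<lambda>r c. flat n P $$ (r, c))"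
    by (rule psd_iff_psd_on) simp
  also have "\<dots> \<longleftrightarrow> psd_on {..<d_in n * d_out n} (\<lambda>r c. P (r div d_out n, r mod d_out n) (c div d_out n, c mod d_out n))"
    by (rule psd_on_cong) (simp add: flat_def)
  finally show ?thesis unfolding psd_on_flatten idx_def .
qed

lemma choi_flat: "choi (d_in n) (d_out n) M = flat n (map_kernel (d_in n) M)"
  by (rule eq_matI) (simp_all add: choi_def flat_def map_kernel_def)

lemma mix_index_dims:
  "mix_index (in_dims n @ out_dims n) {k. odd k} r c =
    swap_index a b n (r div d_out n) (c div d_out n) * d_out n + swap_index a' b' n (r mod d_out n) (c mod d_out n)"
proof -
  have "mix_index (in_dims n @ out_dims n) {k. odd k} (r div d_out n * prod_list (out_dims n) + r mod d_out n)
      (c div d_out n * prod_list (out_dims n) + c mod d_out n) =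
    swap_index a b n (r div d_out n) (c div d_out n) * prod_list (out_dims n) + swap_index a' b' n (r mod d_out n) (c mod d_out n)"
    unfolding swap_index_def
    by (rule mix_index_append_odd) (simp_all only: prod_dims length_replicate_pair even_mult_iff even_numeral simp_thms mod_less_divisor d_pos)
  then show ?thesis by (simp only: prod_dims div_mult_mod_eq)
qed

lemma ptrans_flat: "ptrans (in_dims n @ out_dims n) {k. odd k} (flat n P) = flat n (pt n P)"
proof (rule eq_matI)
  fix r c assume "r < dim_row (flat n (pt n P))" "c < dim_col (flat n (pt n P))"
  then have rc: "r < d_in n * d_out n" "c < d_in n * d_out n" by (simp_all add: flat_def)
  have swaps: "swap_index a b n (r div d_out n) (c div d_out n) < d_in n" "swap_index a b n (c div d_out n) (r div d_out n) < d_in n"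
    "swap_index a' b' n (r mod d_out n) (c mod d_out n) < d_out n" "swap_index a' b' n (c mod d_out n) (r mod d_out n) < d_out n"
    using swap_index_less[OF dims_pos(1,2)] swap_index_less[OF dims_pos(3,4)] rc
    by (auto simp: d_in_def[symmetric] d_out_def[symmetric] less_mult_imp_div_less)
  show "ptrans (in_dims n @ out_dims n) {k. odd k} (flat n P) $$ (r, c) = flat n (pt n P) $$ (r, c)"
    using rc swaps
    by (simp add: ptrans_def prod_dims mix_index_dims flat_def index_less index_div_mod pt_def sw_def)
qed (simp_all add: ptrans_def prod_dims flat_def)

lemma ppt_channel_kernel:
  assumes "ppt_channel (in_dims n) (out_dims n) {k. odd k} M"
  shows "ppt_kernel n 1 (map_kernel (d_in n) M)"
  using assms channel_kernel_trace[of "d_in n" "d_out n" M]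
  unfolding ppt_channel_def ppt_kernel_def prod_dims choi_flat ptrans_flat psd_flat marginal_def is_channel_def
  by simp

lemma kernel_ppt_channel:
  assumes "ppt_kernel n 1 P"
  shows "ppt_channel (in_dims n) (out_dims n) {k. odd k} (kernel_map (d_in n) (d_out n) P)"
  unfolding ppt_channel_def prod_dims
proof
  show "is_channel (d_in n) (d_out n) (kernel_map (d_in n) (d_out n) P)"
    using assms unfolding ppt_kernel_def marginal_def idx_def by (intro kernel_map_channel) auto
  have eq: "pt n (map_kernel (d_in n) (kernel_map (d_in n) (d_out n) P)) x y = pt n P x y"
    if "x \<in> idx n" "y \<in> idx n" for x y
    using sw_in_idx[OF that(1), of y] sw_in_idx[OF that(2), of x] unfolding pt_def idx_def
    by (intro map_kernel_kernel_map)
  show "psd (ptrans (in_dims n @ out_dims n) {k. odd k} (choi (d_in n) (d_out n) (kernel_map (d_in n) (d_out n) P)))"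
    unfolding choi_flat ptrans_flat psd_flat
    by (rule iffD2[OF psd_on_cong, OF eq]) (use assms in \<open>simp_all add: ppt_kernel_def\<close>)
qed

text \<open>By \<open>lin\<close> the Choi kernel determines \<open>\<Phi>\<close>. Channels become
  kernels by scaling with \<open>c1\<close> and \<open>c2\<close>; the way back divides by the
  weights, and \<open>ppt_kernel_normalize\<close> covers weight 0.\<close>

lemma gamma_PPT_eq:
  assumes lin: "\<And>X. X \<in> carrier_mat (d_in n) (d_in n) \<Longrightarrow> \<Phi> X = kernel_map (d_in n) (d_out n) (map_kernel (d_in n) \<Phi>) X"
  shows "gamma_PPT (in_dims n) (out_dims n) {k. odd k} \<Phi> = Inf (ppt_costs n (map_kernel (d_in n) \<Phi>))"
proof -
  let ?K = "kernel_map (d_in n) (d_out n)"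
  let ?S = "{c1 + c2 | c1 c2 M1 M2.
      c1 \<ge> 0 \<and> c2 \<ge> 0 \<and> ppt_channel (in_dims n) (out_dims n) {k. odd k} M1 \<and> ppt_channel (in_dims n) (out_dims n) {k. odd k} M2 \<and>
      (\<forall>X \<in> carrier_mat (d_in n) (d_in n). \<Phi> X = complex_of_real c1 \<cdot>\<^sub>m M1 X - complex_of_real c2 \<cdot>\<^sub>m M2 X)}"
  have "v \<in> ppt_costs n (map_kernel (d_in n) \<Phi>)" if vS: "v \<in> ?S" for v
  proof -
    obtain c1 c2 M1 M2 where v: "v = c1 + c2" "c1 \<ge> 0" "c2 \<ge> 0"
      "ppt_channel (in_dims n) (out_dims n) {k. odd k} M1" "ppt_channel (in_dims n) (out_dims n) {k. odd k} M2"
      "\<forall>X \<in> carrier_mat (d_in n) (d_in n). \<Phi> X = complex_of_real c1 \<cdot>\<^sub>m M1 X - complex_of_real c2 \<cdot>\<^sub>m M2 X"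
      using vS by blast
    let ?P1 = "\<lambda>x y. of_real c1 * map_kernel (d_in n) M1 x y" and ?P2 = "\<lambda>x y. of_real c2 * map_kernel (d_in n) M2 x y"
    have "ppt_kernel n c1 ?P1" "ppt_kernel n c2 ?P2"
      using ppt_kernel_scale[OF ppt_channel_kernel[OF v(4)] v(2)] ppt_kernel_scale[OF ppt_channel_kernel[OF v(5)] v(3)]
      by simp_all
    moreover have "map_kernel (d_in n) \<Phi> x y = ?P1 x y - ?P2 x y" if xy: "x \<in> idx n" "y \<in> idx n" for x y
    proof -
      have c: "M1 (mat_unit (d_in n) i j) \<in> carrier_mat (d_out n) (d_out n)" "M2 (mat_unit (d_in n) i j) \<in> carrier_mat (d_out n) (d_out n)" for i j
        using v(4,5) unfolding ppt_channel_def is_channel_def prod_dims by simp_all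
      show ?thesis
        using v(6) c[of "fst x" "fst y"] xy unfolding map_kernel_def idx_def by auto
    qed
    ultimately show ?thesis unfolding ppt_costs_def v(1) using v(2,3) by blast
  qed
  moreover have "v \<in> ?S" if vP: "v \<in> ppt_costs n (map_kernel (d_in n) \<Phi>)" for v
  proof -
    obtain c1 c2 P1 P2 where v: "v = c1 + c2" "0 \<le> c1" "0 \<le> c2" "ppt_kernel n c1 P1" "ppt_kernel n c2 P2"
      "\<forall>x\<in>idx n. \<forall>y\<in>idx n. map_kernel (d_in n) \<Phi> x y = P1 x y - P2 x y"
      using vP unfolding ppt_costs_def by blast
    obtain K1 where K1: "ppt_kernel n 1 K1" "\<forall>x\<in>idx n. \<forall>y\<in>idx n. P1 x y = of_real c1 * K1 x y"
      using ppt_kernel_normalize[OF v(4,2)] by blast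
    obtain K2 where K2: "ppt_kernel n 1 K2" "\<forall>x\<in>idx n. \<forall>y\<in>idx n. P2 x y = of_real c2 * K2 x y"
      using ppt_kernel_normalize[OF v(5,3)] by blast
    have "\<Phi> X = complex_of_real c1 \<cdot>\<^sub>m ?K K1 X - complex_of_real c2 \<cdot>\<^sub>m ?K K2 X"
      if X: "X \<in> carrier_mat (d_in n) (d_in n)" for X
    proof (rule eq_matI)
      fix k l assume "k < dim_row (complex_of_real c1 \<cdot>\<^sub>m ?K K1 X - complex_of_real c2 \<cdot>\<^sub>m ?K K2 X)"
        "l < dim_col (complex_of_real c1 \<cdot>\<^sub>m ?K K1 X - complex_of_real c2 \<cdot>\<^sub>m ?K K2 X)"
      then have kl: "k < d_out n" "l < d_out n" by (simp_all add: kernel_map_def)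
      have e: "map_kernel (d_in n) \<Phi> (i, k) (j, l) = of_real c1 * K1 (i, k) (j, l) - of_real c2 * K2 (i, k) (j, l)"
        if "i < d_in n" "j < d_in n" for i j
      proof -
        have "(i, k) \<in> idx n" "(j, l) \<in> idx n" using that kl by (simp_all add: idx_def)
        then show ?thesis using v(6) K1(2) K2(2) by metis
      qed
      have "(\<Sum>i<d_in n. \<Sum>j<d_in n. X $$ (i, j) * map_kernel (d_in n) \<Phi> (i, k) (j, l)) =
        (\<Sum>i<d_in n. \<Sum>j<d_in n. of_real c1 * (X $$ (i, j) * K1 (i, k) (j, l)) - of_real c2 * (X $$ (i, j) * K2 (i, k) (j, l)))"
        by (intro sum.cong refl) (simp add: e algebra_simps)
      then show "\<Phi> X $$ (k, l) = (complex_of_real c1 \<cdot>\<^sub>m ?K K1 X - complex_of_real c2 \<cdot>\<^sub>m ?K K2 X) $$ (k, l)"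
        unfolding lin[OF X] using kl by (simp add: kernel_map_def sum_subtractf sum_distrib_left)
    qed (subst lin[OF X], simp add: kernel_map_def)+
    then show ?thesis
      using v(1,2,3) kernel_ppt_channel[OF K1(1)] kernel_ppt_channel[OF K2(1)] by blast
  qed
  ultimately have "?S = ppt_costs n (map_kernel (d_in n) \<Phi>)" by blast
  then show ?thesis unfolding gamma_PPT_def prod_dims by simp
qed

lemma map_kernel_tensor_pow:
  assumes "x \<in> idx n" "y \<in> idx n"
  shows "map_kernel (d_in n) (tensor_pow (a * b) (a' * b') N n) x y = kpow (map_kernel (d_in 1) N) n x y"
  using assms
proof (induction n arbitrary: x y)
  case 0
  then show ?case by (auto simp: map_kernel_def idx_def d_in_def d_out_def mat_unit_def)
next
  case (Suc n)
  have d: "d_in (Suc n) = (a * b) ^ n * (a * b)" "d_out (Suc n) = (a' * b') ^ n * (a' * b')" "d_in 1 = a * b" "d_out 1 = a' * b'"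
    by (simp_all add: d_in_def d_out_def)
  have hl: "hi 1 x = (fst x div (a * b), snd x div (a' * b'))" "lo 1 x = (fst x mod (a * b), snd x mod (a' * b'))" for x
    unfolding hi_def lo_def d by simp_all
  have "map_kernel (d_in (Suc n)) (tensor_pow (a * b) (a' * b') N (Suc n)) x y =
    map_kernel (d_in n) (tensor_pow (a * b) (a' * b') N n) (hi 1 x) (hi 1 y) * map_kernel (d_in 1) N (lo 1 x) (lo 1 y)"
    unfolding d tensor_pow.simps hl d_in_def[of n]
    using Suc.prems dims_pos by (intro map_kernel_tensor_map) (simp_all add: idx_def d)
  also have "map_kernel (d_in n) (tensor_pow (a * b) (a' * b') N n) (hi 1 x) (hi 1 y) = kpow (map_kernel (d_in 1) N) n (hi 1 x) (hi 1 y)"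
    using Suc.prems by (intro Suc.IH hi_in_idx) simp_all
  finally show ?case by (simp add: tens_def)
qed

lemma gamma_PPT_n_eq:
  assumes "1 \<le> n"
  shows "gamma_PPT_n a b a' b' N n = Inf (ppt_costs n (kpow (map_kernel (d_in 1) N) n)) powr (1 / real n)"
proof -
  let ?T = "tensor_pow (a * b) (a' * b') N n"
  obtain m where m: "n = Suc m" using assms by (cases n) auto
  have d: "d_in (Suc m) = (a * b) ^ m * (a * b)" "d_out (Suc m) = (a' * b') ^ m * (a' * b')"
    by (simp_all add: d_in_def d_out_def)
  have "?T X = kernel_map (d_in n) (d_out n) (map_kernel (d_in n) ?T) X" if "X \<in> carrier_mat (d_in n) (d_in n)" for X
    using that dims_pos unfolding m tensor_pow.simps d by (intro tensor_map_eq_kernel_map) simp_all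
  then have "gamma_PPT (in_dims n) (out_dims n) {k. odd k} ?T = Inf (ppt_costs n (map_kernel (d_in n) ?T))"
    by (rule gamma_PPT_eq)
  also have "ppt_costs n (map_kernel (d_in n) ?T) = ppt_costs n (kpow (map_kernel (d_in 1) N) n)"
    by (rule ppt_costs_cong) (rule map_kernel_tensor_pow)
  finally show ?thesis by (simp add: gamma_PPT_n_def)
qed

section \<open>The program for \<Gamma> in terms of kernels\<close>

lemma ptrans_two_parties: "ptrans [a, b, a', b'] {1, 3} (flat 1 P) = flat 1 (pt 1 P)"
proof -
  \<comment> \<open>Among the four positions, \<open>{1, 3}\<close> are the odd ones.\<close>
  have "mix_index [a, b, a', b'] {1, 3} i j = mix_index (in_dims 1 @ out_dims 1) {k. odd k} i j" for i j
    by (simp add: mix_index_def lessThan_Suc numeral_3_eq_3)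
  then have "ptrans [a, b, a', b'] {1, 3} (flat 1 P) = ptrans (in_dims 1 @ out_dims 1) {k. odd k} (flat 1 P)"
    unfolding ptrans_def by simp
  then show ?thesis by (simp only: ptrans_flat)
qed

definition Gamma22_values :: "(complex mat \<Rightarrow> complex mat) \<Rightarrow> real set" where
  "Gamma22_values N = {op_norm (ptrace_out (a * b) (a' * b') (V + Y)) | V Y.
      V \<in> carrier_mat (a * b * (a' * b')) (a * b * (a' * b')) \<and>
      Y \<in> carrier_mat (a * b * (a' * b')) (a * b * (a' * b')) \<and>
      psd V \<and> psd Y \<and>
      loewner_ge (ptrans [a, b, a', b'] {1, 3} (V - Y)) (choi (a * b) (a' * b') N)}"

lemma Gamma22_eq: "Gamma22 a b a' b' N = Inf (Gamma22_values N)"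
  by (simp add: Gamma22_def Gamma22_values_def)

lemma Gamma22_values_nonneg: "s \<in> Gamma22_values N \<Longrightarrow> 0 \<le> s"
  by (auto simp: Gamma22_values_def op_norm_nonneg)

text \<open>One direction between the two programs is enough: near-optimal kernels yield matrices
  for \<open>Gamma22\<close>, which bounds \<Gamma> from above by the dual value.\<close>

lemma Gamma22_member:
  assumes "primal_feasible 1 (map_kernel (d_in 1) N) (\<lambda>_ _. 0) \<mu>" "0 < \<mu>"
  shows "\<exists>s\<in>Gamma22_values N. s \<le> \<mu>"
proof -
  let ?J = "map_kernel (d_in 1) N"
  have d: "d_in 1 = a * b" "d_out 1 = a' * b'" by (simp_all add: d_in_def d_out_def)
  obtain V Y where V: "psd_on (idx 1) V" "psd_on (idx 1) Y" "psd_on (idx 1) (\<lambda>x y. pt 1 V x y - pt 1 Y x y - ?J x y)"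
    "psd_on {..<d_in 1} (\<lambda>i j. of_real \<mu> * (if i = j then 1 else 0) - tr_out 1 V i j - tr_out 1 Y i j - 0)"
    using assms(1) unfolding primal_feasible_def by blast
  have sub: "flat 1 V - flat 1 Y = flat 1 (\<lambda>x y. V x y - Y x y)"
    by (rule eq_matI) (auto simp: flat_def)
  have "ptrans [a, b, a', b'] {1, 3} (flat 1 V - flat 1 Y) - choi (a * b) (a' * b') N =
      flat 1 (\<lambda>x y. pt 1 V x y - pt 1 Y x y - ?J x y)"
    unfolding sub ptrans_two_parties choi_flat[of 1, unfolded d] by (rule eq_matI) (auto simp: flat_def pt_def d simp del: One_nat_def)
  then have ge: "loewner_ge (ptrans [a, b, a', b'] {1, 3} (flat 1 V - flat 1 Y)) (choi (a * b) (a' * b') N)"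
    unfolding loewner_ge_def using V(3) psd_flat
    by (simp add: sub ptrans_two_parties del: One_nat_def) (simp add: flat_def choi_def d del: One_nat_def)
  let ?T = "\<lambda>i j. tr_out 1 V i j + tr_out 1 Y i j"
  have "ptrace_out (a * b) (a' * b') (flat 1 V + flat 1 Y) = mat (d_in 1) (d_in 1) (\<lambda>(i, j). ?T i j)"
    unfolding d[symmetric]
    by (rule eq_matI) (simp_all add: ptrace_out_def flat_def tr_out_def index_less index_div_mod sum.distrib del: One_nat_def)
  moreover have "op_norm (mat (d_in 1) (d_in 1) (\<lambda>(i, j). ?T i j)) \<le> \<mu>"
  proof (rule op_norm_le[OF _ _ assms(2)])
    show "psd_on {..<d_in 1} ?T" by (intro psd_on_add psd_tr_out V)
    show "psd_on {..<d_in 1} (\<lambda>i j. of_real \<mu> * (if i = j then 1 else 0) - ?T i j)"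
      using V(4) by (simp add: diff_diff_eq)
  qed
  ultimately have "op_norm (ptrace_out (a * b) (a' * b') (flat 1 V + flat 1 Y)) \<le> \<mu>" by simp
  moreover have "flat 1 P \<in> carrier_mat (a * b * (a' * b')) (a * b * (a' * b'))" for P
    using flat_carrier[of 1 P] unfolding d .
  ultimately show ?thesis
    unfolding Gamma22_values_def using ge V(1,2) psd_flat by blast
qed

section \<open>Comparison of the regularised cost with \<Gamma>\<close>

lemma root_submult:
  assumes J: "psd_on (idx 1) J" "marginal 1 1 J"
  shows "1 \<le> Inf (ppt_costs n (kpow J n))"
    and "Inf (ppt_costs (m + n) (kpow J (m + n))) \<le> Inf (ppt_costs m (kpow J m)) * Inf (ppt_costs n (kpow J n))"
proof -
  let ?S = "\<lambda>n. ppt_costs n (kpow J n)"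
  have ne: "?S n \<noteq> {}" for n by (rule ppt_costs_nonempty[OF psd_kpow[OF J(1)] marginal_kpow[OF J(2)]])
  have ge: "1 \<le> v" if "v \<in> ?S n" for v n by (rule ppt_costs_ge_1[OF marginal_kpow[OF J(2)] that])
  have bdd: "bdd_below (?S n)" for n using ge by (rule bdd_belowI)
  show ge1: "1 \<le> Inf (?S n)" for n by (rule cInf_greatest[OF ne ge])
  have *: "Inf (?S (m + n)) \<le> v * w" if "v \<in> ?S m" "w \<in> ?S n" for v w
    unfolding kpow_add by (intro cInf_lower ppt_costs_tens that) (use bdd[of "m + n"] in \<open>simp add: kpow_add\<close>)
  \<comment> \<open>The infimum is taken over the second factor first and over the first factor
    afterwards; the lower bound 1 justifies both divisions.\<close>
  have div: "Inf (?S (m + n)) / v \<le> Inf (?S n)" if "v \<in> ?S m" for v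
    using *[OF that] ge[OF that] by (intro cInf_greatest ne) (simp add: field_simps)
  have "Inf (?S (m + n)) \<le> v * Inf (?S n)" if "v \<in> ?S m" for v
    using div[OF that] ge[OF that] by (simp add: pos_divide_le_eq mult.commute)
  then have "Inf (?S (m + n)) / Inf (?S n) \<le> v" if "v \<in> ?S m" for v
    using that ge1[of n] by (simp add: pos_divide_le_eq)
  then have "Inf (?S (m + n)) / Inf (?S n) \<le> Inf (?S m)" by (rule cInf_greatest[OF ne])
  then show "Inf (?S (m + n)) \<le> Inf (?S m) * Inf (?S n)" using ge1[of n] by (simp add: field_simps)
qed

lemma gamma_PPT_inf_ge:
  assumes N: "is_channel (a * b) (a' * b') N"
  shows "gamma_PPT_inf a b a' b' N \<ge> 2 powr (R22_max a b a' b' N)"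
proof -
  define J where "J = map_kernel (d_in 1) N"
  define G where "G = Gamma22 a b a' b' N"
  define \<gamma> where "\<gamma> n = Inf (ppt_costs n (kpow J n))" for n
  have d: "d_in 1 = a * b" "d_out 1 = a' * b'" by (simp_all add: d_in_def d_out_def)
  have J: "psd_on (idx 1) J" "marginal 1 1 J"
    using N channel_kernel_trace[OF N] unfolding is_channel_def psd_choi_iff J_def marginal_def idx_def d by auto
  \<comment> \<open>\<open>lim\<close> is the limit only for a convergent sequence; termwise bounds
    pass to \<open>gamma_PPT_inf\<close> through this fact.\<close>
  have conv: "convergent (\<lambda>n. gamma_PPT_n a b a' b' N (Suc n))"
    using submultiplicative_root_convergent[of \<gamma>] root_submult[OF J]
    unfolding \<gamma>_def J_def by (simp add: gamma_PPT_n_eq)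
  have limI: "c \<le> gamma_PPT_inf a b a' b' N" if "\<And>n. 1 \<le> n \<Longrightarrow> c \<le> \<gamma> n powr (1 / real n)" for c
  proof -
    have "c \<le> gamma_PPT_n a b a' b' N (Suc n)" for n
      using that[of "Suc n"] unfolding gamma_PPT_n_eq[of "Suc n", simplified] \<gamma>_def J_def by simp
    then show ?thesis
      unfolding gamma_PPT_inf_def by (intro LIMSEQ_le_const[OF conv[unfolded convergent_LIMSEQ_iff]]) blast
  qed
  obtain g where g: "dual_feasible 1 J g"
    "\<And>\<epsilon>. 0 < \<epsilon> \<Longrightarrow> \<exists>\<mu>. primal_feasible 1 J (\<lambda>_ _. 0) \<mu> \<and> \<mu> < g + \<epsilon>"
    using strong_duality[of 1 J] psd_on_hermitian[OF J(1)] by blast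
  let ?S = "Gamma22_values N"
  \<comment> \<open>\<open>primal_feasible_lower\<close> gives only \<open>0 \<le> \<mu>\<close>;
    raising the value by \<epsilon> makes it strictly positive, as the norm estimate
    requires.\<close>
  have member: "\<exists>s\<in>?S. s \<le> \<mu> + \<epsilon>" if p: "primal_feasible 1 J (\<lambda>_ _. 0) \<mu>" and "0 < \<epsilon>" for \<mu> \<epsilon>
  proof -
    have "primal_feasible 1 (\<lambda>_ _. 0) (\<lambda>_ _. 0) \<epsilon>"
    proof -
      have "psd_on {..<d_in 1} (\<lambda>i j. of_real \<epsilon> * (if i = j then 1 else 0))"
        using \<open>0 < \<epsilon>\<close> by (intro psd_on_scale psd_on_identity) simp_all
      then show ?thesis
        unfolding primal_feasible_def by (intro exI[of _ "\<lambda>_ _. 0"]) (simp add: psd_on_zero pt_def tr_out_def)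
    qed
    from primal_feasible_add[OF p this] have "primal_feasible 1 J (\<lambda>_ _. 0) (\<mu> + \<epsilon>)" by simp
    moreover have "0 < \<mu> + \<epsilon>" using primal_feasible_lower[OF p] \<open>0 < \<epsilon>\<close> by simp
    ultimately show ?thesis unfolding J_def by (rule Gamma22_member)
  qed
  have S_ne: "?S \<noteq> {}" using g(2)[of 1] member[of _ 1] by fastforce
  have G0: "0 \<le> G" unfolding G_def Gamma22_eq by (rule cInf_greatest[OF S_ne Gamma22_values_nonneg])
  \<comment> \<open>Half of \<epsilon> pays for a primal point that is only nearly optimal, the
    other half for the slack in \<open>member\<close>.\<close>
  have "G \<le> g + \<epsilon>" if \<epsilon>: "0 < \<epsilon>" for \<epsilon>
  proof -
    obtain \<mu> where \<mu>: "primal_feasible 1 J (\<lambda>_ _. 0) \<mu>" "\<mu> < g + \<epsilon> / 2" using g(2)[of "\<epsilon> / 2"] \<epsilon> by auto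
    obtain s where s: "s \<in> ?S" "s \<le> \<mu> + \<epsilon> / 2" using member[OF \<mu>(1), of "\<epsilon> / 2"] \<epsilon> by auto
    have "G \<le> s" unfolding G_def Gamma22_eq by (rule cInf_lower[OF s(1) bdd_belowI[OF Gamma22_values_nonneg]])
    then show ?thesis using s(2) \<mu>(2) by linarith
  qed
  then have G_le: "G \<le> g" by (rule field_le_epsilon)
  show ?thesis
  proof (cases "G = 0")
    case True
    \<comment> \<open>Here the logarithm takes its junk value \<open>log 2 0 = 0\<close>, and \<open>1\<close> is a trivial lower bound.\<close>
    have "1 \<le> gamma_PPT_inf a b a' b' N"
      using root_submult(1)[OF J] by (intro limI ge_one_powr_ge_zero) (simp_all add: \<gamma>_def)
    then show ?thesis using True unfolding R22_max_def G_def by (simp add: log_def)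
  next
    case False
    then have G: "0 < G" using G0 by simp
    have "G \<le> \<gamma> n powr (1 / real n)" if n: "1 \<le> n" for n
    proof -
      have "g ^ n \<le> \<gamma> n"
        unfolding \<gamma>_def using dual_bound[OF dual_feasible_kpow[OF g(1)]]
        by (intro cInf_greatest ppt_costs_nonempty[OF psd_kpow[OF J(1)] marginal_kpow[OF J(2)]])
      moreover have "G ^ n \<le> g ^ n" using G G_le by (intro power_mono) auto
      ultimately have "(G ^ n) powr (1 / real n) \<le> \<gamma> n powr (1 / real n)"
        using G by (intro powr_mono2) auto
      moreover have "(G ^ n) powr (1 / real n) = G"
        using G n by (simp add: powr_realpow[symmetric] powr_powr)
      ultimately show ?thesis by simp
    qed
    then have "G \<le> gamma_PPT_inf a b a' b' N" by (rule limI)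
    then show ?thesis using G unfolding R22_max_def G_def by simp
  qed
qed

end

theorem theoremS3:
  fixes dA dB dA' dB' :: nat and N :: "complex mat \<Rightarrow> complex mat"
  assumes "dA > 0" "dB > 0" "dA' > 0" "dB' > 0"
    and "is_channel (dA * dB) (dA' * dB') N"
  shows "gamma_PPT_inf dA dB dA' dB' N \<ge> 2 powr (R22_max dA dB dA' dB' N)"
proof -
  interpret bipartite_dims dA dB dA' dB' using assms by unfold_locales
  show ?thesis by (rule gamma_PPT_inf_ge[OF assms(5)])
qed

end
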